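(* Let $N\ge1$ and $0\le r\le N$. There exist constants $C_1,C_2>0$ such that for all $u\in L^1(T_N,\Lambda^r)$ with $du=0$ and all $L>0$ there exists $v\in L^\infty(T_N,\Lambda^r)$ with $dv=0$ and (i) $\|v\|_{L^\infty(T_N,\Lambda^r)}\le C_1L$; (ii) $|\{y\in T_N: v(y)\neq u(y)\}|\le \frac{C_2}{L}\int_{\{y\in T_N:|u(y)|>L\}}|u(y)|\,dy$; (iii) $\|v-u\|_{L^1(T_N,\Lambda^r)}\le C_2\int_{\{y\in T_N:|u(y)|>L\}}|u(y)|\,dy$.
   Context: $T_N=\mathbb R^N/\mathbb Z^N$ is the $N$-torus (functions on it identified with $\mathbb Z^N$-periodic functions), with Lebesgue measure $|\cdot|$. $\Lambda^r$ is the $r$-fold exterior power of $(\mathbb R^N)^*$ with the Euclidean norm $|\cdot|$ in the basis $\theta_{k_1}\wedge\dots\wedge\theta_{k_r}$ ($k_1<\dots<k_r$). $d$ is the exterior derivative, understood in the sense of distributions: $dw=0$ means $\int_{T_N}d\phi\wedge w=0$ for all $\phi\in C^\infty(T_N,\Lambda^{N-r-1})$. *)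

theory Defs
  imports "HOL-Analysis.Analysis"
begin

text \<open>The torus T_N is represented by the unit cube cbox 0 1 in real^'n (with 'n a finite,
linearly ordered index type, CARD('n) = N); boundary has measure zero. Test functions are
Z^N-periodic smooth functions on real^'n.  An r-form w is a function assigning to each point a
coefficient family indexed by sets K of coordinates; only the K with card K = r are used
(coefficient of theta_{k_1} wedge ... wedge theta_{k_r}, k_1 < ... < k_r, K = {k_1,...,k_r}).\<close>

definition torus_cube :: "(real^'n) set" where
  "torus_cube = cbox 0 1"

definition periodic_fun :: "(real^'n \<Rightarrow> real) \<Rightarrow> bool" where
  "periodic_fun f \<longleftrightarrow> (\<forall>x v. (\<forall>i. v $ i \<in> \<int>) \<longrightarrow> f (x + v) = f x)"

definition pderiv :: "'n \<Rightarrow> (real^'n \<Rightarrow> real) \<Rightarrow> real^'n \<Rightarrow> real" where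
  "pderiv j f x = frechet_derivative f (at x) (axis j 1)"

fun Ck :: "nat \<Rightarrow> (real^'n \<Rightarrow> real) \<Rightarrow> bool" where
  "Ck 0 f = continuous_on UNIV f"
| "Ck (Suc k) f = (f differentiable_on UNIV \<and> continuous_on UNIV f \<and> (\<forall>j. Ck k (pderiv j f)))"

definition smooth_fun :: "(real^'n \<Rightarrow> real) \<Rightarrow> bool" where
  "smooth_fun f \<longleftrightarrow> (\<forall>k. Ck k f)"

definition form_norm :: "nat \<Rightarrow> ('n set \<Rightarrow> real) \<Rightarrow> real" where
  "form_norm r a = sqrt (\<Sum>K\<in>{K. card K = r}. (a K)\<^sup>2)"

definition form_neq :: "nat \<Rightarrow> ('n set \<Rightarrow> real) \<Rightarrow> ('n set \<Rightarrow> real) \<Rightarrow> bool" where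
  "form_neq r a b \<longleftrightarrow> (\<exists>K. card K = r \<and> a K \<noteq> b K)"

text \<open>Distributional closedness dw = 0 for an r-form w on T_N: for all smooth
(N-r-1)-forms phi, integral of d phi wedge w vanishes.  Written componentwise: for each
(r+1)-set J of coordinates (complement of the index set of a component of phi) and every smooth
periodic scalar phi,
  sum_{j in J} (-1)^{#{k in J. k < j}} integral w_{J - {j}} * d_j phi = 0.\<close>
definition closed_form :: "nat \<Rightarrow> (real^'n::{finite,linorder} \<Rightarrow> ('n set \<Rightarrow> real)) \<Rightarrow> bool" where
  "closed_form r w \<longleftrightarrow>
     (\<forall>J \<phi>. card J = Suc r \<and> smooth_fun \<phi> \<and> periodic_fun \<phi> \<longrightarrow>
        (\<Sum>j\<in>J. (-1::real) ^ card {k\<in>J. k < j} *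
            (LINT x:torus_cube|lebesgue. w x (J - {j}) * pderiv j \<phi> x)) = 0)"

end

theory Submission
  imports Defs
begin

text \<open>The truncation averages pullbacks: \<open>v\<close> is the mean over \<open>y\<close> in the unit ball of the pullback of
  \<open>u\<close> under \<open>x \<mapsto> x + e(x) y\<close>, where \<open>e\<close> is a \<open>C\<^sup>1\<close> function comparable to the distance from a closed
  set \<open>X\<close> and with small gradient. Pullbacks of closed forms are closed. On \<open>X\<close> the map is the identity,
  so \<open>v = u\<close> there; off \<open>X\<close> the value \<open>v(x)\<close> is bounded by the mean of \<open>|u|\<close> over a ball of radius
  comparable to the distance from \<open>X\<close>. The complement of \<open>X\<close> consists of the points where the maximal
  function of \<open>|u| 1\<^bsub>|u| > L\<^esub>\<close> exceeds \<open>L\<close>, together with an open neighbourhood of \<open>{|u| > L}\<close> of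
  comparable measure; so its measure is at most a constant times \<open>(1/L) \<integral>\<^bsub>|u| > L\<^esub> |u|\<close>, and \<open>v\<close> is at
  most a constant times \<open>L\<close>. Since \<open>e\<close> is only Lipschitz across the boundary of \<open>X\<close>, it is approximated by
  globally \<open>C\<^sup>1\<close> functions that are eventually equal to it at every point off \<open>X\<close>.\<close>

section \<open>The torus as a fundamental cell\<close>

definition int_lattice :: "(real^'n) set" where
  "int_lattice = {k. \<forall>i. k $ i \<in> \<int>}"

definition unit_cell :: "(real^'n) set" where
  "unit_cell = {x. \<forall>i. 0 \<le> x $ i \<and> x $ i < 1}"

definition wrap :: "real^'n \<Rightarrow> real^'n" where
  "wrap x = (\<chi> i. frac (x $ i))"

definition torus :: "(real^'n) measure" where
  "torus = density lborel (indicator unit_cell)"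

definition lattice_periodic :: "(real^'n \<Rightarrow> 'b) \<Rightarrow> bool" where
  "lattice_periodic f \<longleftrightarrow> (\<forall>x. \<forall>k\<in>int_lattice. f (x + k) = f x)"

definition lattice_invariant :: "(real^'n) set \<Rightarrow> bool" where
  "lattice_invariant S \<longleftrightarrow> (\<forall>x\<in>S. \<forall>k\<in>int_lattice. x + k \<in> S)"

definition lattice_hull :: "(real^'n) set \<Rightarrow> (real^'n) set" where
  "lattice_hull S = {x. \<exists>k\<in>int_lattice. x + k \<in> S}"

subsection \<open>The integer lattice\<close>

lemma zero_in_int_lattice [simp]: "0 \<in> int_lattice"
  by (simp add: int_lattice_def)

lemma int_lattice_uminus [simp]: "- k \<in> int_lattice \<longleftrightarrow> k \<in> int_lattice"
  by (simp add: int_lattice_def)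

lemma int_lattice_add: "k \<in> int_lattice \<Longrightarrow> l \<in> int_lattice \<Longrightarrow> k + l \<in> int_lattice"
  by (simp add: int_lattice_def)

lemma int_lattice_eq_floor: "k \<in> int_lattice \<Longrightarrow> k = (\<chi> i. real_of_int \<lfloor>k $ i\<rfloor>)"
  by (auto simp: int_lattice_def vec_eq_iff elim!: Ints_cases)

lemma countable_int_lattice: "countable (int_lattice :: (real^'n) set)"
proof (rule countable_subset)
  show "int_lattice \<subseteq> range (\<lambda>f :: 'n \<Rightarrow> int. \<chi> i. real_of_int (f i))"
    by (auto intro!: range_eqI int_lattice_eq_floor)
qed simp

lemma closed_int_lattice: "closed (int_lattice :: (real^'n) set)"
proof -
  have "int_lattice = (\<Inter>i. {k :: real^'n. k $ i \<in> \<int>})"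
    by (auto simp: int_lattice_def)
  moreover have "closed {k :: real^'n. k $ i \<in> \<int>}" for i
    using continuous_closed_vimage[OF closed_Ints, of "\<lambda>k::real^'n. k $ i"]
    by (simp add: vimage_def continuous_on_eq_continuous_at)
  ultimately show ?thesis by (metis closed_INT)
qed

lemma finite_int_lattice_norm_le: "finite {k \<in> int_lattice :: (real^'n) set. norm k \<le> R}"
proof (rule finite_subset)
  let ?A = "{\<lfloor>- R\<rfloor> .. \<lfloor>R\<rfloor>}"
  show "{k \<in> int_lattice :: (real^'n) set. norm k \<le> R} \<subseteq> (\<lambda>f. \<chi> i. real_of_int (f i)) ` (UNIV \<rightarrow>\<^sub>E ?A)"
  proof
    fix k :: "real^'n" assume k: "k \<in> {k \<in> int_lattice. norm k \<le> R}"
    then have "- R \<le> k $ i \<and> k $ i \<le> R" for i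
      using component_le_norm_cart[of k i] by auto
    then have "\<lfloor>k $ i\<rfloor> \<in> ?A" for i
      by (simp add: floor_mono)
    moreover have "k = (\<chi> i. real_of_int \<lfloor>k $ i\<rfloor>)"
      using k by (intro int_lattice_eq_floor) simp
    ultimately show "k \<in> (\<lambda>f. \<chi> i. real_of_int (f i)) ` (UNIV \<rightarrow>\<^sub>E ?A)"
      by (intro image_eqI[where x="\<lambda>i. \<lfloor>k $ i\<rfloor>"]) auto
  qed
qed (intro finite_imageI finite_PiE; simp)

subsection \<open>Reduction to the unit cell\<close>

lemma wrap_in_unit_cell: "wrap x \<in> unit_cell"
  by (simp add: wrap_def unit_cell_def frac_lt_1)

lemma norm_unit_cell_le:
  fixes x :: "real^'n" assumes "x \<in> unit_cell" shows "norm x \<le> CARD('n)"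
proof -
  have "norm x \<le> (\<Sum>i\<in>UNIV. \<bar>x $ i\<bar>)" by (rule norm_le_l1_cart)
  also have "\<dots> \<le> (\<Sum>i\<in>(UNIV::'n set). 1)"
    using assms by (intro sum_mono) (auto simp: unit_cell_def less_imp_le)
  finally show ?thesis by simp
qed

lemma norm_wrap_le: "norm (wrap (x :: real^'n)) \<le> CARD('n)"
  by (rule norm_unit_cell_le[OF wrap_in_unit_cell])

lemma wrap_diff_int_lattice: "wrap x - x \<in> int_lattice"
  by (auto simp: wrap_def int_lattice_def frac_def)

lemma wrap_unique:
  assumes "k \<in> int_lattice" "x + k \<in> unit_cell"
  shows "x + k = wrap x"
proof -
  have "x $ i + k $ i = frac (x $ i)" for i
  proof -
    obtain m where m: "k $ i = of_int m"
      using assms(1) by (auto simp: int_lattice_def elim!: Ints_cases)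
    have "0 \<le> x $ i + k $ i" "x $ i + k $ i < 1"
      using assms(2) by (auto simp: unit_cell_def)
    then have "\<lfloor>x $ i\<rfloor> = - m" unfolding m by linarith
    then show ?thesis by (simp add: m frac_def)
  qed
  then show ?thesis by (simp add: vec_eq_iff wrap_def)
qed

lemma wrap_id: "x \<in> unit_cell \<Longrightarrow> wrap x = x"
  using wrap_unique[of 0 x] by simp

lemma wrap_add: "k \<in> int_lattice \<Longrightarrow> wrap (x + k) = wrap x"
  using wrap_unique[of "k + (wrap (x + k) - (x + k))" x] wrap_in_unit_cell[of "x + k"]
    int_lattice_add[OF _ wrap_diff_int_lattice, of k "x + k"]
  by simp

subsection \<open>Periodic functions and invariant sets\<close>

lemma lattice_periodicD: "lattice_periodic f \<Longrightarrow> k \<in> int_lattice \<Longrightarrow> f (x + k) = f x"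
  by (simp add: lattice_periodic_def)

lemma lattice_periodicI: "(\<And>x k. k \<in> int_lattice \<Longrightarrow> f (x + k) = f x) \<Longrightarrow> lattice_periodic f"
  by (simp add: lattice_periodic_def)

lemma lattice_periodic_wrap: "lattice_periodic f \<Longrightarrow> f (wrap x) = f x"
  using lattice_periodicD[of f "wrap x - x" x] by (simp add: wrap_diff_int_lattice)

lemma lattice_periodic_comp_wrap: "lattice_periodic (\<lambda>x. f (wrap x))"
  by (simp add: lattice_periodic_def wrap_add)

lemma lattice_periodic_const: "lattice_periodic (\<lambda>x. c)"
  by (simp add: lattice_periodic_def)

lemma lattice_periodic_compose: "lattice_periodic f \<Longrightarrow> lattice_periodic (\<lambda>x. h (f x))"
  by (simp add: lattice_periodic_def)

lemma lattice_periodic_add: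
  "lattice_periodic f \<Longrightarrow> lattice_periodic g \<Longrightarrow> lattice_periodic (\<lambda>x. f x + g x)"
  by (simp add: lattice_periodic_def)

lemma lattice_periodic_mult:
  "lattice_periodic f \<Longrightarrow> lattice_periodic g \<Longrightarrow> lattice_periodic (\<lambda>x. f x * g x)"
  by (simp add: lattice_periodic_def)

lemma lattice_periodic_translate:
  assumes "lattice_periodic f" shows "lattice_periodic (\<lambda>x. f (x + c))"
proof (rule lattice_periodicI)
  fix x k :: "real^'a" assume "k \<in> int_lattice"
  from lattice_periodicD[OF assms this, of "x + c"] show "f (x + k + c) = f (x + c)"
    by (simp add: add_ac)
qed

lemma lattice_periodic_reflect:
  assumes "lattice_periodic f" shows "lattice_periodic (\<lambda>x. f (c - x))"
proof (rule lattice_periodicI)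
  fix x k :: "real^'a" assume "k \<in> int_lattice"
  with lattice_periodicD[OF assms, of "- k" "c - x"] show "f (c - (x + k)) = f (c - x)"
    by (simp add: algebra_simps)
qed

lemma periodic_fun_iff: "periodic_fun f \<longleftrightarrow> lattice_periodic f"
  by (auto simp: periodic_fun_def lattice_periodic_def int_lattice_def)

lemma lattice_invariantD: "lattice_invariant S \<Longrightarrow> k \<in> int_lattice \<Longrightarrow> x \<in> S \<Longrightarrow> x + k \<in> S"
  by (simp add: lattice_invariant_def)

lemma lattice_invariant_Un:
  "lattice_invariant S \<Longrightarrow> lattice_invariant T \<Longrightarrow> lattice_invariant (S \<union> T)"
  by (auto simp: lattice_invariant_def)

lemma lattice_invariant_Compl:
  assumes "lattice_invariant S" shows "lattice_invariant (- S)"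
  unfolding lattice_invariant_def
proof (intro ballI ComplI)
  fix x k assume "x \<in> - S" "k \<in> int_lattice" "x + k \<in> S"
  then show False
    using lattice_invariantD[OF assms, of "- k" "x + k"] by simp
qed

lemma lattice_invariant_hull: "lattice_invariant (lattice_hull S)"
  unfolding lattice_invariant_def lattice_hull_def
proof safe
  fix x k l :: "real^'a" assume "k \<in> int_lattice" "l \<in> int_lattice" "x + l \<in> S"
  then show "\<exists>l\<in>int_lattice. x + k + l \<in> S"
    using int_lattice_add[of l "- k"] by (intro bexI[of _ "l - k"]) auto
qed

lemma lattice_hull_iff_wrap:
  assumes "S \<subseteq> unit_cell" shows "x \<in> lattice_hull S \<longleftrightarrow> wrap x \<in> S"
proof
  assume "x \<in> lattice_hull S"
  then obtain k where k: "k \<in> int_lattice" "x + k \<in> S" by (auto simp: lattice_hull_def)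
  then have "x + k = wrap x" using assms by (intro wrap_unique) auto
  with k show "wrap x \<in> S" by simp
next
  assume "wrap x \<in> S"
  then show "x \<in> lattice_hull S"
    unfolding lattice_hull_def by (intro CollectI bexI[OF _ wrap_diff_int_lattice[of x]]) simp
qed

lemma lattice_hull_eq_UN: "lattice_hull S = (\<Union>k\<in>int_lattice. (\<lambda>x. x + k) -` S)"
  by (auto simp: lattice_hull_def)

lemma open_lattice_hull: "open S \<Longrightarrow> open (lattice_hull S)"
  unfolding lattice_hull_eq_UN by (intro open_UN ballI open_vimage continuous_intros)

lemma lattice_hull_borel [measurable]: "S \<in> sets borel \<Longrightarrow> lattice_hull S \<in> sets borel"
proof -
  assume [measurable]: "S \<in> sets borel"
  have "(\<lambda>x. x + k) -` S \<inter> space borel \<in> sets borel" for k :: "real^'a"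
    by measurable
  then show "lattice_hull S \<in> sets borel"
    unfolding lattice_hull_eq_UN by (intro sets.countable_UN' countable_int_lattice) auto
qed

lemma closed_lattice_hull: "compact S \<Longrightarrow> closed (lattice_hull S)"
proof -
  assume S: "compact S"
  have "lattice_hull S = (\<Union>x\<in>S. \<Union>k\<in>int_lattice. {x + k})"
  proof (intro equalityI subsetI)
    fix x assume "x \<in> lattice_hull S"
    then obtain k where "k \<in> int_lattice" "x + k \<in> S" by (auto simp: lattice_hull_def)
    then show "x \<in> (\<Union>x\<in>S. \<Union>k\<in>int_lattice. {x + k})"
      by (intro UN_I[of "x + k"] UN_I[of "- k"]) simp_all
  next
    fix x assume "x \<in> (\<Union>x\<in>S. \<Union>k\<in>int_lattice. {x + k})"
    then obtain p k where "p \<in> S" "k \<in> int_lattice" "x = p + k" by auto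
    then show "x \<in> lattice_hull S"
      unfolding lattice_hull_def by (intro CollectI bexI[of _ "- k"]) simp_all
  qed
  then show "closed (lattice_hull S)"
    using compact_closed_sums[OF S closed_int_lattice] by simp
qed

lemma lattice_periodic_infdist:
  assumes "lattice_invariant H"
  shows "lattice_periodic (\<lambda>x. infdist x H)"
proof (cases "H = {}")
  case False
  have infdist_add_le: "infdist (x + k) H \<le> infdist x H" if k: "k \<in> int_lattice" for x k
    unfolding infdist_notempty[OF False]
  proof (rule cINF_mono[OF False])
    show "bdd_below (dist (x + k) ` H)" by (auto intro!: bdd_belowI[of _ 0])
    show "\<exists>n\<in>H. dist (x + k) n \<le> dist x m" if "m \<in> H" for m
      by (rule bexI[of _ "m + k"]) (use that lattice_invariantD[OF assms k] in auto)
  qed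
  show ?thesis
  proof (rule lattice_periodicI)
    fix x k :: "real^'a" assume "k \<in> int_lattice"
    then show "infdist (x + k) H = infdist x H"
      using infdist_add_le[of k x] infdist_add_le[of "- k" "x + k"] by simp
  qed
qed (simp add: infdist_def lattice_periodic_const)

lemma infdist_lattice_invariant_le:
  fixes H :: "(real^'n) set"
  assumes "lattice_invariant H" "H \<noteq> {}"
  shows "infdist x H \<le> CARD('n)"
proof -
  obtain p where p: "p \<in> H" using assms(2) by blast
  define k where "k = x - p - wrap (x - p)"
  have "- k \<in> int_lattice"
    using wrap_diff_int_lattice[of "x - p"] by (simp add: k_def)
  then have "p + k \<in> H"
    using p assms(1) by (simp add: lattice_invariantD)
  then have "infdist x H \<le> dist x (p + k)" by (rule infdist_le)
  also have "\<dots> = norm (wrap (x - p))" by (simp add: dist_norm k_def)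
  finally show ?thesis using norm_wrap_le[of "x - p"] by simp
qed

subsection \<open>Integration over the torus\<close>

lemma measurable_vec_nth [measurable]: "(\<lambda>x :: real^'n. x $ i) \<in> borel_measurable borel"
  by (intro borel_measurable_continuous_onI continuous_intros)

lemma wrap_measurable [measurable]: "wrap \<in> borel_measurable borel"
  by (subst borel_measurable_euclidean_space)
    (auto simp: Basis_vec_def inner_axis wrap_def frac_def)

lemma unit_cell_borel [measurable]: "unit_cell \<in> sets borel"
proof -
  have "unit_cell = (\<Inter>i. {x \<in> space borel. 0 \<le> x $ i \<and> x $ i < 1} :: (real^'n) set)"
    by (auto simp: unit_cell_def)
  also have "\<dots> \<in> sets borel" by measurable
  finally show ?thesis .
qed

lemma sets_torus [simp, measurable_cong]: "sets torus = sets borel"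
  by (simp add: torus_def)

lemma space_torus [simp]: "space torus = UNIV"
  by (simp add: torus_def)

lemma unit_cell_bounds: "box 0 (1 :: real^'n) \<subseteq> unit_cell" "unit_cell \<subseteq> cbox 0 (1 :: real^'n)"
  by (auto simp: unit_cell_def mem_box_cart less_imp_le)

lemma emeasure_unit_cell: "emeasure lborel (unit_cell :: (real^'n) set) = 1"
proof (rule antisym)
  have unit_box: "(\<Prod>b\<in>Basis. (1 :: real^'n) \<bullet> b) = 1" "\<forall>b\<in>Basis. 0 \<le> (1 :: real^'n) \<bullet> b"
    by (auto intro!: prod.neutral simp: Basis_vec_def inner_axis)
  show "emeasure lborel (unit_cell :: (real^'n) set) \<le> 1"
    using emeasure_mono[OF unit_cell_bounds(2)[where 'n='n], of lborel] unit_box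
    by (simp add: emeasure_lborel_cbox_eq)
  show "1 \<le> emeasure lborel (unit_cell :: (real^'n) set)"
    using emeasure_mono[OF unit_cell_bounds(1)[where 'n='n], of lborel] unit_box
    by (simp add: emeasure_lborel_box_eq)
qed

lemma emeasure_torus_UNIV [simp]: "emeasure (torus :: (real^'n) measure) UNIV = 1"
  using emeasure_unit_cell by (simp add: torus_def emeasure_density)

interpretation torus: finite_measure "torus :: (real^'n) measure"
  by standard simp

lemma measure_torus_UNIV [simp]: "measure (torus :: (real^'n) measure) UNIV = 1"
  by (simp add: measure_def)

lemma AE_torus_iff: "(AE x in torus. P x) \<longleftrightarrow> (AE x in lborel. x \<in> unit_cell \<longrightarrow> P x)"
  unfolding torus_def by (subst AE_density) (auto simp: indicator_def)

lemma nn_integral_torus: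
  "f \<in> borel_measurable borel \<Longrightarrow> (\<integral>\<^sup>+x. f x \<partial>torus) = (\<integral>\<^sup>+x. indicator unit_cell x * f x \<partial>lborel)"
  by (simp add: torus_def nn_integral_density)

lemma lborel_nn_integral_translate:
  fixes f :: "'a::euclidean_space \<Rightarrow> ennreal"
  assumes [measurable]: "f \<in> borel_measurable borel"
  shows "(\<integral>\<^sup>+x. f (x + c) \<partial>lborel) = (\<integral>\<^sup>+x. f x \<partial>lborel)"
proof -
  have "(\<integral>\<^sup>+x. f x \<partial>lborel) = (\<integral>\<^sup>+x. f x \<partial>distr lborel borel ((+) c))"
    by (simp add: lborel_distr_plus)
  also have "\<dots> = (\<integral>\<^sup>+x. f (c + x) \<partial>lborel)"
    by (rule nn_integral_distr) auto
  finally show ?thesis by (simp add: add.commute)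
qed

definition periodization :: "(real^'n \<Rightarrow> ennreal) \<Rightarrow> real^'n \<Rightarrow> ennreal" where
  "periodization h x = (\<integral>\<^sup>+k. h (x + k) \<partial>count_space int_lattice)"

lemma periodization_measurable [measurable]:
  assumes [measurable]: "h \<in> borel_measurable borel"
  shows "periodization h \<in> borel_measurable borel"
proof -
  interpret sigma_finite_measure "count_space (int_lattice :: (real^'a) set)"
    by (rule sigma_finite_measure_count_space_countable[OF countable_int_lattice])
  have "(\<lambda>p. h (fst p + snd p)) \<in> borel_measurable (borel \<Otimes>\<^sub>M count_space int_lattice)"
    by (rule measurable_compose_countable'[OF _ _ countable_int_lattice, where f="\<lambda>k p. h (fst p + k)" and g=snd]) auto
  then show ?thesis
    unfolding periodization_def by (intro borel_measurable_nn_integral) (simp add: case_prod_beta')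
qed

lemma periodization_indicator_unit_cell: "periodization (indicator unit_cell) x = 1"
proof -
  have "periodization (indicator unit_cell) x = (\<integral>\<^sup>+k. indicator {wrap x - x} k \<partial>count_space int_lattice)"
    unfolding periodization_def
  proof (rule nn_integral_cong)
    fix k :: "real^'a" assume "k \<in> space (count_space int_lattice)"
    then have "x + k \<in> unit_cell \<longleftrightarrow> k \<in> {wrap x - x}"
      using wrap_unique[of k x] wrap_in_unit_cell[of x] by (auto simp: algebra_simps)
    then show "indicator unit_cell (x + k) = (indicator {wrap x - x} k :: ennreal)"
      by (simp only: indicator_def)
  qed
  also have "\<dots> = 1"
    using wrap_diff_int_lattice[of x] by (simp add: nn_integral_indicator emeasure_count_space)
  finally show ?thesis .
qed

lemma indicator_lattice_hull_le_periodization: "indicator (lattice_hull S) x \<le> periodization (indicator S) x"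
proof (cases "x \<in> lattice_hull S")
  case True
  then obtain k where k: "k \<in> int_lattice" "x + k \<in> S" by (auto simp: lattice_hull_def)
  have "(1::ennreal) = (\<integral>\<^sup>+l. indicator {k} l \<partial>count_space int_lattice)"
    using k by (simp add: nn_integral_indicator emeasure_count_space)
  also have "\<dots> \<le> periodization (indicator S) x"
    unfolding periodization_def using k by (intro nn_integral_mono) (auto split: split_indicator)
  finally show ?thesis using True by simp
qed simp

lemma nn_integral_mult_sum_lattice_translates:
  fixes g :: "real^'n \<Rightarrow> ennreal"
  assumes [measurable]: "g \<in> borel_measurable borel"
  shows "(\<integral>\<^sup>+x. g x \<partial>lborel) = (\<integral>\<^sup>+k. (\<integral>\<^sup>+x. indicator unit_cell x * g (x + k) \<partial>lborel) \<partial>count_space int_lattice)"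
proof -
  have uminus_bij: "bij_betw uminus (int_lattice :: (real^'n) set) int_lattice"
    by (rule bij_betwI[where g=uminus]) auto
  have "(\<integral>\<^sup>+x. g x \<partial>lborel) = (\<integral>\<^sup>+x. (\<integral>\<^sup>+k. indicator unit_cell (x + k) * g x \<partial>count_space int_lattice) \<partial>lborel)"
    by (simp add: nn_integral_multc periodization_indicator_unit_cell[unfolded periodization_def])
  also have "\<dots> = (\<integral>\<^sup>+k. (\<integral>\<^sup>+x. indicator unit_cell (x + k) * g x \<partial>lborel) \<partial>count_space int_lattice)"
    by (rule nn_integral_count_space_nn_integral[OF countable_int_lattice]) measurable
  also have "\<dots> = (\<integral>\<^sup>+k. (\<integral>\<^sup>+x. indicator unit_cell (x + - k) * g x \<partial>lborel) \<partial>count_space int_lattice)"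
    by (subst nn_integral_bij_count_space[OF uminus_bij, symmetric]) simp
  also have "\<dots> = (\<integral>\<^sup>+k. (\<integral>\<^sup>+x. indicator unit_cell x * g (x + k) \<partial>lborel) \<partial>count_space int_lattice)"
  proof (rule nn_integral_cong)
    fix k :: "real^'n"
    show "(\<integral>\<^sup>+x. indicator unit_cell (x + - k) * g x \<partial>lborel) = (\<integral>\<^sup>+x. indicator unit_cell x * g (x + k) \<partial>lborel)"
      using lborel_nn_integral_translate[of "\<lambda>x. indicator unit_cell (x + - k) * g x" k] by simp
  qed
  finally show ?thesis .
qed

lemma nn_integral_unfold_torus:
  assumes f [measurable]: "f \<in> borel_measurable borel" and per: "lattice_periodic f"
    and h [measurable]: "h \<in> borel_measurable borel"
  shows "(\<integral>\<^sup>+x. h x * f x \<partial>lborel) = (\<integral>\<^sup>+x. periodization h x * f x \<partial>torus)"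
proof -
  have "(\<integral>\<^sup>+x. h x * f x \<partial>lborel)
      = (\<integral>\<^sup>+k. (\<integral>\<^sup>+x. indicator unit_cell x * (h (x + k) * f (x + k)) \<partial>lborel) \<partial>count_space int_lattice)"
    by (rule nn_integral_mult_sum_lattice_translates) measurable
  also have "\<dots> = (\<integral>\<^sup>+k. (\<integral>\<^sup>+x. indicator unit_cell x * (h (x + k) * f x) \<partial>lborel) \<partial>count_space int_lattice)"
    using per by (intro nn_integral_cong) (simp add: lattice_periodicD)
  also have "\<dots> = (\<integral>\<^sup>+x. (\<integral>\<^sup>+k. indicator unit_cell x * (h (x + k) * f x) \<partial>count_space int_lattice) \<partial>lborel)"
    by (rule nn_integral_count_space_nn_integral[OF countable_int_lattice, symmetric]) measurable
  also have "\<dots> = (\<integral>\<^sup>+x. indicator unit_cell x * (periodization h x * f x) \<partial>lborel)"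
    by (intro nn_integral_cong) (simp add: nn_integral_cmult nn_integral_multc periodization_def)
  also have "\<dots> = (\<integral>\<^sup>+x. periodization h x * f x \<partial>torus)"
    by (rule nn_integral_torus[symmetric]) measurable
  finally show ?thesis .
qed

text \<open>The preimage of the unit cell under a map commuting with the lattice is again a fundamental domain.\<close>

lemma nn_integral_fundamental_domain:
  fixes \<theta> :: "real^'n \<Rightarrow> real^'n"
  assumes f: "f \<in> borel_measurable borel" "lattice_periodic f"
    and \<theta> [measurable]: "\<theta> \<in> borel_measurable borel" and equi: "\<And>x k. k \<in> int_lattice \<Longrightarrow> \<theta> (x + k) = \<theta> x + k"
  shows "(\<integral>\<^sup>+x. indicator unit_cell (\<theta> x) * f x \<partial>lborel) = (\<integral>\<^sup>+x. f x \<partial>torus)"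
proof -
  have "periodization (\<lambda>x. indicator unit_cell (\<theta> x)) x = periodization (indicator unit_cell) (\<theta> x)" for x
    unfolding periodization_def by (intro nn_integral_cong) (simp add: equi)
  then show ?thesis
    using nn_integral_unfold_torus[OF f, of "\<lambda>x. indicator unit_cell (\<theta> x)"]
    by (simp add: periodization_indicator_unit_cell)
qed

lemma nn_integral_torus_translate:
  fixes f :: "real^'n \<Rightarrow> ennreal"
  assumes f [measurable]: "f \<in> borel_measurable borel" and per: "lattice_periodic f"
  shows "(\<integral>\<^sup>+x. f (x + z) \<partial>torus) = (\<integral>\<^sup>+x. f x \<partial>torus)"
proof -
  have "(\<integral>\<^sup>+x. f (x + z) \<partial>torus) = (\<integral>\<^sup>+x. indicator unit_cell (x + z - z) * f (x + z) \<partial>lborel)"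
    by (simp add: nn_integral_torus)
  also have "\<dots> = (\<integral>\<^sup>+x. indicator unit_cell (x - z) * f x \<partial>lborel)"
    by (rule lborel_nn_integral_translate) measurable
  also have "\<dots> = (\<integral>\<^sup>+x. f x \<partial>torus)"
    by (rule nn_integral_fundamental_domain[OF f per]) (auto simp: algebra_simps)
  finally show ?thesis .
qed

lemma torus_distr_translate: "distr torus borel (\<lambda>x. wrap (x + z)) = torus"
proof (rule measure_eqI)
  fix A assume "A \<in> sets (distr torus borel (\<lambda>x. wrap (x + z)))"
  then have [measurable]: "A \<in> sets borel" by simp
  have "emeasure (distr torus borel (\<lambda>x. wrap (x + z))) A = (\<integral>\<^sup>+x. indicator A (wrap (x + z)) \<partial>torus)"
    by (subst nn_integral_indicator[symmetric], simp, subst nn_integral_distr) simp_all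
  also have "\<dots> = (\<integral>\<^sup>+x. indicator A (wrap x) \<partial>torus)"
    by (rule nn_integral_torus_translate) (simp_all add: lattice_periodic_comp_wrap)
  also have "\<dots> = (\<integral>\<^sup>+x. indicator A x \<partial>torus)"
    by (intro nn_integral_cong_AE) (simp add: AE_torus_iff wrap_id)
  also have "\<dots> = emeasure torus A" by simp
  finally show "emeasure (distr torus borel (\<lambda>x. wrap (x + z))) A = emeasure torus A" .
qed simp

lemma
  fixes f :: "real^'n \<Rightarrow> 'b::{banach, second_countable_topology}"
  assumes [measurable]: "f \<in> borel_measurable borel" and per: "lattice_periodic f"
  shows torus_integral_translate: "(\<integral>x. f (x + z) \<partial>torus) = (\<integral>x. f x \<partial>torus)"
    and torus_integrable_translate: "integrable torus (\<lambda>x. f (x + z)) \<longleftrightarrow> integrable torus f"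
  using integral_distr[of "\<lambda>x. wrap (x + z)" torus borel f] integrable_distr_eq[of "\<lambda>x. wrap (x + z)" torus borel f]
  by (simp_all add: torus_distr_translate lattice_periodic_wrap[OF per])

lemma emeasure_torus_lattice_hull_le:
  assumes [measurable]: "S \<in> sets borel"
  shows "emeasure torus (lattice_hull S) \<le> emeasure lborel S"
proof -
  have "emeasure torus (lattice_hull S) = (\<integral>\<^sup>+x. indicator (lattice_hull S) x \<partial>torus)" by simp
  also have "\<dots> \<le> (\<integral>\<^sup>+x. periodization (indicator S) x * 1 \<partial>torus)"
    by (intro nn_integral_mono) (simp add: indicator_lattice_hull_le_periodization)
  also have "\<dots> = (\<integral>\<^sup>+x. indicator S x * 1 \<partial>lborel)"
    by (rule nn_integral_unfold_torus[symmetric]) (simp_all add: lattice_periodic_const)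
  also have "\<dots> = emeasure lborel S" by simp
  finally show ?thesis .
qed

lemma nn_integral_cball_le_torus:
  fixes f :: "real^'n \<Rightarrow> ennreal"
  assumes f [measurable]: "f \<in> borel_measurable borel" and per: "lattice_periodic f"
  shows "(\<integral>\<^sup>+x\<in>cball 0 R. f x \<partial>lborel)
    \<le> of_nat (card {k \<in> int_lattice :: (real^'n) set. norm k \<le> R + CARD('n)}) * (\<integral>\<^sup>+x. f x \<partial>torus)"
proof -
  let ?F = "{k \<in> int_lattice :: (real^'n) set. norm k \<le> R + CARD('n)}"
  have card_bound: "periodization (indicator (cball 0 R)) x \<le> of_nat (card ?F)" if x: "x \<in> unit_cell" for x :: "real^'n"
  proof -
    have "periodization (indicator (cball 0 R)) x \<le> (\<integral>\<^sup>+k. indicator ?F k \<partial>count_space int_lattice)"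
      unfolding periodization_def
    proof (intro nn_integral_mono)
      fix k :: "real^'n" assume "k \<in> space (count_space int_lattice)"
      moreover have "norm k \<le> norm (x + k) + norm x"
        using norm_triangle_ineq4[of "x + k" x] by simp
      ultimately show "indicator (cball 0 R) (x + k) \<le> (indicator ?F k :: ennreal)"
        using norm_unit_cell_le[OF x] by (auto split: split_indicator)
    qed
    also have "\<dots> = of_nat (card ?F)"
      using finite_int_lattice_norm_le[of "R + CARD('n)", where 'n='n]
      by (simp add: nn_integral_indicator emeasure_count_space Collect_conj_eq Int_ac)
    finally show ?thesis .
  qed
  have "(\<integral>\<^sup>+x\<in>cball 0 R. f x \<partial>lborel) = (\<integral>\<^sup>+x. indicator (cball 0 R) x * f x \<partial>lborel)"
    by (simp add: mult.commute)
  also have "\<dots> = (\<integral>\<^sup>+x. periodization (indicator (cball 0 R)) x * f x \<partial>torus)"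
    by (rule nn_integral_unfold_torus[OF f per]) (intro borel_measurable_indicator, simp)
  also have "\<dots> \<le> (\<integral>\<^sup>+x. of_nat (card ?F) * f x \<partial>torus)"
    by (intro nn_integral_mono_AE) (simp add: AE_torus_iff card_bound mult_right_mono)
  also have "\<dots> = of_nat (card ?F) * (\<integral>\<^sup>+x. f x \<partial>torus)"
    by (rule nn_integral_cmult) simp
  finally show ?thesis .
qed

lemma torus_integrable_bounded:
  fixes f :: "real^'n \<Rightarrow> 'b::{banach,second_countable_topology}"
  assumes "f \<in> borel_measurable borel" "\<And>x. norm (f x) \<le> B"
  shows "integrable torus f"
  using assms by (intro torus.integrable_const_bound[where B=B]) auto

lemma torus_integrable_mult_bounded:
  fixes w b :: "real^'n \<Rightarrow> real"
  assumes w: "integrable torus w" and [measurable]: "b \<in> borel_measurable borel"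
    and B: "\<And>x. norm (b x) \<le> B"
  shows "integrable torus (\<lambda>x. w x * b x)"
proof (rule Bochner_Integration.integrable_bound)
  note [measurable] = borel_measurable_integrable[OF w]
  show "integrable torus (\<lambda>x. B * w x)" using w by simp
  have "\<bar>w x\<bar> * \<bar>b x\<bar> \<le> \<bar>w x\<bar> * \<bar>B\<bar>" for x
    by (rule mult_left_mono[OF order_trans[OF B[unfolded real_norm_def] abs_ge_self]]) simp
  then show "AE x in torus. norm (w x * b x) \<le> norm (B * w x)"
    by (intro AE_I2) (simp only: real_norm_def abs_mult mult.commute)
  show "(\<lambda>x. w x * b x) \<in> borel_measurable torus" by measurable
qed

section \<open>Periodic functions of class C1\<close>

definition C1_periodic :: "(real^'n \<Rightarrow> real) \<Rightarrow> (real^'n \<Rightarrow> real^'n) \<Rightarrow> bool" where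
  "C1_periodic f f' \<longleftrightarrow> lattice_periodic f \<and> (\<forall>x. (f has_derivative (\<lambda>h. f' x \<bullet> h)) (at x)) \<and> continuous_on UNIV f'"

lemma periodic_continuous_bounded:
  fixes f :: "real^'n \<Rightarrow> 'b::real_normed_vector"
  assumes "continuous_on UNIV f" "lattice_periodic f"
  obtains B where "B > 0" "\<And>x. norm (f x) \<le> B"
proof -
  have "compact (f ` cball 0 (CARD('n)))"
    using assms(1) by (intro compact_continuous_image) (auto intro: continuous_on_subset)
  then obtain B where B: "B > 0" "\<And>y. y \<in> f ` cball 0 (CARD('n)) \<Longrightarrow> norm y \<le> B"
    using compact_imp_bounded bounded_pos by metis
  have "norm (f x) \<le> B" for x
  proof -
    have "f x = f (wrap x)" by (simp add: lattice_periodic_wrap[OF assms(2)])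
    also have "\<dots> \<in> f ` cball 0 (CARD('n))"
      using norm_wrap_le[of x] by auto
    finally show ?thesis by (rule B)
  qed
  with B(1) show thesis by (rule that)
qed

lemma periodic_continuous_uniformly:
  fixes f :: "real^'n \<Rightarrow> 'b::real_normed_vector"
  assumes "continuous_on UNIV f" and per: "lattice_periodic f" and "e > 0"
  obtains d where "d > 0" "\<And>x y. norm (x - y) < d \<Longrightarrow> norm (f x - f y) < e"
proof -
  let ?K = "cball (0::real^'n) (CARD('n) + 1)"
  have "uniformly_continuous_on ?K f"
    using assms(1) by (intro compact_uniformly_continuous) (auto intro: continuous_on_subset)
  then obtain d where d: "d > 0" "\<And>x y. x \<in> ?K \<Longrightarrow> y \<in> ?K \<Longrightarrow> dist y x < d \<Longrightarrow> dist (f y) (f x) < e"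
    using \<open>e > 0\<close> unfolding uniformly_continuous_on_def by metis
  have "norm (f x - f y) < e" if "norm (x - y) < min d 1" for x y
  proof -
    define k where "k = wrap x - x"
    have k: "k \<in> int_lattice" by (simp add: k_def wrap_diff_int_lattice)
    have "norm (x + k) \<le> CARD('n)"
      using norm_wrap_le[of x] by (simp add: k_def)
    moreover have "norm (y + k) \<le> norm (x + k) + norm (x - y)"
      using norm_triangle_ineq4[of "x + k" "x - y"] by (simp add: add.commute)
    ultimately have "dist (f (x + k)) (f (y + k)) < e"
      using that by (intro d(2)) (auto simp: mem_cball_0 dist_norm simp del: mem_cball)
    then show ?thesis
      using lattice_periodicD[OF per k] by (simp add: dist_norm)
  qed
  then show thesis using d(1) that[of "min d 1"] by simp
qed

lemma torus_integrable_continuous: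
  fixes f :: "real^'n \<Rightarrow> 'b::{banach,second_countable_topology}"
  assumes "continuous_on UNIV f" "lattice_periodic f"
  shows "integrable torus f"
proof -
  obtain B where "\<And>x. norm (f x) \<le> B" using periodic_continuous_bounded[OF assms] by metis
  with assms show ?thesis by (intro torus_integrable_bounded borel_measurable_continuous_onI)
qed

lemma C1_periodicD:
  assumes "C1_periodic f f'"
  shows C1_periodic_periodic: "lattice_periodic f"
    and C1_periodic_has_derivative: "\<And>x. (f has_derivative (\<lambda>h. f' x \<bullet> h)) (at x)"
    and C1_periodic_gradient_continuous: "continuous_on UNIV f'"
    and C1_periodic_continuous: "continuous_on UNIV f"
proof -
  show derivative: "(f has_derivative (\<lambda>h. f' x \<bullet> h)) (at x)" for x
    using assms by (simp add: C1_periodic_def)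
  show "continuous_on UNIV f"
    using has_derivative_continuous[OF derivative] by (simp add: continuous_at_imp_continuous_on)
qed (use assms in \<open>simp_all add: C1_periodic_def\<close>)

lemma C1_periodic_gradient_periodic:
  assumes "C1_periodic f f'"
  shows "lattice_periodic f'"
proof (rule lattice_periodicI)
  fix x k :: "real^'a" assume k: "k \<in> int_lattice"
  have "((\<lambda>x. f (x + k)) has_derivative (\<lambda>h. f' (x + k) \<bullet> h)) (at x)"
    by (rule has_derivative_compose[of "\<lambda>x. x + k" "\<lambda>h. h" x UNIV f "\<lambda>h. f' (x + k) \<bullet> h"])
       (auto intro!: derivative_eq_intros C1_periodic_has_derivative[OF assms])
  then have "(f has_derivative (\<lambda>h. f' (x + k) \<bullet> h)) (at x)"
    using lattice_periodicD[OF C1_periodic_periodic[OF assms] k] by simp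
  with C1_periodic_has_derivative[OF assms, of x] have "(\<lambda>h. f' (x + k) \<bullet> h) = (\<lambda>h. f' x \<bullet> h)"
    by (rule has_derivative_unique[rotated])
  then show "f' (x + k) = f' x"
    by (metis vector_eq_rdot)
qed

lemma C1_periodic_bounds:
  assumes "C1_periodic f f'"
  obtains B where "B > 0" "\<And>x. \<bar>f x\<bar> \<le> B" "\<And>x. norm (f' x) \<le> B"
proof -
  obtain B1 where "B1 > 0" "\<And>x. norm (f x) \<le> B1"
    by (rule periodic_continuous_bounded[OF C1_periodicD(4,1)[OF assms]]) auto
  moreover obtain B2 where "B2 > 0" "\<And>x. norm (f' x) \<le> B2"
    by (rule periodic_continuous_bounded[OF C1_periodicD(3)[OF assms] C1_periodic_gradient_periodic[OF assms]]) auto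
  ultimately show thesis
    by (intro that[of "max B1 B2"]) (auto simp: le_max_iff_disj)
qed

lemma C1_periodic_measurable:
  assumes "C1_periodic f f'"
  shows "f \<in> borel_measurable borel" "f' \<in> borel_measurable borel"
  using C1_periodicD(3,4)[OF assms] by (auto intro: borel_measurable_continuous_onI)

subsection \<open>Differentiation under the integral sign\<close>

lemma abs_inner_le: "norm v \<le> B \<Longrightarrow> \<bar>v \<bullet> w\<bar> \<le> B * norm w"
  by (rule order_trans[OF Cauchy_Schwarz_ineq2 mult_right_mono]) simp_all

lemma gradient_bounded_imp_lipschitz:
  fixes f :: "'a::real_inner \<Rightarrow> real"
  assumes "\<And>x. (f has_derivative (\<lambda>h. f' x \<bullet> h)) (at x)" "\<And>x. norm (f' x) \<le> B"
  shows "\<bar>f x - f y\<bar> \<le> B * norm (x - y)"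
proof -
  have "norm (f x - f y) \<le> B * norm (x - y)"
  proof (rule differentiable_bound[where S=UNIV and f'="\<lambda>x h. f' x \<bullet> h"])
    show "onorm (\<lambda>h. f' z \<bullet> h) \<le> B" for z
      using order_trans[OF norm_ge_zero assms(2)]
      by (intro onorm_bound) (simp_all add: abs_inner_le[OF assms(2)])
  qed (use assms(1) in auto)
  then show ?thesis by simp
qed

lemma gradient_remainder_bound:
  fixes f :: "'a::real_inner \<Rightarrow> real"
  assumes "\<And>x. (f has_derivative (\<lambda>h. f' x \<bullet> h)) (at x)" "\<And>x. norm (f' x) \<le> B"
  shows "\<bar>f (x + h) - f x - f' x \<bullet> h\<bar> \<le> 2 * B * norm h"
  using gradient_bounded_imp_lipschitz[of f f' B "x + h" x, OF assms] abs_inner_le[OF assms(2), of x h]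
  by simp

lemma gradient_remainder_tendsto:
  fixes f :: "'a::real_inner \<Rightarrow> real"
  assumes "(f has_derivative (\<lambda>h. f' x \<bullet> h)) (at x)" "\<And>i. X i \<noteq> 0" "X \<longlonglongrightarrow> 0"
  shows "(\<lambda>i. (f (x + X i) - f x - f' x \<bullet> X i) / norm (X i)) \<longlonglongrightarrow> 0"
proof (rule tendsto_norm_zero_cancel)
  have "((\<lambda>h. norm (f (x + h) - f x - f' x \<bullet> h) / norm h) \<longlongrightarrow> 0) (at 0)"
    using assms(1) by (simp add: has_derivative_at)
  then have "(\<lambda>i. norm (f (x + X i) - f x - f' x \<bullet> X i) / norm (X i)) \<longlonglongrightarrow> 0"
    using assms(2,3) by (auto simp: tendsto_at_iff_sequentially o_def)
  then show "(\<lambda>i. norm ((f (x + X i) - f x - f' x \<bullet> X i) / norm (X i))) \<longlonglongrightarrow> 0"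
    by simp
qed

lemma has_derivative_integral_dominated:
  fixes G :: "'v::euclidean_space \<Rightarrow> 'a \<Rightarrow> real" and G' :: "'v \<Rightarrow> 'a \<Rightarrow> 'v"
  assumes G: "\<And>x z. ((\<lambda>x. G x z) has_derivative (\<lambda>h. G' x z \<bullet> h)) (at x)"
    and bound: "\<And>x z. norm (G' x z) \<le> B z"
    and B: "integrable M B"
    and int: "\<And>x. integrable M (G x)"
    and meas: "\<And>x. G' x \<in> borel_measurable M"
  shows "((\<lambda>x. \<integral>z. G x z \<partial>M) has_derivative (\<lambda>h. (\<integral>z. G' x z \<partial>M) \<bullet> h)) (at x)"
proof -
  define remainder where "remainder h = (\<integral>z. G (x + h) z \<partial>M) - (\<integral>z. G x z \<partial>M) - (\<integral>z. G' x z \<partial>M) \<bullet> h" for h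
  have intG': "integrable M (G' x)"
    by (rule Bochner_Integration.integrable_bound[OF B meas])
      (use bound in \<open>auto intro: order_trans[OF _ abs_ge_self]\<close>)
  have "((\<lambda>h. norm (remainder h) / norm h) \<longlongrightarrow> 0) (at 0)"
  proof (subst tendsto_at_iff_sequentially, intro allI impI)
    fix X :: "nat \<Rightarrow> 'v" assume "\<forall>i. X i \<in> UNIV - {0}" and X0: "X \<longlonglongrightarrow> 0"
    then have X_nonzero: "X i \<noteq> 0" for i by simp
    define D where "D i z = (G (x + X i) z - G x z - G' x z \<bullet> X i) / norm (X i)" for i z
    have "(\<lambda>i. \<integral>z. D i z \<partial>M) \<longlonglongrightarrow> (\<integral>z. 0 \<partial>M)"
    proof (rule integral_dominated_convergence)
      show "integrable M (\<lambda>z. 2 * B z)" using B by simp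
      show "D i \<in> borel_measurable M" for i
        unfolding D_def using int meas
        by (auto dest!: borel_measurable_integrable
            intro!: borel_measurable_divide borel_measurable_diff borel_measurable_inner)
      show "AE z in M. norm (D i z) \<le> 2 * B z" for i
        using gradient_remainder_bound[OF G bound, where x=x and h="X i"] X_nonzero[of i] by (simp add: D_def divide_le_eq)
      show "AE z in M. (\<lambda>i. D i z) \<longlonglongrightarrow> 0"
        unfolding D_def by (intro AE_I2 gradient_remainder_tendsto[OF G X_nonzero X0])
    qed simp
    then have "(\<lambda>i. norm (\<integral>z. D i z \<partial>M)) \<longlonglongrightarrow> 0"
      by (intro tendsto_norm_zero) simp
    moreover have "(\<integral>z. D i z \<partial>M) = remainder (X i) / norm (X i)" for i
      using int intG' by (simp add: D_def remainder_def)
    ultimately show "((\<lambda>h. norm (remainder h) / norm h) \<circ> X) \<longlonglongrightarrow> 0"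
      by (simp add: o_def)
  qed
  then show ?thesis
    by (simp add: has_derivative_at bounded_linear_inner_right remainder_def)
qed

lemma has_real_derivative_integral_dominated:
  fixes G G' :: "real \<Rightarrow> 'a \<Rightarrow> real"
  assumes "\<And>t z. ((\<lambda>t. G t z) has_real_derivative G' t z) (at t)" "\<And>t z. \<bar>G' t z\<bar> \<le> B z"
    "integrable M B" "\<And>t. integrable M (G t)" "\<And>t. G' t \<in> borel_measurable M"
  shows "((\<lambda>t. \<integral>z. G t z \<partial>M) has_real_derivative (\<integral>z. G' t z \<partial>M)) (at t)"
  using has_derivative_integral_dominated[of G G' B M t] assms
  by (simp add: has_field_derivative_def)

subsection \<open>Calculus of periodic C1 functions\<close>

lemma C1_periodic_mult:
  assumes f: "C1_periodic f f'" and g: "C1_periodic g g'"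
  shows "C1_periodic (\<lambda>x. f x * g x) (\<lambda>x. f x *\<^sub>R g' x + g x *\<^sub>R f' x)"
  unfolding C1_periodic_def
proof (intro conjI allI)
  show "lattice_periodic (\<lambda>x. f x * g x)"
    by (intro lattice_periodic_mult C1_periodic_periodic[OF f] C1_periodic_periodic[OF g])
  show "((\<lambda>x. f x * g x) has_derivative (\<lambda>h. (f x *\<^sub>R g' x + g x *\<^sub>R f' x) \<bullet> h)) (at x)" for x
    using has_derivative_mult[OF C1_periodicD(2)[OF f, of x] C1_periodicD(2)[OF g, of x]]
    by (simp add: inner_add_left mult.commute)
  show "continuous_on UNIV (\<lambda>x. f x *\<^sub>R g' x + g x *\<^sub>R f' x)"
    by (intro continuous_intros C1_periodicD(3,4)[OF f] C1_periodicD(3,4)[OF g])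
qed

lemma C1_periodic_add:
  assumes f: "C1_periodic f f'" and g: "C1_periodic g g'"
  shows "C1_periodic (\<lambda>x. f x + g x) (\<lambda>x. f' x + g' x)"
  unfolding C1_periodic_def
proof (intro conjI allI)
  show "lattice_periodic (\<lambda>x. f x + g x)"
    by (intro lattice_periodic_add C1_periodic_periodic[OF f] C1_periodic_periodic[OF g])
  show "((\<lambda>x. f x + g x) has_derivative (\<lambda>h. (f' x + g' x) \<bullet> h)) (at x)" for x
    using has_derivative_add[OF C1_periodicD(2)[OF f, of x] C1_periodicD(2)[OF g, of x]]
    by (simp add: inner_add_left)
  show "continuous_on UNIV (\<lambda>x. f' x + g' x)"
    by (intro continuous_intros C1_periodicD(3)[OF f] C1_periodicD(3)[OF g])
qed

lemma C1_periodic_const: "C1_periodic (\<lambda>x. c) (\<lambda>x. 0)"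
  by (simp add: C1_periodic_def lattice_periodic_const)

lemma C1_periodic_scale:
  assumes f: "C1_periodic f f'" shows "C1_periodic (\<lambda>x. c * f x) (\<lambda>x. c *\<^sub>R f' x)"
  using C1_periodic_mult[OF C1_periodic_const[of c] f] by simp

lemma C1_periodic_sum:
  assumes "finite A" "\<And>a. a \<in> A \<Longrightarrow> C1_periodic (f a) (f' a)"
  shows "C1_periodic (\<lambda>x. \<Sum>a\<in>A. f a x) (\<lambda>x. \<Sum>a\<in>A. f' a x)"
  using assms
proof (induction A rule: finite_induct)
  case (insert a A)
  then show ?case
    using C1_periodic_add[of "f a" "f' a" "\<lambda>x. \<Sum>a\<in>A. f a x" "\<lambda>x. \<Sum>a\<in>A. f' a x"] by simp
qed (simp add: C1_periodic_const)

lemma C1_periodic_translate: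
  assumes f: "C1_periodic f f'" shows "C1_periodic (\<lambda>x. f (x + c)) (\<lambda>x. f' (x + c))"
  unfolding C1_periodic_def
proof (intro conjI allI)
  show "lattice_periodic (\<lambda>x. f (x + c))"
    by (rule lattice_periodic_translate[OF C1_periodic_periodic[OF f]])
  show "((\<lambda>x. f (x + c)) has_derivative (\<lambda>h. f' (x + c) \<bullet> h)) (at x)" for x
    by (rule has_derivative_compose[of "\<lambda>x. x + c" "\<lambda>h. h" x UNIV f "\<lambda>h. f' (x + c) \<bullet> h"])
       (auto intro!: derivative_eq_intros C1_periodicD(2)[OF f])
  show "continuous_on UNIV (\<lambda>x. f' (x + c))"
    by (rule continuous_on_compose2[OF C1_periodicD(3)[OF f]]) (auto intro!: continuous_intros)
qed

lemma C1_periodic_compose_real: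
  assumes h: "\<And>s. (h has_real_derivative h' s) (at s)" "continuous_on UNIV h'" and f: "C1_periodic f f'"
  shows "C1_periodic (\<lambda>x. h (f x)) (\<lambda>x. h' (f x) *\<^sub>R f' x)"
  unfolding C1_periodic_def
proof (intro conjI allI)
  show "lattice_periodic (\<lambda>x. h (f x))"
    by (rule lattice_periodic_compose[OF C1_periodic_periodic[OF f]])
  show "((\<lambda>x. h (f x)) has_derivative (\<lambda>v. (h' (f x) *\<^sub>R f' x) \<bullet> v)) (at x)" for x
    using has_derivative_compose[OF C1_periodicD(2)[OF f, of x] h(1)[unfolded has_field_derivative_def]] by simp
  show "continuous_on UNIV (\<lambda>x. h' (f x) *\<^sub>R f' x)"
    by (intro continuous_intros C1_periodicD(3)[OF f] continuous_on_compose2[OF h(2) C1_periodicD(4)[OF f]]) simp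
qed

lemma C1_periodic_line_derivative:
  assumes "C1_periodic f f'"
  shows "((\<lambda>t. f (x + t *\<^sub>R v)) has_real_derivative f' (x + t *\<^sub>R v) \<bullet> v) (at t)"
proof -
  have "((\<lambda>t. x + t *\<^sub>R v) has_derivative (\<lambda>h. h *\<^sub>R v)) (at t)"
    by (auto intro!: derivative_eq_intros)
  from has_derivative_compose[OF this C1_periodicD(2)[OF assms]]
  show ?thesis by (simp add: has_field_derivative_def mult_commute_abs)
qed

lemma integral_line_derivative:
  assumes f: "C1_periodic f f'" and [measurable]: "c \<in> borel_measurable borel" and c: "\<And>x. \<bar>c x\<bar> \<le> C"
  shows "((\<lambda>t. \<integral>x. c x * f (x + t *\<^sub>R v) \<partial>torus) has_real_derivative (\<integral>x. c x * (f' x \<bullet> v) \<partial>torus)) (at 0)"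
proof -
  obtain B where B: "B > 0" "\<And>x. \<bar>f x\<bar> \<le> B" "\<And>x. norm (f' x) \<le> B" using C1_periodic_bounds[OF f] by metis
  note [measurable] = C1_periodic_measurable[OF f]
  have "((\<lambda>t. \<integral>x. c x * f (x + t *\<^sub>R v) \<partial>torus) has_real_derivative (\<integral>x. c x * (f' (x + 0 *\<^sub>R v) \<bullet> v) \<partial>torus)) (at 0)"
  proof (rule has_real_derivative_integral_dominated)
    show "((\<lambda>t. c x * f (x + t *\<^sub>R v)) has_real_derivative c x * (f' (x + t *\<^sub>R v) \<bullet> v)) (at t)" for x t
      by (rule DERIV_cmult[OF C1_periodic_line_derivative[OF f]])
    show "\<bar>c x * (f' (x + t *\<^sub>R v) \<bullet> v)\<bar> \<le> C * (B * norm v)" for x t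
      unfolding abs_mult using order_trans[OF abs_ge_zero c] by (intro mult_mono c abs_inner_le B) auto
    show "integrable torus (\<lambda>x. c x * f (x + t *\<^sub>R v))" for t
    proof (rule torus_integrable_bounded)
      show "norm (c x * f (x + t *\<^sub>R v)) \<le> C * B" for x
        unfolding real_norm_def abs_mult using order_trans[OF abs_ge_zero c] by (intro mult_mono c B) auto
    qed measurable
  qed simp_all
  then show ?thesis by simp
qed

lemma torus_integral_derivative:
  assumes f: "C1_periodic f f'"
  shows "(\<integral>x. f' x \<bullet> v \<partial>torus) = 0"
proof -
  have "(\<integral>x. f (x + t *\<^sub>R v) \<partial>torus) = (\<integral>x. f x \<partial>torus)" for t
    by (rule torus_integral_translate[OF C1_periodic_measurable(1)[OF f] C1_periodic_periodic[OF f]])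
  then have "((\<lambda>t::real. \<integral>x. f x \<partial>torus) has_real_derivative (\<integral>x. f' x \<bullet> v \<partial>torus)) (at 0)"
    using integral_line_derivative[OF f, of "\<lambda>_. 1" 1 v] by simp
  from DERIV_unique[OF this DERIV_const] show ?thesis .
qed

lemma torus_integral_by_parts:
  assumes f: "C1_periodic f f'" and g: "C1_periodic g g'"
  shows "(\<integral>x. f x * (g' x \<bullet> v) \<partial>torus) = - (\<integral>x. (f' x \<bullet> v) * g x \<partial>torus)"
proof -
  have "integrable torus (\<lambda>x. f x * (g' x \<bullet> v))" "integrable torus (\<lambda>x. (f' x \<bullet> v) * g x)"
    by (intro torus_integrable_continuous continuous_intros lattice_periodic_mult
        lattice_periodic_compose[where h="\<lambda>p. p \<bullet> v"] C1_periodicD(1,3,4)[OF f] C1_periodicD(1,3,4)[OF g]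
        C1_periodic_gradient_periodic[OF f] C1_periodic_gradient_periodic[OF g])+
  then have "(\<integral>x. f x * (g' x \<bullet> v) \<partial>torus) + (\<integral>x. (f' x \<bullet> v) * g x \<partial>torus)
     = (\<integral>x. (f x *\<^sub>R g' x + g x *\<^sub>R f' x) \<bullet> v \<partial>torus)"
    by (subst Bochner_Integration.integral_add[symmetric]) (simp_all add: inner_add_left mult.commute)
  also have "\<dots> = 0"
    by (rule torus_integral_derivative[OF C1_periodic_mult[OF f g]])
  finally show ?thesis by simp
qed

text \<open>Weak symmetry of second derivatives: moving a translation from one factor to the other
  avoids assuming that either function is twice differentiable.\<close>

lemma torus_integral_gradients_symmetric:
  assumes a: "C1_periodic a a'" and b: "C1_periodic b b'"
  shows "(\<integral>x. (a' x \<bullet> v) * (b' x \<bullet> w) \<partial>torus) = (\<integral>x. (a' x \<bullet> w) * (b' x \<bullet> v) \<partial>torus)"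
proof -
  obtain A where A: "\<And>x. norm (a' x) \<le> A" using C1_periodic_bounds[OF a] by metis
  obtain B where B: "\<And>x. norm (b' x) \<le> B" using C1_periodic_bounds[OF b] by metis
  note [measurable] = C1_periodic_measurable[OF a] C1_periodic_measurable[OF b]
  have translate: "(\<integral>x. (a' x \<bullet> v) * b (x + t *\<^sub>R w) \<partial>torus) = (\<integral>x. - (b' x \<bullet> v) * a (x + t *\<^sub>R (- w)) \<partial>torus)" for t
  proof -
    have per: "lattice_periodic (\<lambda>x. (b' x \<bullet> v) * a (x + t *\<^sub>R (- w)))"
      by (intro lattice_periodic_mult lattice_periodic_compose[where h="\<lambda>p. p \<bullet> v"]
          C1_periodic_gradient_periodic[OF b] lattice_periodic_translate C1_periodic_periodic[OF a])
    have "(\<integral>x. (a' x \<bullet> v) * b (x + t *\<^sub>R w) \<partial>torus) = - (\<integral>x. a x * (b' (x + t *\<^sub>R w) \<bullet> v) \<partial>torus)"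
      using torus_integral_by_parts[OF a C1_periodic_translate[OF b], of "t *\<^sub>R w" v] by simp
    also have "(\<integral>x. a x * (b' (x + t *\<^sub>R w) \<bullet> v) \<partial>torus) = (\<integral>x. (b' (x + t *\<^sub>R w) \<bullet> v) * a (x + t *\<^sub>R w + t *\<^sub>R (- w)) \<partial>torus)"
      by (simp add: mult.commute)
    also have "\<dots> = (\<integral>x. (b' x \<bullet> v) * a (x + t *\<^sub>R (- w)) \<partial>torus)"
      by (rule torus_integral_translate[OF _ per]) simp
    finally show ?thesis by simp
  qed
  have "((\<lambda>t. \<integral>x. (a' x \<bullet> v) * b (x + t *\<^sub>R w) \<partial>torus) has_real_derivative (\<integral>x. (a' x \<bullet> v) * (b' x \<bullet> w) \<partial>torus)) (at 0)"
    by (rule integral_line_derivative[OF b _ abs_inner_le[OF A]]) measurable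
  moreover have "((\<lambda>t. \<integral>x. - (b' x \<bullet> v) * a (x + t *\<^sub>R (- w)) \<partial>torus) has_real_derivative (\<integral>x. - (b' x \<bullet> v) * (a' x \<bullet> (- w)) \<partial>torus)) (at 0)"
    by (rule integral_line_derivative[OF a, where C="B * norm v"]) (measurable, simp add: abs_inner_le[OF B])
  ultimately have "(\<integral>x. (a' x \<bullet> v) * (b' x \<bullet> w) \<partial>torus) = (\<integral>x. - (b' x \<bullet> v) * (a' x \<bullet> (- w)) \<partial>torus)"
    unfolding translate by (rule DERIV_unique)
  then show ?thesis by (simp add: mult.commute)
qed

subsection \<open>Convolution with a C1 kernel\<close>

definition torus_convolution :: "(real^'n \<Rightarrow> real) \<Rightarrow> (real^'n \<Rightarrow> 'b::{banach,second_countable_topology}) \<Rightarrow> real^'n \<Rightarrow> 'b" where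
  "torus_convolution w K x = (\<integral>z. w z *\<^sub>R K (x - z) \<partial>torus)"

lemma torus_convolution_continuous:
  fixes K :: "real^'n \<Rightarrow> 'b::{banach,second_countable_topology}"
  assumes K: "continuous_on UNIV K" "lattice_periodic K" and w: "integrable torus w"
  shows "continuous_on UNIV (torus_convolution w K)"
proof -
  obtain B where B: "\<And>x. norm (K x) \<le> B" using periodic_continuous_bounded[OF K] by metis
  have [measurable]: "K \<in> borel_measurable borel" using K(1) by (rule borel_measurable_continuous_onI)
  note [measurable] = borel_measurable_integrable[OF w]
  have "(\<lambda>i. torus_convolution w K (X i)) \<longlonglongrightarrow> torus_convolution w K x" if X: "X \<longlonglongrightarrow> x" for x X
    unfolding torus_convolution_def
  proof (rule integral_dominated_convergence)
    show "integrable torus (\<lambda>z. \<bar>w z\<bar> * B)" using w by simp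
    show "AE z in torus. norm (w z *\<^sub>R K (X i - z)) \<le> \<bar>w z\<bar> * B" for i
      by (simp add: B mult_left_mono)
    show "AE z in torus. (\<lambda>i. w z *\<^sub>R K (X i - z)) \<longlonglongrightarrow> w z *\<^sub>R K (x - z)"
      by (intro AE_I2 tendsto_scaleR tendsto_const continuous_on_tendsto_compose[OF K(1)] tendsto_diff X) simp_all
  qed simp_all
  then show ?thesis
    by (auto simp: continuous_on_sequentially o_def)
qed

lemma C1_periodic_convolution:
  assumes K: "C1_periodic K K'" and w: "integrable torus w"
  shows "C1_periodic (torus_convolution w K) (torus_convolution w K')"
  unfolding C1_periodic_def
proof (intro conjI allI)
  obtain B where B: "B > 0" "\<And>x. \<bar>K x\<bar> \<le> B" "\<And>x. norm (K' x) \<le> B" using C1_periodic_bounds[OF K] by metis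
  note [measurable] = C1_periodic_measurable[OF K] borel_measurable_integrable[OF w]
  show "lattice_periodic (torus_convolution w K)"
  proof (rule lattice_periodicI)
    fix x k :: "real^'a" assume "k \<in> int_lattice"
    then have "K (x + k - z) = K (x - z)" for z
      using lattice_periodicD[OF C1_periodic_periodic[OF K], of k "x - z"] by (simp add: algebra_simps)
    then show "torus_convolution w K (x + k) = torus_convolution w K x"
      by (simp add: torus_convolution_def)
  qed
  show "continuous_on UNIV (torus_convolution w K')"
    by (rule torus_convolution_continuous[OF C1_periodicD(3)[OF K] C1_periodic_gradient_periodic[OF K] w])
  show "(torus_convolution w K has_derivative (\<lambda>h. torus_convolution w K' x \<bullet> h)) (at x)" for x
    unfolding torus_convolution_def
  proof (rule has_derivative_integral_dominated)
    show "((\<lambda>x. w z *\<^sub>R K (x - z)) has_derivative (\<lambda>h. (w z *\<^sub>R K' (x - z)) \<bullet> h)) (at x)" for x z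
      using has_derivative_mult_right[OF C1_periodicD(2)[OF C1_periodic_translate[OF K, of "- z"]], of "w z" x]
      by simp
    show "norm (w z *\<^sub>R K' (x - z)) \<le> \<bar>w z\<bar> * B" for x z
      by (simp add: B mult_left_mono)
    show "integrable torus (\<lambda>z. \<bar>w z\<bar> * B)" using w by simp
    show "integrable torus (\<lambda>z. w z *\<^sub>R K (x - z))" for x
      unfolding real_scaleR_def by (rule torus_integrable_mult_bounded[OF w, of _ B]) (simp_all add: B)
  qed simp
qed

section \<open>A smooth approximate identity\<close>

subsection \<open>Smooth periodic functions\<close>

definition gradient :: "(real^'n \<Rightarrow> real) \<Rightarrow> real^'n \<Rightarrow> real^'n" where
  "gradient f x = (\<chi> j. pderiv j f x)"

lemma gradient_nth [simp]: "gradient f x $ j = pderiv j f x"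
  by (simp add: gradient_def)

lemma pderiv_eq:
  assumes "(f has_derivative F) (at x)"
  shows "pderiv j f x = F (axis j 1)"
  using frechet_derivative_at[OF assms] by (simp add: pderiv_def)

lemma gradient_eq:
  assumes "(f has_derivative (\<lambda>h. p \<bullet> h)) (at x)"
  shows "gradient f x = p"
  by (simp add: vec_eq_iff pderiv_eq[OF assms] inner_axis)

lemma Ck_Suc_imp: "Ck (Suc k) f \<Longrightarrow> Ck k f"
  by (induction k arbitrary: f) auto

lemma Ck_const: "Ck k (\<lambda>x::real^'n. c)"
proof (induction k arbitrary: c)
  case (Suc k)
  have "pderiv j (\<lambda>x::real^'n. c) = (\<lambda>x. 0)" for j
    by (rule ext) (subst pderiv_eq[OF has_derivative_const], simp)
  with Suc[of 0] show ?case by (simp add: differentiable_on_const)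
qed simp

lemma Ck_add: "Ck k f \<Longrightarrow> Ck k g \<Longrightarrow> Ck k (\<lambda>x. f x + g x)"
proof (induction k arbitrary: f g)
  case 0 then show ?case by (simp add: continuous_on_add)
next
  case (Suc k)
  then have differentiable: "f differentiable at x" "g differentiable at x" for x
    by (auto simp: differentiable_on_def)
  have "pderiv j (\<lambda>x. f x + g x) = (\<lambda>x. pderiv j f x + pderiv j g x)" for j
    by (rule ext, subst pderiv_eq[OF has_derivative_add[OF differentiable[unfolded frechet_derivative_works]]])
      (simp add: pderiv_def)
  then show ?case using Suc by (auto intro: continuous_on_add differentiable_on_add)
qed

lemma Ck_mult: "Ck k f \<Longrightarrow> Ck k g \<Longrightarrow> Ck k (\<lambda>x. f x * g x)"
proof (induction k arbitrary: f g)
  case 0 then show ?case by (simp add: continuous_on_mult)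
next
  case (Suc k)
  then have differentiable: "f differentiable at x" "g differentiable at x" for x
    by (auto simp: differentiable_on_def)
  have "pderiv j (\<lambda>x. f x * g x) = (\<lambda>x. f x * pderiv j g x + pderiv j f x * g x)" for j
    by (rule ext, subst pderiv_eq[OF has_derivative_mult[OF differentiable[unfolded frechet_derivative_works]]])
      (simp add: pderiv_def)
  moreover have "Ck k f" "Ck k g" using Suc.prems Ck_Suc_imp by blast+
  ultimately show ?case using Suc by (auto intro: continuous_on_mult differentiable_on_mult Ck_add)
qed

lemma Ck_cos: "Ck k (\<lambda>x::real^'n. cos (c * x $ i + b))"
proof (induction k arbitrary: b)
  case 0 then show ?case by (auto intro!: continuous_intros)
next
  case (Suc k)
  have derivative: "((\<lambda>x::real^'n. cos (c * x $ i + b)) has_derivative (\<lambda>h. - sin (c * x $ i + b) * (c * h $ i))) (at x)" for x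
    by (auto intro!: derivative_eq_intros bounded_linear_imp_has_derivative bounded_linear_vec_nth)
  have "pderiv j (\<lambda>x. cos (c * x $ i + b)) = (\<lambda>x. (if i = j then c else 0) * cos (c * x $ i + (b + pi/2)))" for j
    by (rule ext, subst pderiv_eq[OF derivative]) (simp add: axis_def cos_add sin_add flip: add.assoc)
  then have "Ck k (pderiv j (\<lambda>x. cos (c * x $ i + b)))" for j
    by (simp only:) (intro Ck_mult Ck_const Suc)
  then show ?case using derivative
    by (auto intro!: continuous_intros simp: differentiable_on_def differentiable_def)
qed

lemma Ck_prod: "finite A \<Longrightarrow> (\<And>a. a \<in> A \<Longrightarrow> Ck k (f a)) \<Longrightarrow> Ck k (\<lambda>x. \<Prod>a\<in>A. f a x)"
  by (induction A rule: finite_induct) (simp_all add: Ck_const Ck_mult)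

lemma Ck_power: "Ck k f \<Longrightarrow> Ck k (\<lambda>x. f x ^ m)"
  by (induction m) (simp_all add: Ck_const Ck_mult)

lemma smooth_fun_C1_periodic:
  assumes "smooth_fun f" "periodic_fun f"
  shows "C1_periodic f (gradient f)"
  unfolding C1_periodic_def
proof (intro conjI allI)
  have C: "Ck (Suc 0) f" using assms by (auto simp: smooth_fun_def)
  show "lattice_periodic f" using assms by (simp add: periodic_fun_iff)
  show "continuous_on UNIV (gradient f)"
    unfolding gradient_def using C by (intro continuous_on_vec_lambda) auto
  fix x :: "real^'a"
  have derivative: "(f has_derivative frechet_derivative f (at x)) (at x)"
    using C by (auto simp: differentiable_on_def frechet_derivative_works)
  have "frechet_derivative f (at x) h = gradient f x \<bullet> h" for h
  proof -
    have "frechet_derivative f (at x) h = frechet_derivative f (at x) (\<Sum>j\<in>UNIV. h $ j *\<^sub>R axis j 1)"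
      by (simp add: basis_expansion flip: scalar_mult_eq_scaleR)
    also have "\<dots> = (\<Sum>j\<in>UNIV. h $ j * pderiv j f x)"
      using has_derivative_linear[OF derivative] by (simp add: linear_sum linear_cmul pderiv_def)
    finally show ?thesis by (simp add: inner_vec_def mult.commute)
  qed
  then show "(f has_derivative (\<lambda>h. gradient f x \<bullet> h)) (at x)"
    using derivative by (metis (no_types, lifting) ext)
qed

lemma smooth_fun_pderiv_measurable: "smooth_fun f \<Longrightarrow> pderiv j f \<in> borel_measurable borel"
proof -
  assume "smooth_fun f"
  then have "Ck (Suc 0) f" unfolding smooth_fun_def by blast
  then show ?thesis by (intro borel_measurable_continuous_onI) simp
qed

subsection \<open>Powers of a trigonometric bump\<close>

definition cos_bump :: "real^'n \<Rightarrow> real" where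
  "cos_bump x = (\<Prod>i\<in>UNIV. (1 + cos (2 * pi * x $ i)) / 2)"

lemma one_plus_cos_bounds: "0 \<le> 1 + cos t" "1 + cos t \<le> (2::real)"
  using cos_ge_minus_one[of t] cos_le_one[of t] by linarith+

lemma cos_bump_bounds: "0 \<le> cos_bump x" "cos_bump x \<le> 1"
  unfolding cos_bump_def by (auto intro!: prod_nonneg prod_le_1 simp: one_plus_cos_bounds)

lemma cos_bump_minus: "cos_bump (- x) = cos_bump x"
  by (simp add: cos_bump_def)

lemma cos_bump_periodic: "lattice_periodic cos_bump"
proof (rule lattice_periodicI)
  fix x k :: "real^'n" assume k: "k \<in> int_lattice"
  have "cos (2 * pi * (x + k) $ i) = cos (2 * pi * x $ i)" for i
  proof -
    obtain n where n: "k $ i = of_int n" using k by (auto simp: int_lattice_def elim!: Ints_cases)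
    show ?thesis by (simp add: n distrib_left cos_add mult.assoc[symmetric])
  qed
  then show "cos_bump (x + k) = cos_bump x" by (simp only: cos_bump_def)
qed

lemma cos_bump_eq_1_imp_int_lattice:
  assumes "cos_bump x = 1" shows "x \<in> int_lattice"
  unfolding int_lattice_def
proof (intro CollectI allI)
  fix i
  have "cos_bump x = (1 + cos (2 * pi * x $ i)) / 2 * (\<Prod>i\<in>UNIV - {i}. (1 + cos (2 * pi * x $ i)) / 2)"
    unfolding cos_bump_def by (simp add: prod.remove[of UNIV i])
  also have "\<dots> \<le> (1 + cos (2 * pi * x $ i)) / 2 * 1"
    by (intro mult_left_mono prod_le_1) (auto simp: one_plus_cos_bounds)
  finally have "cos (2 * pi * x $ i) = 1" using assms cos_le_one[of "2 * pi * x $ i"] by simp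
  then obtain n :: int where "2 * pi * x $ i = of_int n * 2 * pi" by (auto simp: cos_one_2pi_int)
  then show "x $ i \<in> \<int>" by simp
qed

lemma cos_bump_continuous: "continuous_on UNIV cos_bump"
  unfolding cos_bump_def by (intro continuous_intros) simp

lemma cos_bump_measurable [measurable]: "cos_bump \<in> borel_measurable borel"
  by (rule borel_measurable_continuous_onI[OF cos_bump_continuous])

lemma smooth_cos_bump_power: "smooth_fun (\<lambda>z. a * cos_bump (x - z) ^ m)"
  unfolding smooth_fun_def
proof
  fix k
  have "cos_bump (x - z) = (\<Prod>i\<in>UNIV. (1 + cos ((- 2 * pi) * z $ i + 2 * pi * x $ i)) * (1/2))" for z
    unfolding cos_bump_def by (rule prod.cong) (simp_all add: right_diff_distrib)
  then show "Ck k (\<lambda>z. a * cos_bump (x - z) ^ m)"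
    by (simp only: , intro Ck_mult Ck_const Ck_power Ck_prod Ck_add Ck_cos finite)
qed

lemma cos_bump_power_integrable: "integrable torus (\<lambda>z. cos_bump z ^ m)"
  by (rule torus_integrable_bounded[where B=1]) (auto simp: cos_bump_bounds power_le_one)

lemma measure_torus_open_pos:
  fixes U :: "(real^'n) set"
  assumes U: "open U" "0 \<in> U"
  shows "0 < measure torus U"
proof -
  have "(\<chi> i. 1/2) \<in> (box 0 1 :: (real^'n) set)" by (simp add: mem_box_cart)
  then have "box 0 (1 :: real^'n) \<noteq> {}" by blast
  then have "(0 :: real^'n) \<in> closure (box 0 1)"
    by (simp add: mem_box_cart)
  then have "U \<inter> box 0 1 \<noteq> {}"
    using U open_Int_closure_eq_empty[OF U(1), of "box 0 1"] by blast
  then obtain p e where "e > 0" and ball: "ball p e \<subseteq> U \<inter> box 0 1"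
    using openE[OF open_Int[OF U(1) open_box]] by blast
  then have "emeasure torus (ball p e) = emeasure lborel (ball p e)"
    using unit_cell_bounds(1)[where 'n='n]
    by (subst torus_def, subst emeasure_density)
      (auto simp: Int_absorb1 simp flip: indicator_inter_arith intro!: nn_integral_cong split: split_indicator)
  then have "measure torus (ball p e) = measure lborel (ball p e)" by (simp add: measure_def)
  also have "\<dots> > 0" using \<open>e > 0\<close> by (rule content_ball_pos)
  finally show ?thesis
    using torus.finite_measure_mono[of "ball p e" U] ball U(1) by simp
qed

lemma cos_bump_mass_ge:
  fixes p :: real
  assumes "0 \<le> p" "p < 1"
  obtains c where "c > 0" "\<And>m. c * p ^ m \<le> (\<integral>z. cos_bump z ^ m \<partial>(torus :: (real^'n) measure))"
proof -
  define U where "U = (cos_bump -` {p<..} :: (real^'n) set)"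
  have U: "open U"
    unfolding U_def using cos_bump_continuous by (intro open_vimage) auto
  have "0 \<in> U" using assms by (simp add: U_def cos_bump_def)
  show thesis
  proof
    show "0 < measure torus U" by (rule measure_torus_open_pos[OF U \<open>0 \<in> U\<close>])
    fix m
    have "measure torus U * p ^ m = (\<integral>z. indicator U z * p ^ m \<partial>torus)" using U by simp
    also have "\<dots> \<le> (\<integral>z. cos_bump z ^ m \<partial>(torus :: (real^'n) measure))"
    proof (rule integral_mono)
      show "integrable torus (\<lambda>z. indicator U z * p ^ m)"
        using U by (intro integrable_mult_left) (simp add: torus.emeasure_finite less_top[symmetric])
      show "indicator U z * p ^ m \<le> cos_bump z ^ m" for z
        using assms by (auto split: split_indicator intro!: power_mono simp: cos_bump_bounds U_def)
    qed (rule cos_bump_power_integrable)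
    finally show "measure torus U * p ^ m \<le> (\<integral>z. cos_bump z ^ m \<partial>(torus :: (real^'n) measure))" .
  qed
qed

lemma cos_bump_mass_pos: "0 < (\<integral>z. cos_bump z ^ m \<partial>(torus :: (real^'n) measure))"
proof -
  obtain c :: real where "c > 0" "c * (1/2) ^ m \<le> (\<integral>z. cos_bump z ^ m \<partial>(torus :: (real^'n) measure))"
    using cos_bump_mass_ge[of "1/2", where 'n='n] by auto
  then show ?thesis
    by (meson less_le_trans mult_pos_pos zero_less_power half_gt_zero zero_less_one)
qed

lemma cos_bump_le_away_from_lattice:
  assumes "d > 0"
  obtains q where "0 \<le> q" "q < 1" "\<And>z :: real^'n. d \<le> infdist z int_lattice \<Longrightarrow> cos_bump z \<le> q"
proof -
  define C where "C = {z :: real^'n. d \<le> infdist z int_lattice} \<inter> cball 0 (CARD('n))"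
  have "closed {z :: real^'n. d \<le> infdist z int_lattice}"
    by (intro closed_Collect_le continuous_intros)
  then have C: "compact C" unfolding C_def by (intro closed_Int_compact) auto
  have "lattice_periodic (\<lambda>z :: real^'n. infdist z int_lattice)"
    by (rule lattice_periodic_infdist) (simp add: lattice_invariant_def int_lattice_add)
  then have C_wrap: "wrap z \<in> C" if "d \<le> infdist z int_lattice" for z :: "real^'n"
    using that norm_wrap_le[of z] lattice_periodic_wrap by (fastforce simp: C_def)
  show thesis
  proof (cases "C = {}")
    case True then show ?thesis using C_wrap by (intro that[of 0]) auto
  next
    case False
    then obtain z0 where z0: "z0 \<in> C" "\<And>z. z \<in> C \<Longrightarrow> cos_bump z \<le> cos_bump z0"
      using continuous_attains_sup[OF C False, of cos_bump] continuous_on_subset[OF cos_bump_continuous] by auto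
    show ?thesis
    proof
      have "cos_bump z0 \<noteq> 1"
        using z0(1) assms cos_bump_eq_1_imp_int_lattice[of z0] by (auto simp: C_def infdist_zero)
      then show "0 \<le> cos_bump z0" "cos_bump z0 < 1" using cos_bump_bounds[of z0] by auto
      show "cos_bump z \<le> cos_bump z0" if "d \<le> infdist z int_lattice" for z :: "real^'n"
        using z0(2)[OF C_wrap[OF that]] by (simp add: lattice_periodic_wrap[OF cos_bump_periodic])
    qed
  qed
qed

subsection \<open>Mollification\<close>

definition torus_kernel :: "nat \<Rightarrow> real^'n \<Rightarrow> real" where
  "torus_kernel m x = (1 / (\<integral>z. cos_bump z ^ m \<partial>(torus :: (real^'n) measure))) * cos_bump x ^ m"

definition mollify :: "nat \<Rightarrow> (real^'n \<Rightarrow> real) \<Rightarrow> real^'n \<Rightarrow> real" where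
  "mollify m w = torus_convolution w (torus_kernel m)"

lemma torus_kernel_minus: "torus_kernel m (- x) = torus_kernel m x"
  by (simp add: torus_kernel_def cos_bump_minus)

lemma torus_kernel_periodic: "lattice_periodic (torus_kernel m)"
  unfolding torus_kernel_def by (rule lattice_periodic_compose[OF cos_bump_periodic])

lemma torus_kernel_reflected:
  "smooth_fun (\<lambda>z. torus_kernel m (x - z))" "periodic_fun (\<lambda>z. torus_kernel m (x - z))"
proof -
  show "smooth_fun (\<lambda>z. torus_kernel m (x - z))"
    unfolding torus_kernel_def by (rule smooth_cos_bump_power)
  show "periodic_fun (\<lambda>z. torus_kernel m (x - z))"
    unfolding periodic_fun_iff by (rule lattice_periodic_reflect[OF torus_kernel_periodic])
qed

lemma torus_kernel_C1_periodic: "C1_periodic (torus_kernel m) (gradient (torus_kernel m))"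
  using smooth_fun_C1_periodic[OF torus_kernel_reflected, of m 0] by (simp add: torus_kernel_minus)

lemma torus_kernel_measurable [measurable]: "torus_kernel m \<in> borel_measurable borel"
  unfolding torus_kernel_def by measurable

lemma torus_kernel_nonneg: "0 \<le> torus_kernel m x"
  unfolding torus_kernel_def using cos_bump_mass_pos[of m, where 'n='a]
  by (auto simp: cos_bump_bounds intro!: mult_nonneg_nonneg divide_nonneg_nonneg)

lemma torus_kernel_integrable: "integrable torus (torus_kernel m)"
  unfolding torus_kernel_def by (intro integrable_mult_right cos_bump_power_integrable)

lemma torus_kernel_mass: "(\<integral>z. torus_kernel m z \<partial>(torus :: (real^'n) measure)) = 1"
  unfolding torus_kernel_def using cos_bump_mass_pos[of m, where 'n='n] by simp

lemma torus_kernel_decay: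
  assumes "d > 0"
  obtains s where "s \<longlonglongrightarrow> 0" "\<And>m. 0 \<le> s m"
    "\<And>m (z :: real^'n). d \<le> infdist z int_lattice \<Longrightarrow> torus_kernel m z \<le> s m"
proof -
  obtain q where q: "0 \<le> q" "q < 1" "\<And>z :: real^'n. d \<le> infdist z int_lattice \<Longrightarrow> cos_bump z \<le> q"
    using cos_bump_le_away_from_lattice[OF assms] by metis
  define p where "p = (1 + q) / 2"
  have p: "0 < p" "p < 1" "q < p" using q by (auto simp: p_def)
  obtain c where c: "c > 0" "\<And>m. c * p ^ m \<le> (\<integral>z. cos_bump z ^ m \<partial>(torus :: (real^'n) measure))"
    using cos_bump_mass_ge[of p, where 'n='n] p by (metis less_imp_le)
  show thesis
  proof
    show "(\<lambda>m. (q / p) ^ m / c) \<longlonglongrightarrow> 0"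
      using p q by (intro tendsto_divide_zero LIMSEQ_power_zero) auto
    show "0 \<le> (q / p) ^ m / c" for m using p q c by simp
    fix m and z :: "real^'n" assume z: "d \<le> infdist z int_lattice"
    have "torus_kernel m z = cos_bump z ^ m / (\<integral>z. cos_bump z ^ m \<partial>(torus :: (real^'n) measure))"
      by (simp add: torus_kernel_def)
    also have "\<dots> \<le> q ^ m / (c * p ^ m)"
      using q(1,3) z c p by (intro frac_le power_mono zero_le_power) (auto simp: cos_bump_bounds)
    also have "\<dots> = (q / p) ^ m / c" by (simp add: power_divide)
    finally show "torus_kernel m z \<le> (q / p) ^ m / c" .
  qed
qed

lemma mollify_C1_periodic:
  "integrable torus w \<Longrightarrow> C1_periodic (mollify m w) (torus_convolution w (gradient (torus_kernel m)))"
  unfolding mollify_def by (rule C1_periodic_convolution[OF torus_kernel_C1_periodic])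

lemma mollify_measurable [measurable (raw)]: "integrable torus w \<Longrightarrow> mollify m w \<in> borel_measurable borel"
  by (rule C1_periodic_measurable(1)[OF mollify_C1_periodic])

lemma torus_kernel_mult_integrable:
  fixes w :: "real^'n \<Rightarrow> real"
  assumes "integrable torus w"
  shows "integrable torus (\<lambda>z. w z * torus_kernel m (x - z))"
proof -
  obtain B where "\<And>x :: real^'n. \<bar>torus_kernel m x\<bar> \<le> B"
    using C1_periodic_bounds[OF torus_kernel_C1_periodic] by metis
  then show ?thesis
    by (intro torus_integrable_mult_bounded[where B=B] assms) simp_all
qed

lemma mollify_diff:
  assumes "integrable torus v" "integrable torus w"
  shows "mollify m (\<lambda>x. v x - w x) x = mollify m v x - mollify m w x"
  using torus_kernel_mult_integrable[OF assms(1)] torus_kernel_mult_integrable[OF assms(2)]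
  by (simp add: mollify_def torus_convolution_def left_diff_distrib)

lemma
  fixes b :: "real^'n \<Rightarrow> real"
  assumes b: "integrable torus b" "lattice_periodic b"
  shows mollify_eq_integral_shift: "mollify m b x = (\<integral>z. torus_kernel m z * b (x + z) \<partial>torus)"
    and torus_kernel_mult_shift_integrable: "integrable torus (\<lambda>z. torus_kernel m z * b (x + z))"
proof -
  note [measurable] = borel_measurable_integrable[OF b(1)]
  let ?f = "\<lambda>z. b z * torus_kernel m (x - z)"
  have f: "?f \<in> borel_measurable borel" "lattice_periodic ?f"
    using lattice_periodic_mult[OF b(2) lattice_periodic_reflect[OF torus_kernel_periodic]] by measurable
  have shift: "?f (z + x) = torus_kernel m z * b (x + z)" for z
    by (simp add: torus_kernel_minus add.commute)
  show "mollify m b x = (\<integral>z. torus_kernel m z * b (x + z) \<partial>torus)"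
    using torus_integral_translate[OF f, of x] unfolding shift by (simp add: mollify_def torus_convolution_def)
  show "integrable torus (\<lambda>z. torus_kernel m z * b (x + z))"
    using torus_integrable_translate[OF f, of x] torus_kernel_mult_integrable[OF b(1)] unfolding shift by simp
qed

lemma periodic_shift_le:
  fixes b :: "real^'n \<Rightarrow> real"
  assumes per: "lattice_periodic b" and unif: "\<And>x y. norm (x - y) < d \<Longrightarrow> \<bar>b x - b y\<bar> < e"
    and z: "infdist z int_lattice < d"
  shows "\<bar>b (x + z) - b x\<bar> < e"
proof -
  have "int_lattice \<noteq> ({} :: (real^'n) set)" using zero_in_int_lattice by blast
  then obtain l where l: "l \<in> int_lattice" "dist z l < d"
    using infdist_attains_inf[OF closed_int_lattice, of z] z by metis
  have "\<bar>b (x + z - l) - b x\<bar> < e" using l(2) by (intro unif) (simp add: dist_norm)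
  moreover have "b (x + z - l) = b (x + z)"
    using lattice_periodicD[OF per, of "- l" "x + z"] l(1) by simp
  ultimately show ?thesis by simp
qed

lemma mollify_diff_le:
  fixes b :: "real^'n \<Rightarrow> real"
  assumes b: "integrable torus b" "lattice_periodic b" "\<And>x. \<bar>b x\<bar> \<le> B"
    and unif: "\<And>x y. norm (x - y) < d \<Longrightarrow> \<bar>b x - b y\<bar> < e" and e: "0 < e"
    and s: "0 \<le> s" "\<And>z :: real^'n. d \<le> infdist z int_lattice \<Longrightarrow> torus_kernel m z \<le> s"
  shows "\<bar>mollify m b x - b x\<bar> \<le> e + 2 * B * s"
proof -
  note int = torus_kernel_mult_shift_integrable[OF b(1,2)] torus_kernel_integrable[of m, where 'a='n]
  have "mollify m b x - b x = (\<integral>z. torus_kernel m z * b (x + z) \<partial>torus) - (\<integral>z. torus_kernel m z * b x \<partial>(torus :: (real^'n) measure))"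
    using torus_kernel_mass[of m, where 'n='n] by (simp add: mollify_eq_integral_shift[OF b(1,2)])
  also have "\<dots> = (\<integral>z. torus_kernel m z * (b (x + z) - b x) \<partial>torus)"
    using int by (simp add: right_diff_distrib)
  finally have "\<bar>mollify m b x - b x\<bar> \<le> (\<integral>z. \<bar>torus_kernel m z * (b (x + z) - b x)\<bar> \<partial>torus)"
    using integral_abs_bound by metis
  also have "\<dots> \<le> (\<integral>z. torus_kernel m z * e + 2 * B * s \<partial>(torus :: (real^'n) measure))"
  proof (rule integral_mono)
    show "integrable torus (\<lambda>z. \<bar>torus_kernel m z * (b (x + z) - b x)\<bar>)"
      using int by (intro integrable_abs) (simp add: right_diff_distrib)
    show "integrable torus (\<lambda>z :: real^'n. torus_kernel m z * e + 2 * B * s)"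
      using int by simp
    fix z :: "real^'n"
    have B: "\<bar>b (x + z) - b x\<bar> \<le> 2 * B" "0 \<le> B" using b(3)[of x] b(3)[of "x + z"] by linarith+
    have "torus_kernel m z * \<bar>b (x + z) - b x\<bar> \<le> torus_kernel m z * e + 2 * B * s"
    proof (cases "d \<le> infdist z int_lattice")
      case True
      have "torus_kernel m z * \<bar>b (x + z) - b x\<bar> \<le> s * (2 * B)"
        using B s(1) by (intro mult_mono s(2) True) auto
      then show ?thesis using torus_kernel_nonneg[of m z] e by (simp add: add_increasing mult.commute)
    next
      case False
      then have "\<bar>b (x + z) - b x\<bar> < e" by (intro periodic_shift_le[OF b(2) unif]) auto
      then have "torus_kernel m z * \<bar>b (x + z) - b x\<bar> \<le> torus_kernel m z * e"
        by (intro mult_left_mono torus_kernel_nonneg) simp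
      moreover have "0 \<le> 2 * B * s" using B(2) s(1) by simp
      ultimately show ?thesis by linarith
    qed
    then show "\<bar>torus_kernel m z * (b (x + z) - b x)\<bar> \<le> torus_kernel m z * e + 2 * B * s"
      by (simp add: abs_mult torus_kernel_nonneg)
  qed
  also have "\<dots> = e + 2 * B * s"
    using int(2) torus_kernel_mass[of m, where 'n='n] by simp
  finally show ?thesis .
qed

lemma mollify_uniform_limit:
  fixes b :: "real^'n \<Rightarrow> real"
  assumes cont: "continuous_on UNIV b" and per: "lattice_periodic b"
  shows "uniform_limit UNIV (\<lambda>m. mollify m b) b sequentially"
proof (rule uniform_limitI)
  fix e :: real assume e: "e > 0"
  obtain B where B: "B > 0" "\<And>x. norm (b x) \<le> B" using periodic_continuous_bounded[OF cont per] by metis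
  obtain d where d: "d > 0" "\<And>x y. norm (x - y) < d \<Longrightarrow> norm (b x - b y) < e / 2"
    using periodic_continuous_uniformly[OF cont per, of "e / 2"] e by auto
  obtain s where s: "s \<longlonglongrightarrow> 0" "\<And>m. 0 \<le> s m"
    "\<And>m (z :: real^'n). d \<le> infdist z int_lattice \<Longrightarrow> torus_kernel m z \<le> s m"
    using torus_kernel_decay[OF d(1)] by metis
  have "\<forall>\<^sub>F m in sequentially. s m < e / (4 * B)"
    using s(1) e B(1) by (intro order_tendstoD(2)) auto
  then show "\<forall>\<^sub>F m in sequentially. \<forall>x\<in>UNIV. dist (mollify m b x) (b x) < e"
  proof (rule eventually_mono, intro ballI)
    fix m x assume "s m < e / (4 * B)"
    then have "2 * B * s m < e / 2" using B(1) by (simp add: field_simps)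
    moreover have "\<bar>mollify m b x - b x\<bar> \<le> e / 2 + 2 * B * s m"
      using B(2) d(2) e by (intro mollify_diff_le[OF torus_integrable_continuous[OF cont per] per _ _ _ s(2,3)]) auto
    ultimately show "dist (mollify m b x) (b x) < e" by (simp add: dist_real_def)
  qed
qed

lemma mollify_lipschitz:
  fixes \<delta> :: "real^'n \<Rightarrow> real"
  assumes lip: "\<And>x y. \<bar>\<delta> x - \<delta> y\<bar> \<le> norm (x - y)" and \<delta>: "integrable torus \<delta>" "lattice_periodic \<delta>"
  shows "\<bar>mollify m \<delta> x - mollify m \<delta> y\<bar> \<le> norm (x - y)"
proof -
  note int = torus_kernel_mult_shift_integrable[OF \<delta>]
  have "mollify m \<delta> x - mollify m \<delta> y = (\<integral>z. torus_kernel m z * \<delta> (x + z) - torus_kernel m z * \<delta> (y + z) \<partial>torus)"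
    by (simp add: mollify_eq_integral_shift[OF \<delta>] Bochner_Integration.integral_diff[OF int int])
  then have "\<bar>mollify m \<delta> x - mollify m \<delta> y\<bar> \<le> (\<integral>z. \<bar>torus_kernel m z * \<delta> (x + z) - torus_kernel m z * \<delta> (y + z)\<bar> \<partial>torus)"
    using integral_abs_bound by metis
  also have "\<dots> \<le> (\<integral>z. torus_kernel m z * norm (x - y) \<partial>(torus :: (real^'n) measure))"
  proof (rule integral_mono)
    fix z :: "real^'n"
    have "torus_kernel m z * \<bar>\<delta> (x + z) - \<delta> (y + z)\<bar> \<le> torus_kernel m z * norm (x - y)"
      using lip[of "x + z" "y + z"] by (intro mult_left_mono torus_kernel_nonneg) simp
    then show "\<bar>torus_kernel m z * \<delta> (x + z) - torus_kernel m z * \<delta> (y + z)\<bar> \<le> torus_kernel m z * norm (x - y)"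
      by (simp only: right_diff_distrib[symmetric] abs_mult abs_of_nonneg[OF torus_kernel_nonneg])
  qed (intro integrable_abs Bochner_Integration.integrable_diff int integrable_mult_left torus_kernel_integrable)+
  also have "\<dots> = norm (x - y)" using torus_kernel_mass[of m, where 'n='n] by simp
  finally show ?thesis .
qed

subsection \<open>Convergence in L1\<close>

definition torus_L1_norm :: "(real^'n \<Rightarrow> real) \<Rightarrow> ennreal" where
  "torus_L1_norm f = (\<integral>\<^sup>+x. ennreal \<bar>f x\<bar> \<partial>torus)"

lemma torus_L1_norm_mono: "(\<And>x. \<bar>f x\<bar> \<le> \<bar>g x\<bar>) \<Longrightarrow> torus_L1_norm f \<le> torus_L1_norm g"
  unfolding torus_L1_norm_def by (intro nn_integral_mono ennreal_leI) auto

lemma torus_L1_norm_cmult: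
  assumes [measurable]: "f \<in> borel_measurable borel"
  shows "torus_L1_norm (\<lambda>x. c * f x) = ennreal \<bar>c\<bar> * torus_L1_norm f"
  unfolding torus_L1_norm_def abs_mult by (simp add: ennreal_mult nn_integral_cmult)

lemma torus_L1_norm_add_le:
  assumes [measurable]: "f \<in> borel_measurable borel" "g \<in> borel_measurable borel"
  shows "torus_L1_norm (\<lambda>x. f x + g x) \<le> torus_L1_norm f + torus_L1_norm g"
proof -
  have "torus_L1_norm (\<lambda>x. f x + g x) \<le> (\<integral>\<^sup>+x. ennreal \<bar>f x\<bar> + ennreal \<bar>g x\<bar> \<partial>torus)"
    unfolding torus_L1_norm_def
    by (intro nn_integral_mono) (simp add: abs_triangle_ineq ennreal_leI flip: ennreal_plus)
  also have "\<dots> = torus_L1_norm f + torus_L1_norm g"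
    unfolding torus_L1_norm_def by (rule nn_integral_add) measurable
  finally show ?thesis .
qed

lemma torus_L1_norm_le_bound:
  assumes "\<And>x :: real^'n. \<bar>f x\<bar> \<le> B"
  shows "torus_L1_norm f \<le> ennreal B"
proof -
  have "torus_L1_norm f \<le> (\<integral>\<^sup>+x. ennreal B \<partial>(torus :: (real^'n) measure))"
    unfolding torus_L1_norm_def by (intro nn_integral_mono ennreal_leI assms)
  then show ?thesis by simp
qed

lemma torus_integrable_iff_L1_norm:
  "integrable torus f \<longleftrightarrow> f \<in> borel_measurable borel \<and> torus_L1_norm f < \<infinity>"
  by (simp add: integrable_iff_bounded torus_L1_norm_def measurable_def)

lemma torus_L1_norm_dominated:
  fixes f :: "real^'n \<Rightarrow> real"
  assumes "\<And>i. s i \<in> borel_measurable borel" "f \<in> borel_measurable borel" "integrable torus w"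
    and "AE x in torus. (\<lambda>i. s i x) \<longlonglongrightarrow> f x" and bound: "\<And>i x. \<bar>s i x\<bar> \<le> w x"
  shows "(\<lambda>i. torus_L1_norm (\<lambda>x. s i x - f x)) \<longlonglongrightarrow> 0"
proof -
  have "(\<integral>\<^sup>+x. norm (w x) \<partial>torus) < \<infinity>" "w \<in> borel_measurable borel"
    using assms(3) by (auto simp: integrable_iff_bounded)
  moreover have "w x = norm (w x)" for x
    using order_trans[OF abs_ge_zero bound[of 0 x]] by simp
  ultimately have "(\<lambda>i. \<integral>\<^sup>+x. norm (f x - s i x) \<partial>torus) \<longlonglongrightarrow> 0"
    using assms by (intro nn_integral_dominated_convergence_norm[where w=w]) auto
  then show ?thesis by (simp add: torus_L1_norm_def abs_minus_commute)
qed

lemma compact_indicator_limit_of_periodic: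
  assumes K: "compact K" "K \<subseteq> unit_cell"
  obtains f :: "nat \<Rightarrow> real^'n \<Rightarrow> real" where "\<And>j. continuous_on UNIV (f j)" "\<And>j. lattice_periodic (f j)"
    "\<And>j x. \<bar>f j x\<bar> \<le> 1" "\<And>x. (\<lambda>j. f j x) \<longlonglongrightarrow> indicator K (wrap x)"
proof (cases "lattice_hull K = {}")
  case True
  then have "wrap x \<notin> K" for x using lattice_hull_iff_wrap[OF K(2)] by blast
  then show thesis by (intro that[of "\<lambda>_ _. 0"]) (simp_all add: lattice_periodic_const)
next
  case False
  define H where "H = lattice_hull K"
  have H: "closed H" "H \<noteq> {}" using closed_lattice_hull[OF K(1)] False by (simp_all add: H_def)
  have wrap_H: "wrap x \<in> K \<longleftrightarrow> x \<in> H" for x by (simp add: H_def lattice_hull_iff_wrap[OF K(2)])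
  show thesis
  proof
    show "continuous_on UNIV (\<lambda>x. max 0 (1 - real j * infdist x H))" for j
      by (intro continuous_intros)
    show "lattice_periodic (\<lambda>x. max 0 (1 - real j * infdist x H))" for j
      by (rule lattice_periodic_compose[OF lattice_periodic_infdist])
        (simp add: H_def lattice_invariant_hull)
    show "\<bar>max 0 (1 - real j * infdist x H)\<bar> \<le> 1" for j x
      by (auto simp: infdist_nonneg)
    show "(\<lambda>j. max 0 (1 - real j * infdist x H)) \<longlonglongrightarrow> indicator K (wrap x)" for x
    proof (cases "x \<in> H")
      case True
      then show ?thesis using wrap_H[of x] by simp
    next
      case False
      then have pos: "infdist x H > 0"
        using in_closed_iff_infdist_zero[OF H, of x] infdist_nonneg[of x H] by linarith
      then obtain J where "1 < real J * infdist x H" using reals_Archimedean3 by blast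
      moreover have "real J * infdist x H \<le> real j * infdist x H" if "J \<le> j" for j
        using that pos by simp
      ultimately have "\<forall>j\<ge>J. max 0 (1 - real j * infdist x H) = 0"
        by (fastforce simp: max_def)
      then show ?thesis
        using False wrap_H[of x] by (intro tendsto_eventually) (auto simp: eventually_sequentially)
    qed
  qed
qed

definition continuous_L1_limit :: "(real^'n \<Rightarrow> real) \<Rightarrow> bool" where
  "continuous_L1_limit w \<longleftrightarrow> (\<forall>e>0. \<exists>b. continuous_on UNIV b \<and> lattice_periodic b \<and> torus_L1_norm (\<lambda>x. w x - b x) < ennreal e)"

lemma continuous_L1_limitI:
  fixes w :: "real^'n \<Rightarrow> real"
  assumes w: "w \<in> borel_measurable borel" and s: "\<And>i. continuous_L1_limit (s i)" "\<And>i. s i \<in> borel_measurable borel"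
    and lim: "(\<lambda>i. torus_L1_norm (\<lambda>x. s i x - w x)) \<longlonglongrightarrow> 0"
  shows "continuous_L1_limit w"
  unfolding continuous_L1_limit_def
proof (intro allI impI)
  fix e :: real assume "e > 0"
  then have "\<forall>\<^sub>F i in sequentially. torus_L1_norm (\<lambda>x. s i x - w x) < ennreal (e/2)"
    by (intro order_tendstoD(2)[OF lim]) simp
  then obtain i where i: "torus_L1_norm (\<lambda>x. w x - s i x) < ennreal (e/2)"
    by (auto simp: eventually_sequentially torus_L1_norm_def abs_minus_commute)
  obtain b where b: "continuous_on UNIV b" "lattice_periodic b" "torus_L1_norm (\<lambda>x. s i x - b x) < ennreal (e/2)"
    using s(1)[of i] \<open>e > 0\<close> unfolding continuous_L1_limit_def by (meson half_gt_zero)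
  have "torus_L1_norm (\<lambda>x. w x - b x) \<le> torus_L1_norm (\<lambda>x. w x - s i x) + torus_L1_norm (\<lambda>x. s i x - b x)"
    using torus_L1_norm_add_le[of "\<lambda>x. w x - s i x" "\<lambda>x. s i x - b x"] w s(2) borel_measurable_continuous_onI[OF b(1)]
    by simp
  also have "\<dots> < ennreal (e/2 + e/2)" using i b(3) by (rule add_mono_ennreal)
  finally have "torus_L1_norm (\<lambda>x. w x - b x) < ennreal e" by simp
  then show "\<exists>b. continuous_on UNIV b \<and> lattice_periodic b \<and> torus_L1_norm (\<lambda>x. w x - b x) < ennreal e"
    using b by blast
qed

lemma continuous_L1_limit_continuous:
  "continuous_on UNIV b \<Longrightarrow> lattice_periodic b \<Longrightarrow> continuous_L1_limit b"
  unfolding continuous_L1_limit_def by (auto intro!: exI[of _ b] simp: torus_L1_norm_def)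

lemma continuous_L1_limit_add:
  fixes v w :: "real^'n \<Rightarrow> real"
  assumes v: "continuous_L1_limit v" "v \<in> borel_measurable borel" and w: "continuous_L1_limit w" "w \<in> borel_measurable borel"
  shows "continuous_L1_limit (\<lambda>x. v x + w x)"
  unfolding continuous_L1_limit_def
proof (intro allI impI)
  fix e :: real assume "e > 0"
  then obtain b c where b: "continuous_on UNIV b" "lattice_periodic b" "torus_L1_norm (\<lambda>x. v x - b x) < ennreal (e/2)"
    and c: "continuous_on UNIV c" "lattice_periodic c" "torus_L1_norm (\<lambda>x. w x - c x) < ennreal (e/2)"
    using v(1) w(1) unfolding continuous_L1_limit_def by (meson half_gt_zero)
  have "torus_L1_norm (\<lambda>x. v x + w x - (b x + c x)) \<le> torus_L1_norm (\<lambda>x. v x - b x) + torus_L1_norm (\<lambda>x. w x - c x)"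
    using torus_L1_norm_add_le[of "\<lambda>x. v x - b x" "\<lambda>x. w x - c x"] v(2) w(2)
      borel_measurable_continuous_onI[OF b(1)] borel_measurable_continuous_onI[OF c(1)]
    by (simp add: algebra_simps)
  also have "\<dots> < ennreal (e/2 + e/2)" using b(3) c(3) by (rule add_mono_ennreal)
  finally show "\<exists>b. continuous_on UNIV b \<and> lattice_periodic b \<and> torus_L1_norm (\<lambda>x. v x + w x - b x) < ennreal e"
    using b(1,2) c(1,2) by (intro exI[of _ "\<lambda>x. b x + c x"]) (auto intro: continuous_on_add lattice_periodic_add)
qed

lemma continuous_L1_limit_indicator_compact:
  fixes K :: "(real^'n) set"
  assumes K: "compact K" "K \<subseteq> unit_cell"
  shows "continuous_L1_limit (\<lambda>x. c * indicator K x)"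
proof -
  obtain f :: "nat \<Rightarrow> real^'n \<Rightarrow> real" where f: "\<And>j. continuous_on UNIV (f j)" "\<And>j. lattice_periodic (f j)" "\<And>j x. \<bar>f j x\<bar> \<le> 1"
    "\<And>x. (\<lambda>j. f j x) \<longlonglongrightarrow> indicator K (wrap x)"
    using compact_indicator_limit_of_periodic[OF K] by metis
  have [measurable]: "K \<in> sets borel" using K(1) by (simp add: compact_imp_closed)
  have [measurable]: "f j \<in> borel_measurable borel" for j by (rule borel_measurable_continuous_onI[OF f(1)])
  show ?thesis
  proof (rule continuous_L1_limitI)
    show "continuous_L1_limit (\<lambda>x. c * f j x)" for j
      by (intro continuous_L1_limit_continuous continuous_intros f(1) lattice_periodic_mult lattice_periodic_const f(2))
    show "(\<lambda>j. torus_L1_norm (\<lambda>x. c * f j x - c * indicator K x)) \<longlonglongrightarrow> 0"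
    proof (rule torus_L1_norm_dominated[where w="\<lambda>_. \<bar>c\<bar>"])
      have "(\<lambda>j. c * f j x) \<longlonglongrightarrow> c * indicator K x" if "x \<in> unit_cell" for x
        using f(4)[of x] by (intro tendsto_mult tendsto_const) (simp add: wrap_id that)
      then show "AE x in torus. (\<lambda>j. c * f j x) \<longlonglongrightarrow> c * indicator K x" by (simp add: AE_torus_iff)
      show "\<bar>c * f j x\<bar> \<le> \<bar>c\<bar>" for j x using f(3)[of j x] by (simp add: abs_mult mult_left_le)
    qed simp_all
  qed simp_all
qed

lemma compact_approximates_in_unit_cell:
  fixes A :: "(real^'n) set"
  assumes [measurable]: "A \<in> sets borel" and "e > 0"
  obtains K where "compact K" "K \<subseteq> A" "K \<subseteq> unit_cell" "measure torus (A - K) < e"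
proof -
  let ?compacts = "{K. K \<subseteq> A \<inter> unit_cell \<and> compact K}"
  have "emeasure torus (A \<inter> unit_cell) = (SUP K\<in>?compacts. emeasure torus K)"
    by (rule inner_regular) auto
  from SUP_approx_ennreal[OF \<open>e > 0\<close> _ this]
  have "\<exists>K\<in>?compacts. emeasure torus (A \<inter> unit_cell) < emeasure torus K + ennreal e"
    using torus.emeasure_finite by fastforce
  then obtain K where K: "K \<subseteq> A \<inter> unit_cell" "compact K" and "emeasure torus (A \<inter> unit_cell) < emeasure torus K + ennreal e"
    by blast
  then have "measure torus (A \<inter> unit_cell) < measure torus K + e"
    using \<open>e > 0\<close> by (simp add: torus.emeasure_eq_measure ennreal_less_iff flip: ennreal_plus)
  then have "measure torus (A \<inter> unit_cell - K) < e"
    using K by (subst torus.finite_measure_Diff) (auto simp: compact_imp_closed)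
  moreover have "measure torus (A - K) = measure torus (A \<inter> unit_cell - K)"
    using K(2) by (intro torus.finite_measure_eq_AE) (auto simp: AE_torus_iff compact_imp_closed)
  ultimately show thesis using K by (intro that[of K]) auto
qed

lemma continuous_L1_limit_indicator:
  fixes A :: "(real^'n) set"
  assumes A [measurable]: "A \<in> sets borel"
  shows "continuous_L1_limit (\<lambda>x. c * indicator A x)"
proof -
  have "\<exists>K. compact K \<and> K \<subseteq> A \<and> K \<subseteq> unit_cell \<and> measure torus (A - K) < 1 / Suc i" for i
    by (rule compact_approximates_in_unit_cell[OF A, of "1 / Suc i"]) auto
  then obtain K where K: "\<And>i. compact (K i)" "\<And>i. K i \<subseteq> A" "\<And>i. K i \<subseteq> unit_cell"
    "\<And>i. measure torus (A - K i) < 1 / Suc i"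
    by metis
  have [measurable]: "K i \<in> sets borel" for i using K(1) by (simp add: compact_imp_closed)
  show ?thesis
  proof (rule continuous_L1_limitI)
    show "continuous_L1_limit (\<lambda>x. c * indicator (K i) x)" for i
      by (rule continuous_L1_limit_indicator_compact[OF K(1,3)])
    have dist: "torus_L1_norm (\<lambda>x. c * indicator (K i) x - c * indicator A x) = ennreal (\<bar>c\<bar> * measure torus (A - K i))" for i
    proof -
      have "torus_L1_norm (\<lambda>x. c * indicator (K i) x - c * indicator A x) = torus_L1_norm (\<lambda>x. c * indicator (A - K i) x)"
        unfolding torus_L1_norm_def using K(2)[of i]
        by (intro nn_integral_cong) (auto split: split_indicator)
      also have "\<dots> = ennreal (\<bar>c\<bar> * measure torus (A - K i))"
        by (subst torus_L1_norm_cmult) (simp_all add: torus_L1_norm_def ennreal_indicator torus.emeasure_eq_measure ennreal_mult)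
      finally show ?thesis .
    qed
    have "(\<lambda>i. measure torus (A - K i)) \<longlonglongrightarrow> 0"
      by (rule real_tendsto_sandwich[OF _ _ tendsto_const LIMSEQ_inverse_real_of_nat])
        (use K(4) in \<open>auto intro!: always_eventually less_imp_le simp: inverse_eq_divide\<close>)
    then have "(\<lambda>i. ennreal (\<bar>c\<bar> * measure torus (A - K i))) \<longlonglongrightarrow> ennreal (\<bar>c\<bar> * 0)"
      by (intro tendsto_ennrealI tendsto_mult tendsto_const)
    then show "(\<lambda>i. torus_L1_norm (\<lambda>x. c * indicator (K i) x - c * indicator A x)) \<longlonglongrightarrow> 0"
      unfolding dist by simp
  qed simp_all
qed

lemma integrable_continuous_L1_limit:
  fixes w :: "real^'n \<Rightarrow> real"
  assumes "integrable torus w"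
  shows "continuous_L1_limit w"
  using assms
proof (induction rule: integrable_induct)
  case (base A c)
  then show ?case using continuous_L1_limit_indicator[of A c] by (simp add: mult.commute)
next
  case (add f g)
  then show ?case by (intro continuous_L1_limit_add) (auto simp: torus_integrable_iff_L1_norm)
next
  case (lim f s)
  then show ?case
    by (intro continuous_L1_limitI[of f s] torus_L1_norm_dominated[where w="\<lambda>x. 2 * \<bar>f x\<bar>"])
      (auto simp: torus_integrable_iff_L1_norm[of f] torus_integrable_iff_L1_norm[of "s _"])
qed

lemma mollify_L1_norm_le:
  fixes w :: "real^'n \<Rightarrow> real"
  assumes w: "integrable torus w"
  shows "torus_L1_norm (mollify m w) \<le> torus_L1_norm w"
proof -
  note [measurable] = borel_measurable_integrable[OF w]
  interpret pair_sigma_finite "torus :: (real^'n) measure" "torus :: (real^'n) measure" ..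
  have kernel_mass: "(\<integral>\<^sup>+x. ennreal (torus_kernel m (x - z)) \<partial>torus) = 1" for z :: "real^'n"
  proof -
    have "(\<integral>\<^sup>+x. ennreal (torus_kernel m (x + - z)) \<partial>torus) = (\<integral>\<^sup>+x. ennreal (torus_kernel m x) \<partial>(torus :: (real^'n) measure))"
      by (rule nn_integral_torus_translate) (simp_all add: lattice_periodic_compose[OF torus_kernel_periodic])
    also have "\<dots> = ennreal 1"
      using torus_kernel_mass[of m, where 'n='n] nn_integral_eq_integral[OF torus_kernel_integrable[of m, where 'a='n]]
      by (simp add: torus_kernel_nonneg)
    finally show ?thesis by simp
  qed
  have "torus_L1_norm (mollify m w) \<le> (\<integral>\<^sup>+x. (\<integral>\<^sup>+z. ennreal \<bar>w z\<bar> * ennreal (torus_kernel m (x - z)) \<partial>torus) \<partial>torus)"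
    unfolding torus_L1_norm_def
  proof (rule nn_integral_mono)
    fix x :: "real^'n"
    have "ennreal (norm (mollify m w x)) \<le> (\<integral>\<^sup>+z. ennreal (norm (w z * torus_kernel m (x - z))) \<partial>torus)"
      unfolding mollify_def torus_convolution_def real_scaleR_def
      by (rule integral_norm_bound_ennreal[OF torus_kernel_mult_integrable[OF w]])
    then show "ennreal \<bar>mollify m w x\<bar> \<le> (\<integral>\<^sup>+z. ennreal \<bar>w z\<bar> * ennreal (torus_kernel m (x - z)) \<partial>torus)"
      by (simp add: abs_mult torus_kernel_nonneg ennreal_mult)
  qed
  also have "\<dots> = (\<integral>\<^sup>+z. (\<integral>\<^sup>+x. ennreal \<bar>w z\<bar> * ennreal (torus_kernel m (x - z)) \<partial>torus) \<partial>torus)"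
    by (rule Fubini'[symmetric]) measurable
  also have "\<dots> = torus_L1_norm w"
    by (simp add: nn_integral_cmult kernel_mass torus_L1_norm_def)
  finally show ?thesis .
qed

lemma mollify_continuous_tendsto_L1:
  assumes b: "continuous_on UNIV b" "lattice_periodic b"
  shows "(\<lambda>m. torus_L1_norm (\<lambda>x. mollify m b x - b x)) \<longlonglongrightarrow> 0"
proof (rule tendsto_zero_ennreal)
  fix e :: real assume e: "0 < e"
  then have "\<forall>\<^sub>F m in sequentially. \<forall>x\<in>UNIV. dist (mollify m b x) (b x) < e / 2"
    by (intro uniform_limitD[OF mollify_uniform_limit[OF b]]) simp
  then show "\<forall>\<^sub>F m in sequentially. torus_L1_norm (\<lambda>x. mollify m b x - b x) < ennreal e"
  proof (rule eventually_mono)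
    fix m assume "\<forall>x\<in>UNIV. dist (mollify m b x) (b x) < e / 2"
    then have "torus_L1_norm (\<lambda>x. mollify m b x - b x) \<le> ennreal (e / 2)"
      by (intro torus_L1_norm_le_bound less_imp_le) (simp add: dist_real_def)
    also have "\<dots> < ennreal e" using e by (intro ennreal_lessI) auto
    finally show "torus_L1_norm (\<lambda>x. mollify m b x - b x) < ennreal e" .
  qed
qed

lemma mollify_tendsto_L1:
  assumes w: "integrable torus w"
  shows "(\<lambda>m. torus_L1_norm (\<lambda>x. mollify m w x - w x)) \<longlonglongrightarrow> 0"
proof (rule tendsto_zero_ennreal)
  fix e :: real assume e: "0 < e"
  then have third_pos: "0 < e / 3" by simp
  obtain b where b: "continuous_on UNIV b" "lattice_periodic b" and wb: "torus_L1_norm (\<lambda>x. w x - b x) < ennreal (e / 3)"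
    using integrable_continuous_L1_limit[OF w] third_pos unfolding continuous_L1_limit_def by blast
  have b_integrable: "integrable torus b" by (rule torus_integrable_continuous[OF b])
  note [measurable] = borel_measurable_integrable[OF w] borel_measurable_integrable[OF b_integrable]
  have "\<forall>\<^sub>F m in sequentially. torus_L1_norm (\<lambda>x. mollify m b x - b x) < ennreal (e / 3)"
    using third_pos by (intro order_tendstoD(2)[OF mollify_continuous_tendsto_L1[OF b]]) simp
  then show "\<forall>\<^sub>F m in sequentially. torus_L1_norm (\<lambda>x. mollify m w x - w x) < ennreal e"
  proof eventually_elim
    case (elim m)
    have [measurable]: "mollify m w \<in> borel_measurable borel" "mollify m b \<in> borel_measurable borel"
      using w b_integrable by simp_all
    have "torus_L1_norm (\<lambda>x. mollify m w x - w x)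
        \<le> torus_L1_norm (\<lambda>x. mollify m w x - b x) + torus_L1_norm (\<lambda>x. b x - w x)"
      using torus_L1_norm_add_le[of "\<lambda>x. mollify m w x - b x" "\<lambda>x. b x - w x"] by simp
    also have "\<dots> \<le> torus_L1_norm (\<lambda>x. mollify m w x - mollify m b x) + torus_L1_norm (\<lambda>x. mollify m b x - b x)
        + torus_L1_norm (\<lambda>x. b x - w x)"
      using torus_L1_norm_add_le[of "\<lambda>x. mollify m w x - mollify m b x" "\<lambda>x. mollify m b x - b x"]
      by (simp add: add_right_mono)
    also have "\<dots> \<le> torus_L1_norm (\<lambda>x. w x - b x) + torus_L1_norm (\<lambda>x. mollify m b x - b x) + torus_L1_norm (\<lambda>x. w x - b x)"
      using mollify_L1_norm_le[of "\<lambda>x. w x - b x" m] w b_integrable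
      by (intro add_mono) (simp_all add: mollify_diff torus_L1_norm_def abs_minus_commute)
    also have "\<dots> < ennreal (e / 3 + e / 3 + e / 3)"
      by (intro add_mono_ennreal wb elim)
    finally show ?case by simp
  qed
qed

section \<open>Displacements\<close>

subsection \<open>Vitali covers and expanding maps\<close>

lemma emeasure_UN_le_count_space:
  assumes "countable C" "\<And>i. i \<in> C \<Longrightarrow> B i \<in> sets M"
  shows "emeasure M (\<Union>i\<in>C. B i) \<le> (\<integral>\<^sup>+i. emeasure M (B i) \<partial>count_space C)"
proof -
  have [measurable]: "(\<Union>i\<in>C. B i) \<in> sets M" using assms by (intro sets.countable_UN') auto
  have "emeasure M (\<Union>i\<in>C. B i) = (\<integral>\<^sup>+x. indicator (\<Union>i\<in>C. B i) x \<partial>M)" by simp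
  also have "\<dots> \<le> (\<integral>\<^sup>+x. (\<integral>\<^sup>+i. indicator (B i) x \<partial>count_space C) \<partial>M)"
  proof (rule nn_integral_mono)
    fix x
    show "indicator (\<Union>i\<in>C. B i) x \<le> (\<integral>\<^sup>+i. (indicator (B i) x :: ennreal) \<partial>count_space C)"
    proof (cases "x \<in> (\<Union>i\<in>C. B i)")
      case True
      then obtain j where j: "j \<in> C" "x \<in> B j" by auto
      have "(1::ennreal) = (\<integral>\<^sup>+i. indicator {j} i \<partial>count_space C)"
        using j by (simp add: nn_integral_indicator emeasure_count_space)
      also have "\<dots> \<le> (\<integral>\<^sup>+i. (indicator (B i) x :: ennreal) \<partial>count_space C)"
        using j by (intro nn_integral_mono) (auto split: split_indicator)
      finally show ?thesis using True by simp
    qed simp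
  qed
  also have "\<dots> = (\<integral>\<^sup>+i. (\<integral>\<^sup>+x. indicator (B i) x \<partial>M) \<partial>count_space C)"
    using assms by (intro nn_integral_count_space_nn_integral) auto
  also have "\<dots> = (\<integral>\<^sup>+i. emeasure M (B i) \<partial>count_space C)"
    using assms by (intro nn_integral_cong) auto
  finally show ?thesis .
qed

lemma emeasure_Vitali_cover_le:
  fixes f :: "'a::euclidean_space \<Rightarrow> ennreal"
  assumes f [measurable]: "f \<in> borel_measurable borel"
    and r: "\<And>p. p \<in> F \<Longrightarrow> 0 < r p \<and> r p \<le> R"
    and U: "U \<in> sets borel" "\<And>p. p \<in> F \<Longrightarrow> cball p (r p) \<subseteq> U"
    and E: "\<And>p. p \<in> F \<Longrightarrow> E p \<in> sets borel"
    and E_le: "\<And>p. p \<in> F \<Longrightarrow> emeasure lborel (E p) \<le> a * (\<integral>\<^sup>+z\<in>cball p (r p). f z \<partial>lborel)"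
  obtains C where "C \<subseteq> F" "F \<subseteq> (\<Union>j\<in>C. ball j (5 * r j))"
    "emeasure lborel (\<Union>j\<in>C. E j) \<le> a * (\<integral>\<^sup>+z\<in>U. f z \<partial>lborel)"
proof -
  obtain C where C: "countable C" "C \<subseteq> F" "pairwise (\<lambda>i j. disjnt (cball i (r i)) (cball j (r j))) C"
    "\<And>i. i \<in> F \<Longrightarrow> \<exists>j. j \<in> C \<and> \<not> disjnt (cball i (r i)) (cball j (r j)) \<and> cball i (r i) \<subseteq> ball j (5 * r j)"
    by (rule Vitali_covering_lemma_cballs_balls[OF r, where a="\<lambda>i. i"]) (blast intro: that)+
  have mass: "(\<integral>\<^sup>+z\<in>A. f z \<partial>lborel) = emeasure (density lborel f) A" if "A \<in> sets borel" for A
    using that by (simp add: emeasure_density)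
  have "emeasure lborel (\<Union>j\<in>C. E j) \<le> (\<integral>\<^sup>+j. emeasure lborel (E j) \<partial>count_space C)"
    using C(1,2) E by (intro emeasure_UN_le_count_space) auto
  also have "\<dots> \<le> (\<integral>\<^sup>+j. a * emeasure (density lborel f) (cball j (r j)) \<partial>count_space C)"
    using C(2) E_le by (intro nn_integral_mono) (auto simp: mass borel_closed)
  also have "\<dots> = a * (\<integral>\<^sup>+j. emeasure (density lborel f) (cball j (r j)) \<partial>count_space C)"
    by (rule nn_integral_cmult) simp
  also have "\<dots> = a * emeasure (density lborel f) (\<Union>j\<in>C. cball j (r j))"
    using C(1,3) by (subst emeasure_UN_countable)
      (auto simp: disjoint_family_on_def pairwise_def disjnt_def borel_closed)
  also have "\<dots> \<le> a * (\<integral>\<^sup>+z\<in>U. f z \<partial>lborel)"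
    using C(2) U by (subst mass[OF U(1)], intro mult_left_mono emeasure_mono) auto
  finally have "emeasure lborel (\<Union>j\<in>C. E j) \<le> a * (\<integral>\<^sup>+z\<in>U. f z \<partial>lborel)" .
  moreover have "F \<subseteq> (\<Union>j\<in>C. ball j (5 * r j))"
  proof
    fix p assume p: "p \<in> F"
    then have "p \<in> cball p (r p)" using r by (simp add: less_imp_le)
    with C(4)[OF p] show "p \<in> (\<Union>j\<in>C. ball j (5 * r j))" by blast
  qed
  ultimately show thesis using C(2) that by blast
qed

lemma emeasure_lborel_cball_scale:
  fixes p q :: "'a::euclidean_space"
  assumes "0 \<le> c" "0 \<le> s"
  shows "emeasure lborel (cball p (c * s)) = ennreal (c ^ DIM('a)) * emeasure lborel (cball q s)"
  using assms by (simp add: emeasure_cball power_mult_distrib mult_ac flip: ennreal_mult)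

lemma nn_integral_compose_le:
  assumes [measurable]: "\<psi> \<in> measurable M N" "h \<in> borel_measurable N"
    and vimage_le: "\<And>A. A \<in> sets N \<Longrightarrow> emeasure M (\<psi> -` A \<inter> space M) \<le> c * emeasure N A"
  shows "(\<integral>\<^sup>+x. h (\<psi> x) \<partial>M) \<le> c * (\<integral>\<^sup>+x. h x \<partial>N)"
proof -
  have "(\<integral>\<^sup>+x. h (\<psi> x) \<partial>M) = (\<integral>\<^sup>+x. h x \<partial>distr M N \<psi>)"
    by (subst nn_integral_distr) simp_all
  also have "\<dots> \<le> (\<integral>\<^sup>+x. h x \<partial>scale_measure c N)"
  proof (rule nn_integral_mono_measure)
    have "emeasure (distr M N \<psi>) A \<le> emeasure (scale_measure c N) A" if "A \<in> sets N" for A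
      using vimage_le[OF that] that by (simp add: emeasure_distr)
    then show "distr M N \<psi> \<le> scale_measure c N"
      by (subst le_measure) simp_all
  qed simp
  also have "\<dots> = c * (\<integral>\<^sup>+x. h x \<partial>N)"
    by (rule nn_integral_scale_measure) simp
  finally show ?thesis .
qed

locale expanding_map =
  fixes \<psi> :: "'a::euclidean_space \<Rightarrow> 'a" and C :: real
  assumes measurable_map [measurable]: "\<psi> \<in> borel_measurable borel"
    and expanding: "dist x x' \<le> C * dist (\<psi> x) (\<psi> x')"
    and factor_nonneg: "0 \<le> C"
begin

lemma vimage_borel: "A \<in> sets borel \<Longrightarrow> \<psi> -` A \<in> sets borel"
  using measurable_sets[OF measurable_map, of A] by simp

lemma emeasure_vimage_ball_le:
  assumes "0 \<le> s"
  shows "emeasure lborel (\<psi> -` ball p (5 * s)) \<le> ennreal ((10 * C) ^ DIM('a)) * emeasure lborel (cball p s)"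
proof (cases "\<psi> -` ball p (5 * s) = {}")
  case False
  then obtain x0 where x0: "\<psi> x0 \<in> ball p (5 * s)" by blast
  have "\<psi> -` ball p (5 * s) \<subseteq> cball x0 (10 * C * s)"
  proof
    fix x assume "x \<in> \<psi> -` ball p (5 * s)"
    then have "dist (\<psi> x0) (\<psi> x) \<le> 10 * s"
      using x0 dist_triangle[of "\<psi> x0" "\<psi> x" p] by (simp add: dist_commute)
    then have "C * dist (\<psi> x0) (\<psi> x) \<le> C * (10 * s)" using factor_nonneg by (rule mult_left_mono)
    then show "x \<in> cball x0 (10 * C * s)" using expanding[of x0 x] by simp
  qed
  then have "emeasure lborel (\<psi> -` ball p (5 * s)) \<le> emeasure lborel (cball x0 (10 * C * s))"
    by (rule emeasure_mono) simp
  then show ?thesis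
    using emeasure_lborel_cball_scale[of "10 * C" s x0 p] factor_nonneg assms by simp
qed simp

lemma emeasure_vimage_open_le:
  assumes U: "open U"
  shows "emeasure lborel (\<psi> -` U) \<le> ennreal ((10 * C) ^ DIM('a)) * emeasure lborel U"
proof -
  have "\<exists>s. 0 < s \<and> s \<le> 1 \<and> cball p s \<subseteq> U" if "p \<in> U" for p
  proof -
    obtain s where "s > 0" "cball p s \<subseteq> U" using \<open>p \<in> U\<close> open_contains_cball_eq[OF U] by metis
    moreover have "cball p (min s 1) \<subseteq> cball p s" by (rule subset_cball) simp
    ultimately show ?thesis by (intro exI[of _ "min s 1"]) simp
  qed
  then obtain r where r: "\<And>p. p \<in> U \<Longrightarrow> 0 < r p \<and> r p \<le> 1" "\<And>p. p \<in> U \<Longrightarrow> cball p (r p) \<subseteq> U"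
    by metis
  obtain C' where C': "C' \<subseteq> U" "U \<subseteq> (\<Union>j\<in>C'. ball j (5 * r j))"
    "emeasure lborel (\<Union>j\<in>C'. \<psi> -` ball j (5 * r j)) \<le> ennreal ((10 * C) ^ DIM('a)) * (\<integral>\<^sup>+z\<in>U. 1 \<partial>lborel)"
  proof (rule emeasure_Vitali_cover_le[of "\<lambda>_. 1" U r 1 U "\<lambda>p. \<psi> -` ball p (5 * r p)" "ennreal ((10 * C) ^ DIM('a))"])
    show "emeasure lborel (\<psi> -` ball p (5 * r p)) \<le> ennreal ((10 * C) ^ DIM('a)) * (\<integral>\<^sup>+z\<in>cball p (r p). 1 \<partial>lborel)"
      if "p \<in> U" for p
      using emeasure_vimage_ball_le[of "r p" p] r(1)[OF that] by (simp add: borel_closed)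
    show "0 < r p \<and> r p \<le> 1" "cball p (r p) \<subseteq> U" if "p \<in> U" for p
      using r that by blast+
    show "U \<in> sets borel" "\<psi> -` ball p (5 * r p) \<in> sets borel" for p
      using U by (simp_all add: vimage_borel borel_open)
  qed simp
  have "emeasure lborel (\<psi> -` U) \<le> emeasure lborel (\<Union>j\<in>C'. \<psi> -` ball j (5 * r j))"
  proof (rule emeasure_mono)
    show "(\<Union>j\<in>C'. \<psi> -` ball j (5 * r j)) \<in> sets lborel"
      using vimage_borel[of "\<Union>j\<in>C'. ball j (5 * r j)"] by (simp add: vimage_UN open_UN)
  qed (use C'(2) in blast)
  also note C'(3)
  also have "(\<integral>\<^sup>+z\<in>U. 1 \<partial>lborel) = emeasure lborel U"
    using U by (simp add: borel_open)
  finally show ?thesis .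
qed

lemma emeasure_vimage_le:
  assumes A: "A \<in> sets borel"
  shows "emeasure lborel (\<psi> -` A) \<le> ennreal ((10 * C) ^ DIM('a)) * emeasure lborel A"
proof (rule ennreal_le_epsilon)
  define c where "c = (10 * C) ^ DIM('a)"
  have c: "0 \<le> c" using factor_nonneg by (simp add: c_def)
  fix e :: real assume e: "0 < e"
  then have "0 < e / (c + 1)" using c by simp
  then obtain U where U: "open U" "A \<subseteq> U" "emeasure lborel (U - A) < ennreal (e / (c + 1))"
    by (rule outer_regular_lborel[OF A])
  have "emeasure lborel (\<psi> -` A) \<le> emeasure lborel (\<psi> -` U)"
    using U(1,2) by (intro emeasure_mono) (auto intro!: vimage_borel)
  also have "\<dots> \<le> ennreal c * emeasure lborel U"
    unfolding c_def by (rule emeasure_vimage_open_le[OF U(1)])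
  also have "emeasure lborel U = emeasure lborel A + emeasure lborel (U - A)"
    using A U(1,2) by (subst plus_emeasure) (auto simp: Un_absorb1)
  also have "ennreal c * (emeasure lborel A + emeasure lborel (U - A)) \<le> ennreal c * (emeasure lborel A + ennreal (e / (c + 1)))"
    using U(3) by (intro mult_left_mono add_left_mono) auto
  also have "\<dots> = ennreal c * emeasure lborel A + ennreal (c * (e / (c + 1)))"
    using c e unfolding distrib_left by (subst ennreal_mult) auto
  also have "\<dots> \<le> ennreal c * emeasure lborel A + ennreal e"
    using c e by (intro add_left_mono ennreal_leI) (simp add: field_simps)
  finally show "emeasure lborel (\<psi> -` A) \<le> ennreal ((10 * C) ^ DIM('a)) * emeasure lborel A + ennreal e"
    by (simp add: c_def)
qed

lemma nn_integral_lborel_compose_le: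
  assumes "h \<in> borel_measurable borel"
  shows "(\<integral>\<^sup>+x. h (\<psi> x) \<partial>lborel) \<le> ennreal ((10 * C) ^ DIM('a)) * (\<integral>\<^sup>+x. h x \<partial>lborel)"
  by (rule nn_integral_compose_le) (use assms emeasure_vimage_le in auto)

end

subsection \<open>Rank-one displacements of the torus\<close>

definition displace :: "(real^'n \<Rightarrow> real) \<Rightarrow> real^'n \<Rightarrow> real^'n \<Rightarrow> real^'n" where
  "displace e y x = x + e x *\<^sub>R y"

definition small_gradient :: "(real^'n \<Rightarrow> real) \<Rightarrow> (real^'n \<Rightarrow> real^'n) \<Rightarrow> bool" where
  "small_gradient e e' \<longleftrightarrow> C1_periodic e e' \<and> (\<forall>x. norm (e' x) \<le> 1/2)"

lemma displace_add:
  "lattice_periodic e \<Longrightarrow> k \<in> int_lattice \<Longrightarrow> displace e y (x + k) = displace e y x + k"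
  by (simp add: displace_def lattice_periodicD)

lemma lattice_periodic_displace:
  "lattice_periodic f \<Longrightarrow> lattice_periodic e \<Longrightarrow> lattice_periodic (\<lambda>x. f (displace e y x))"
  by (rule lattice_periodicI) (simp add: displace_add lattice_periodicD)

lemma displace_measurable [measurable]:
  assumes [measurable]: "e \<in> borel_measurable borel"
  shows "displace e y \<in> borel_measurable borel"
  unfolding displace_def by measurable

lemma C1_periodic_displace:
  assumes f: "C1_periodic f f'" and e: "C1_periodic e e'"
  shows "C1_periodic (\<lambda>x. f (displace e y x)) (\<lambda>x. f' (displace e y x) + (f' (displace e y x) \<bullet> y) *\<^sub>R e' x)"
  unfolding C1_periodic_def
proof (intro conjI allI)
  show "lattice_periodic (\<lambda>x. f (displace e y x))"
    by (rule lattice_periodic_displace[OF C1_periodic_periodic[OF f] C1_periodic_periodic[OF e]])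
  show "((\<lambda>x. f (displace e y x)) has_derivative (\<lambda>h. (f' (displace e y x) + (f' (displace e y x) \<bullet> y) *\<^sub>R e' x) \<bullet> h)) (at x)" for x
  proof -
    have "(displace e y has_derivative (\<lambda>h. h + (e' x \<bullet> h) *\<^sub>R y)) (at x)"
      unfolding displace_def
      by (intro has_derivative_add has_derivative_ident has_derivative_scaleR_left C1_periodicD(2)[OF e])
    from has_derivative_compose[OF this C1_periodicD(2)[OF f]]
    show ?thesis by (simp add: inner_add_left inner_add_right mult.commute)
  qed
  have "continuous_on UNIV (displace e y)"
    unfolding displace_def by (intro continuous_intros C1_periodicD(4)[OF e])
  then have "continuous_on UNIV (\<lambda>x. f' (displace e y x))"
    by (rule continuous_on_compose2[OF C1_periodicD(3)[OF f]]) simp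
  then show "continuous_on UNIV (\<lambda>x. f' (displace e y x) + (f' (displace e y x) \<bullet> y) *\<^sub>R e' x)"
    by (intro continuous_intros C1_periodicD(3)[OF e])
qed

lemma small_gradientD:
  assumes "small_gradient e e'"
  shows small_gradient_C1_periodic: "C1_periodic e e'" and small_gradient_norm_le: "norm (e' x) \<le> 1"
  using assms order_trans[of "norm (e' x)" "1/2" 1] by (auto simp: small_gradient_def)

lemma displace_expanding:
  assumes e: "small_gradient e e'" and y: "norm y \<le> 1"
  shows "dist x x' \<le> 2 * dist (displace e y x) (displace e y x')"
proof -
  have "\<bar>e x - e x'\<bar> \<le> 1/2 * norm (x - x')"
    using e by (intro gradient_bounded_imp_lipschitz) (auto simp: small_gradient_def C1_periodic_def)
  then have "norm ((e x - e x') *\<^sub>R y) \<le> (1/2 * norm (x - x')) * 1"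
    unfolding norm_scaleR using y by (intro mult_mono) auto
  moreover have "x - x' = (displace e y x - displace e y x') - (e x - e x') *\<^sub>R y"
    by (simp add: displace_def algebra_simps)
  ultimately show ?thesis
    using norm_triangle_ineq4[of "displace e y x - displace e y x'" "(e x - e x') *\<^sub>R y"]
    by (simp add: dist_norm)
qed

lemma nn_integral_displace_le:
  fixes h :: "real^'n \<Rightarrow> ennreal"
  assumes e: "small_gradient e e'" and y: "norm y \<le> 1"
    and h [measurable]: "h \<in> borel_measurable borel" and per: "lattice_periodic h"
  shows "(\<integral>\<^sup>+x. h (displace e y x) \<partial>torus) \<le> 20 ^ CARD('n) * (\<integral>\<^sup>+x. h x \<partial>torus)"
proof -
  note e1 = small_gradient_C1_periodic[OF e]
  note [measurable] = C1_periodic_measurable(1)[OF e1]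
  interpret expanding_map "displace e y" 2
    by unfold_locales (simp_all add: displace_expanding[OF e y])
  have "(\<integral>\<^sup>+x. h (displace e y x) \<partial>torus) = (\<integral>\<^sup>+x. indicator unit_cell (displace e y x) * h (displace e y x) \<partial>lborel)"
    by (rule nn_integral_fundamental_domain[symmetric])
      (simp_all add: displace_add lattice_periodic_displace[OF per] C1_periodic_periodic[OF e1])
  also have "\<dots> \<le> ennreal ((10 * 2) ^ DIM(real^'n)) * (\<integral>\<^sup>+x. indicator unit_cell x * h x \<partial>lborel)"
    by (rule nn_integral_lborel_compose_le) measurable
  also have "\<dots> = 20 ^ CARD('n) * (\<integral>\<^sup>+x. h x \<partial>torus)"
    by (simp add: nn_integral_torus flip: ennreal_power)
  finally show ?thesis .
qed

section \<open>Pullback of closed forms\<close>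

subsection \<open>Exterior algebra at a point\<close>

type_synonym 'n form = "(real,'n) vec \<Rightarrow> 'n set \<Rightarrow> real"

definition fsign :: "'n::{finite,linorder} \<Rightarrow> 'n set \<Rightarrow> real" where
  "fsign j J = (-1) ^ card {k\<in>J. k < j}"

definition interior_product ::
  "(real,'n) vec \<Rightarrow> ('n::{finite,linorder} set \<Rightarrow> 'b::real_vector) \<Rightarrow> 'n set \<Rightarrow> 'b" where
  "interior_product y a I = (\<Sum>i\<in>- I. (fsign i (insert i I) * y $ i) *\<^sub>R a (insert i I))"

definition covector_wedge :: "(real,'n) vec \<Rightarrow> ('n::{finite,linorder} set \<Rightarrow> real) \<Rightarrow> 'n set \<Rightarrow> real" where
  "covector_wedge p a K = (\<Sum>k\<in>K. fsign k K * p $ k * a (K - {k}))"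

text \<open>Here \<open>D K\<close> stands for the gradient of the coefficient with index set \<open>K\<close>.\<close>

definition exterior_derivative :: "('n::{finite,linorder} set \<Rightarrow> (real,'n) vec) \<Rightarrow> 'n set \<Rightarrow> real" where
  "exterior_derivative D J = (\<Sum>j\<in>J. fsign j J * D (J - {j}) $ j)"

lemma fsign_insert: "a \<notin> S \<Longrightarrow> fsign j (insert a S) = (if a < j then - fsign j S else fsign j S)"
proof -
  assume a: "a \<notin> S"
  have "{k \<in> insert a S. k < j} = (if a < j then insert a {k \<in> S. k < j} else {k \<in> S. k < j})" by auto
  then show ?thesis using a by (simp add: fsign_def)
qed

lemma fsign_remove: "a \<in> S \<Longrightarrow> fsign j (S - {a}) = (if a < j then - fsign j S else fsign j S)"
  using fsign_insert[of a "S - {a}" j] by (simp add: insert_absorb)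

lemma fsign_cancel [simp]: "fsign j J * (fsign j J * a) = a"
  by (simp add: fsign_def flip: power_mult_distrib mult.assoc)

lemma fsign_abs [simp]: "\<bar>fsign j J\<bar> = 1"
  by (simp add: fsign_def power_abs)

lemma fsign_swap:
  assumes "j \<in> J" "k \<in> J" "j \<noteq> k"
  shows "fsign j J * fsign k (J - {j}) = - (fsign k J * fsign j (J - {k}))"
  using assms by (cases "j < k") (auto simp: fsign_remove)

lemma fsign_exchange:
  assumes "j \<in> I" "i \<notin> I"
  shows "fsign j I * fsign i (insert i (I - {j})) = - (fsign i (insert i I) * fsign j (insert i I))"
  using assms by (cases "j < i") (auto simp: fsign_insert fsign_remove)

lemma sum_fsign_swap:
  "(\<Sum>j\<in>J. \<Sum>k\<in>J - {j}. fsign j J * fsign k (J - {j}) * a j k)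
    = - (\<Sum>k\<in>J. \<Sum>j\<in>J - {k}. fsign k J * fsign j (J - {k}) * a j k)"
proof -
  have "(\<Sum>j\<in>J. \<Sum>k\<in>J - {j}. fsign j J * fsign k (J - {j}) * a j k)
      = (\<Sum>j\<in>J. \<Sum>k\<in>{k. k \<in> J \<and> j \<noteq> k}. - (fsign k J * fsign j (J - {k}) * a j k))"
    by (intro sum.cong) (auto simp: fsign_swap)
  also have "\<dots> = (\<Sum>k\<in>J. \<Sum>j\<in>{j. j \<in> J \<and> j \<noteq> k}. - (fsign k J * fsign j (J - {k}) * a j k))"
    by (rule sum.swap_restrict) simp_all
  also have "\<dots> = (\<Sum>k\<in>J. \<Sum>j\<in>J - {k}. - (fsign k J * fsign j (J - {k}) * a j k))"
    by (intro sum.cong) auto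
  finally show ?thesis by (simp add: sum_negf)
qed

lemma sum_fsign_symmetric:
  assumes "\<And>j k. j \<in> J \<Longrightarrow> k \<in> J - {j} \<Longrightarrow> a k j = a j k"
  shows "(\<Sum>j\<in>J. \<Sum>k\<in>J - {j}. fsign j J * fsign k (J - {j}) * a j k) = 0"
proof -
  have "(\<Sum>j\<in>J. \<Sum>k\<in>J - {j}. fsign j J * fsign k (J - {j}) * a j k)
      = (\<Sum>j\<in>J. \<Sum>k\<in>J - {j}. fsign j J * fsign k (J - {j}) * a k j)"
    using assms by (intro sum.cong) auto
  with sum_fsign_swap[of J a] show ?thesis by simp
qed

lemma covector_wedge_twice: "covector_wedge p (covector_wedge p a) J = 0"
proof -
  have "covector_wedge p (covector_wedge p a) J
      = (\<Sum>j\<in>J. \<Sum>k\<in>J - {j}. fsign j J * fsign k (J - {j}) * (p $ j * p $ k * a (J - {j} - {k})))"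
    unfolding covector_wedge_def by (simp add: sum_distrib_left mult_ac)
  also have "\<dots> = 0"
    by (rule sum_fsign_symmetric) (simp add: mult_ac Diff_insert2[symmetric] insert_commute)
  finally show ?thesis .
qed

lemma covector_wedge_add: "covector_wedge p (\<lambda>I. a I + b I) K = covector_wedge p a K + covector_wedge p b K"
  by (simp add: covector_wedge_def distrib_left sum.distrib)

lemma covector_wedge_cong:
  "(\<And>k. k \<in> K \<Longrightarrow> a (K - {k}) = b (K - {k})) \<Longrightarrow> covector_wedge p a K = covector_wedge p b K"
  unfolding covector_wedge_def by (intro sum.cong) auto

lemma interior_product_add_scaleR:
  "interior_product y (\<lambda>K. D K + c K *\<^sub>R p) I = interior_product y D I + interior_product y c I *\<^sub>R p"
  by (simp add: interior_product_def scaleR_add_right sum.distrib scaleR_sum_left)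

lemma exterior_derivative_add_scaleR:
  "exterior_derivative (\<lambda>K. D K + c K *\<^sub>R p) J = exterior_derivative D J + covector_wedge p c J"
  by (simp add: exterior_derivative_def covector_wedge_def distrib_left sum.distrib mult_ac)

text \<open>Cartan's formula for the contraction of a closed form with a constant vector field.\<close>

lemma exterior_derivative_interior_product:
  fixes D :: "'n::{finite,linorder} set \<Rightarrow> (real,'n) vec"
  assumes closed: "\<And>J. card J = Suc r \<Longrightarrow> exterior_derivative D J = 0" and I: "card I = r"
  shows "exterior_derivative (interior_product y D) I = D I \<bullet> y"
proof -
  define S where "S i j = fsign j I * fsign i (insert i (I - {j})) * D (insert i (I - {j})) $ j" for i j
  have "interior_product y D (I - {j}) $ j = fsign j I * y $ j * D I $ j
      + (\<Sum>i\<in>- I. fsign i (insert i (I - {j})) * y $ i * D (insert i (I - {j})) $ j)" if "j \<in> I" for j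
  proof -
    have "- (I - {j}) = insert j (- I)" by auto
    then show ?thesis using that by (simp add: interior_product_def insert_absorb)
  qed
  then have "exterior_derivative (interior_product y D) I
      = (\<Sum>j\<in>I. y $ j * D I $ j + (\<Sum>i\<in>- I. y $ i * S i j))"
    unfolding exterior_derivative_def S_def
    by (intro sum.cong) (simp_all add: distrib_left sum_distrib_left mult_ac)
  also have "\<dots> = (\<Sum>j\<in>I. y $ j * D I $ j) + (\<Sum>i\<in>- I. y $ i * (\<Sum>j\<in>I. S i j))"
    by (simp add: sum.distrib sum.swap[of _ "- I" I] sum_distrib_left)
  also have "(\<Sum>i\<in>- I. y $ i * (\<Sum>j\<in>I. S i j)) = (\<Sum>i\<in>- I. y $ i * D I $ i)"
  proof (intro sum.cong arg_cong2[where f="(*)"] refl)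
    fix i assume i: "i \<in> - I"
    let ?J = "insert i I"
    have "exterior_derivative D ?J = 0" using i I by (intro closed) simp
    moreover have "?J - {i} = I" using i by auto
    ultimately have rest: "(\<Sum>j\<in>I. fsign j ?J * D (?J - {j}) $ j) = - (fsign i ?J * D I $ i)"
      using i by (simp add: exterior_derivative_def)
    have "S i j = - fsign i ?J * (fsign j ?J * D (?J - {j}) $ j)" if "j \<in> I" for j
    proof -
      have "insert i (I - {j}) = ?J - {j}" using i that by auto
      then show ?thesis using fsign_exchange[OF that, of i] i by (simp add: S_def)
    qed
    then have "(\<Sum>j\<in>I. S i j) = - fsign i ?J * (\<Sum>j\<in>I. fsign j ?J * D (?J - {j}) $ j)"
      by (simp add: sum_distrib_left sum_negf)
    then show "(\<Sum>j\<in>I. S i j) = D I $ i"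
      unfolding rest by simp
  qed
  also have "(\<Sum>j\<in>I. y $ j * D I $ j) + (\<Sum>i\<in>- I. y $ i * D I $ i) = (\<Sum>i\<in>UNIV. y $ i * D I $ i)"
    using sum.union_disjoint[of I "- I" "\<lambda>i. y $ i * D I $ i"] by (simp add: Compl_partition)
  finally show ?thesis by (simp add: inner_vec_def mult.commute)
qed

lemma exterior_derivative_covector_wedge:
  "(\<Sum>j\<in>J. \<Sum>k\<in>J - {j}. fsign j J * fsign k (J - {j}) * (p $ k * D (J - {j} - {k}) $ j))
    = - covector_wedge p (exterior_derivative D) J"
  unfolding covector_wedge_def exterior_derivative_def sum_distrib_left
  by (subst sum_fsign_swap, intro arg_cong[where f=uminus] sum.cong refl)
    (simp add: mult_ac Diff_insert2[symmetric] insert_commute)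

text \<open>The identity \<open>du = p \<and> d(\<iota>\<^sub>y u)\<close> for the composition \<open>u\<close> of a closed form with a displacement whose
  derivative is \<open>h \<mapsto> h + (p \<bullet> h) y\<close>; by the chain rule the coefficients of \<open>u\<close> have gradients \<open>D K + (D K \<bullet> y) p\<close>.\<close>

lemma exterior_derivative_displaced:
  fixes D :: "'n::{finite,linorder} set \<Rightarrow> (real,'n) vec"
  assumes closed: "\<And>J. card J = Suc r \<Longrightarrow> exterior_derivative D J = 0" and J: "card J = Suc r"
  shows "exterior_derivative (\<lambda>K. D K + (D K \<bullet> y) *\<^sub>R p) J
    = covector_wedge p (exterior_derivative (interior_product y (\<lambda>K. D K + (D K \<bullet> y) *\<^sub>R p))) J"
proof -
  let ?c = "\<lambda>K. D K \<bullet> y"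
  have "covector_wedge p (exterior_derivative (interior_product y (\<lambda>K. D K + ?c K *\<^sub>R p))) J
      = covector_wedge p (exterior_derivative (interior_product y D)) J
        + covector_wedge p (covector_wedge p (interior_product y ?c)) J"
    by (simp add: interior_product_add_scaleR[abs_def] exterior_derivative_add_scaleR[abs_def] covector_wedge_add)
  also have "covector_wedge p (exterior_derivative (interior_product y D)) J = covector_wedge p ?c J"
    using J by (intro covector_wedge_cong exterior_derivative_interior_product[OF closed]) simp_all
  finally show ?thesis
    by (simp add: exterior_derivative_add_scaleR closed[OF J] covector_wedge_twice)
qed

definition pullback_at :: "(real,'n) vec \<Rightarrow> (real,'n) vec \<Rightarrow> ('n::{finite,linorder} set \<Rightarrow> real) \<Rightarrow> 'n set \<Rightarrow> real" where
  "pullback_at p y a K = a K + covector_wedge p (interior_product y a) K"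

lemma pullback_at_zero [simp]: "pullback_at 0 y a K = a K"
  by (simp add: pullback_at_def covector_wedge_def)

lemma pullback_at_diff: "pullback_at p y (\<lambda>K. a K - b K) K = pullback_at p y a K - pullback_at p y b K"
  by (simp add: pullback_at_def covector_wedge_def interior_product_def right_diff_distrib sum_subtractf)

definition form_l1 :: "nat \<Rightarrow> ('n::finite set \<Rightarrow> real) \<Rightarrow> real" where
  "form_l1 r a = (\<Sum>K\<in>{K. card K = r}. \<bar>a K\<bar>)"

lemma form_l1_nonneg [simp]: "0 \<le> form_l1 r a"
  by (simp add: form_l1_def sum_nonneg)

lemma abs_le_form_l1: "card K = r \<Longrightarrow> \<bar>a K\<bar> \<le> form_l1 r a"
  unfolding form_l1_def by (rule member_le_sum[of K _ "\<lambda>K. \<bar>a K\<bar>"]) auto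

lemma card_exchange:
  fixes K :: "'n::finite set"
  assumes "k \<in> K" "i \<in> - (K - {k})"
  shows "card (insert i (K - {k})) = card K"
proof -
  have "card (insert i (K - {k})) = Suc (card (K - {k}))" using assms by (intro card_insert_disjoint) auto
  also have "\<dots> = card K" using assms by (intro card_Suc_Diff1) auto
  finally show ?thesis .
qed

lemma abs_interior_product_le:
  fixes a :: "'n::{finite,linorder} set \<Rightarrow> real"
  assumes y: "norm y \<le> 1" and K: "card K = r" "k \<in> K"
  shows "\<bar>interior_product y a (K - {k})\<bar> \<le> CARD('n) * form_l1 r a"
proof -
  have "\<bar>interior_product y a (K - {k})\<bar> \<le> (\<Sum>i\<in>- (K - {k}). \<bar>y $ i\<bar> * \<bar>a (insert i (K - {k}))\<bar>)"
    unfolding interior_product_def by (rule order_trans[OF sum_abs]) (simp add: abs_mult)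
  also have "\<dots> \<le> (\<Sum>i\<in>- (K - {k}). 1 * form_l1 r a)"
  proof (intro sum_mono mult_mono)
    show "\<bar>y $ i\<bar> \<le> 1" for i using component_le_norm_cart[of y i] y by simp
  qed (use K card_exchange in \<open>auto intro: abs_le_form_l1\<close>)
  also have "\<dots> \<le> CARD('n) * form_l1 r a"
    by (simp add: card_mono mult_right_mono)
  finally show ?thesis .
qed

lemma abs_pullback_at_le:
  fixes a :: "'n::{finite,linorder} set \<Rightarrow> real"
  assumes p: "norm p \<le> 1" and y: "norm y \<le> 1" and K: "card K = r"
  shows "\<bar>pullback_at p y a K\<bar> \<le> (1 + CARD('n)\<^sup>2) * form_l1 r a"
proof -
  have "\<bar>covector_wedge p (interior_product y a) K\<bar> \<le> (\<Sum>k\<in>K. \<bar>p $ k\<bar> * \<bar>interior_product y a (K - {k})\<bar>)"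
    unfolding covector_wedge_def by (rule order_trans[OF sum_abs]) (simp add: abs_mult)
  also have "\<dots> \<le> (\<Sum>k\<in>K. 1 * (CARD('n) * form_l1 r a))"
  proof (intro sum_mono mult_mono abs_interior_product_le[OF y K])
    show "\<bar>p $ k\<bar> \<le> 1" for k using component_le_norm_cart[of p k] p by simp
  qed auto
  also have "\<dots> \<le> CARD('n) * (CARD('n) * form_l1 r a)"
    by (simp add: card_mono mult_right_mono)
  finally show ?thesis
    using abs_le_form_l1[OF K, of a] by (simp add: pullback_at_def power2_eq_square algebra_simps)
qed

subsection \<open>Closed forms on the torus\<close>

definition differential_pairing :: "'n::{finite,linorder} form \<Rightarrow> ((real,'n) vec \<Rightarrow> (real,'n) vec) \<Rightarrow> 'n set \<Rightarrow> real" where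
  "differential_pairing w \<phi>' J = (\<Sum>j\<in>J. fsign j J * (\<integral>x. w x (J - {j}) * \<phi>' x $ j \<partial>torus))"

definition torus_closed :: "nat \<Rightarrow> 'n::{finite,linorder} form \<Rightarrow> bool" where
  "torus_closed r w \<longleftrightarrow> (\<forall>J \<phi>. card J = Suc r \<and> smooth_fun \<phi> \<and> periodic_fun \<phi> \<longrightarrow>
     differential_pairing w (gradient \<phi>) J = 0)"

definition periodic_L1_form :: "nat \<Rightarrow> 'n::finite form \<Rightarrow> bool" where
  "periodic_L1_form r w \<longleftrightarrow> (\<forall>K. card K = r \<longrightarrow> integrable torus (\<lambda>x. w x K) \<and> lattice_periodic (\<lambda>x. w x K))"

definition periodic_continuous :: "(real^'n \<Rightarrow> 'b::topological_space) \<Rightarrow> bool" where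
  "periodic_continuous f \<longleftrightarrow> continuous_on UNIV f \<and> lattice_periodic f"

lemma torus_closedD:
  "torus_closed r w \<Longrightarrow> card J = Suc r \<Longrightarrow> smooth_fun \<phi> \<Longrightarrow> periodic_fun \<phi> \<Longrightarrow> differential_pairing w (gradient \<phi>) J = 0"
  by (simp add: torus_closed_def)

lemma periodic_L1_formD:
  assumes "periodic_L1_form r w" "card K = r"
  shows periodic_L1_form_integrable: "integrable torus (\<lambda>x. w x K)"
    and periodic_L1_form_periodic: "lattice_periodic (\<lambda>x. w x K)"
    and periodic_L1_form_measurable: "(\<lambda>x. w x K) \<in> borel_measurable borel"
  using assms by (auto simp: periodic_L1_form_def torus_integrable_iff_L1_norm)

lemma periodic_L1_form_diff:
  "periodic_L1_form r v \<Longrightarrow> periodic_L1_form r w \<Longrightarrow> periodic_L1_form r (\<lambda>x K. v x K - w x K)"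
  by (simp add: periodic_L1_form_def lattice_periodic_def)

lemma periodic_continuous_integrable:
  fixes f :: "real^'n \<Rightarrow> real"
  shows "periodic_continuous f \<Longrightarrow> integrable torus f"
  by (simp add: periodic_continuous_def torus_integrable_continuous)

lemma periodic_continuous_mult:
  fixes f g :: "real^'n \<Rightarrow> real"
  shows "periodic_continuous f \<Longrightarrow> periodic_continuous g \<Longrightarrow> periodic_continuous (\<lambda>x. f x * g x)"
  by (simp add: periodic_continuous_def lattice_periodic_mult continuous_on_mult)

lemma periodic_continuous_const: "periodic_continuous (\<lambda>x. c)"
  by (simp add: periodic_continuous_def lattice_periodic_const)

lemma periodic_continuous_nth: "periodic_continuous f \<Longrightarrow> periodic_continuous (\<lambda>x. f x $ i)"
  by (auto simp: periodic_continuous_def lattice_periodic_def intro: continuous_intros)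

lemma C1_periodic_imp_periodic_continuous:
  assumes "C1_periodic f f'" shows "periodic_continuous f" "periodic_continuous f'"
  using C1_periodicD[OF assms] C1_periodic_gradient_periodic[OF assms] by (simp_all add: periodic_continuous_def)

lemmas periodic_continuous_intros = periodic_continuous_mult periodic_continuous_nth periodic_continuous_const

lemma integral_double_sum:
  fixes f :: "'i \<Rightarrow> 'j \<Rightarrow> 'a \<Rightarrow> real"
  assumes "\<And>j k. j \<in> A \<Longrightarrow> k \<in> B j \<Longrightarrow> integrable M (f j k)"
  shows "(\<integral>x. (\<Sum>j\<in>A. \<Sum>k\<in>B j. c j k * f j k x) \<partial>M) = (\<Sum>j\<in>A. \<Sum>k\<in>B j. c j k * (\<integral>x. f j k x \<partial>M))"
proof -
  have "(\<integral>x. (\<Sum>j\<in>A. \<Sum>k\<in>B j. c j k * f j k x) \<partial>M) = (\<Sum>j\<in>A. \<integral>x. (\<Sum>k\<in>B j. c j k * f j k x) \<partial>M)"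
    using assms by (intro Bochner_Integration.integral_sum Bochner_Integration.integrable_sum integrable_mult_right)
  also have "\<dots> = (\<Sum>j\<in>A. \<Sum>k\<in>B j. \<integral>x. c j k * f j k x \<partial>M)"
    using assms by (intro sum.cong refl Bochner_Integration.integral_sum integrable_mult_right)
  finally show ?thesis by simp
qed

lemma differential_pairing_add:
  assumes "\<And>j. j \<in> J \<Longrightarrow> integrable torus (\<lambda>x. v x (J - {j}) * \<phi>' x $ j)"
    and "\<And>j. j \<in> J \<Longrightarrow> integrable torus (\<lambda>x. w x (J - {j}) * \<phi>' x $ j)"
  shows "differential_pairing (\<lambda>x K. v x K + w x K) \<phi>' J = differential_pairing v \<phi>' J + differential_pairing w \<phi>' J"
proof -
  have "(\<integral>x. (v x (J - {j}) + w x (J - {j})) * \<phi>' x $ j \<partial>torus)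
      = (\<integral>x. v x (J - {j}) * \<phi>' x $ j \<partial>torus) + (\<integral>x. w x (J - {j}) * \<phi>' x $ j \<partial>torus)" if "j \<in> J" for j
    unfolding distrib_right by (rule Bochner_Integration.integral_add[OF assms[OF that]])
  then show ?thesis
    by (simp add: differential_pairing_def distrib_left sum.distrib)
qed

lemma differential_pairing_C1:
  fixes u :: "'n::{finite,linorder} form"
  assumes u: "\<And>K. card K = r \<Longrightarrow> C1_periodic (\<lambda>x. u x K) (U K)" and \<phi>: "C1_periodic \<phi> \<phi>'" and J: "card J = Suc r"
  shows "differential_pairing u \<phi>' J = - (\<integral>x. \<phi> x * exterior_derivative (\<lambda>K. U K x) J \<partial>torus)"
proof -
  have u_C1: "C1_periodic (\<lambda>x. u x (J - {j})) (U (J - {j}))" if "j \<in> J" for j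
    using that J by (intro u) simp
  have "(\<integral>x. u x (J - {j}) * \<phi>' x $ j \<partial>torus) = - (\<integral>x. \<phi> x * U (J - {j}) x $ j \<partial>torus)" if "j \<in> J" for j
    using torus_integral_by_parts[OF u_C1[OF that] \<phi>, of "axis j 1"] by (simp add: inner_axis mult.commute)
  then have "differential_pairing u \<phi>' J = - (\<Sum>j\<in>J. fsign j J * (\<integral>x. \<phi> x * U (J - {j}) x $ j \<partial>torus))"
    by (simp add: differential_pairing_def sum_negf)
  also have "(\<Sum>j\<in>J. fsign j J * (\<integral>x. \<phi> x * U (J - {j}) x $ j \<partial>torus))
      = (\<integral>x. (\<Sum>j\<in>J. fsign j J * (\<phi> x * U (J - {j}) x $ j)) \<partial>torus)"
  proof -
    have "integrable torus (\<lambda>x. fsign j J * (\<phi> x * U (J - {j}) x $ j))" if "j \<in> J" for j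
      by (intro integrable_mult_right periodic_continuous_integrable periodic_continuous_intros
          C1_periodic_imp_periodic_continuous[OF \<phi>] C1_periodic_imp_periodic_continuous[OF u_C1[OF that]])
    then show ?thesis by (simp add: Bochner_Integration.integral_sum)
  qed
  also have "\<dots> = (\<integral>x. \<phi> x * exterior_derivative (\<lambda>K. U K x) J \<partial>torus)"
    by (simp add: exterior_derivative_def sum_distrib_left mult_ac)
  finally show ?thesis .
qed

lemma torus_integral_mult_gradient_by_parts:
  assumes e: "C1_periodic e e'" and \<phi>: "C1_periodic \<phi> \<phi>'" and g: "C1_periodic g g'"
  shows "(\<integral>x. e' x $ k * g x * \<phi>' x $ j \<partial>torus)
    = (\<integral>x. e' x $ k * (\<phi> x *\<^sub>R g' x + g x *\<^sub>R \<phi>' x) $ j \<partial>torus) - (\<integral>x. \<phi> x * (e' x $ k * g' x $ j) \<partial>torus)"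
proof -
  note cont = periodic_continuous_integrable periodic_continuous_intros
    C1_periodic_imp_periodic_continuous[OF e] C1_periodic_imp_periodic_continuous[OF \<phi>] C1_periodic_imp_periodic_continuous[OF g]
  have "(\<integral>x. e' x $ k * (\<phi> x *\<^sub>R g' x + g x *\<^sub>R \<phi>' x) $ j \<partial>torus)
      = (\<integral>x. e' x $ k * g x * \<phi>' x $ j + \<phi> x * (e' x $ k * g' x $ j) \<partial>torus)"
    by (simp add: algebra_simps)
  also have "\<dots> = (\<integral>x. e' x $ k * g x * \<phi>' x $ j \<partial>torus) + (\<integral>x. \<phi> x * (e' x $ k * g' x $ j) \<partial>torus)"
    by (intro Bochner_Integration.integral_add cont)
  finally show ?thesis by simp
qed

lemma differential_pairing_covector_wedge:
  fixes g :: "'n::{finite,linorder} form"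
  assumes e: "C1_periodic e e'" and \<phi>: "C1_periodic \<phi> \<phi>'"
    and g: "\<And>I. Suc (Suc (card I)) = card J \<Longrightarrow> C1_periodic (\<lambda>x. g x I) (G I)"
  shows "differential_pairing (\<lambda>x. covector_wedge (e' x) (g x)) \<phi>' J
    = (\<integral>x. \<phi> x * covector_wedge (e' x) (exterior_derivative (\<lambda>I. G I x)) J \<partial>torus)"
proof -
  let ?s = "\<lambda>j k. fsign j J * fsign k (J - {j})"
  define E where "E j k = (\<integral>x. e' x $ k * (\<phi> x *\<^sub>R G (J - {j} - {k}) x + g x (J - {j} - {k}) *\<^sub>R \<phi>' x) $ j \<partial>torus)" for j k
  have g_C1: "C1_periodic (\<lambda>x. g x (J - {j} - {k})) (G (J - {j} - {k}))" if "j \<in> J" "k \<in> J - {j}" for j k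
    using that card_Suc_Diff1[of J j] card_Suc_Diff1[of "J - {j}" k] by (intro g) simp
  have swap: "J - {k} - {j} = J - {j} - {k}" for j k by auto
  have E_symmetric: "E k j = E j k" if "j \<in> J" "k \<in> J - {j}" for j k
    using torus_integral_gradients_symmetric[OF e C1_periodic_mult[OF \<phi> g_C1[OF that]], of "axis j 1" "axis k 1"]
    unfolding E_def swap[of k j] by (simp add: inner_axis)
  have "differential_pairing (\<lambda>x. covector_wedge (e' x) (g x)) \<phi>' J
      = (\<Sum>j\<in>J. fsign j J * (\<integral>x. (\<Sum>k\<in>J - {j}. fsign k (J - {j}) * (e' x $ k * g x (J - {j} - {k}) * \<phi>' x $ j)) \<partial>torus))"
    by (simp add: differential_pairing_def covector_wedge_def sum_distrib_left mult_ac)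
  also have "\<dots> = (\<Sum>j\<in>J. \<Sum>k\<in>J - {j}. ?s j k * (\<integral>x. e' x $ k * g x (J - {j} - {k}) * \<phi>' x $ j \<partial>torus))"
  proof (rule sum.cong[OF refl])
    fix j assume j: "j \<in> J"
    have "integrable torus (\<lambda>x. fsign k (J - {j}) * (e' x $ k * g x (J - {j} - {k}) * \<phi>' x $ j))" if "k \<in> J - {j}" for k
      using g_C1[OF j that] e \<phi>
      by (intro integrable_mult_right periodic_continuous_integrable periodic_continuous_intros C1_periodic_imp_periodic_continuous)
    then show "fsign j J * (\<integral>x. (\<Sum>k\<in>J - {j}. fsign k (J - {j}) * (e' x $ k * g x (J - {j} - {k}) * \<phi>' x $ j)) \<partial>torus)
        = (\<Sum>k\<in>J - {j}. ?s j k * (\<integral>x. e' x $ k * g x (J - {j} - {k}) * \<phi>' x $ j \<partial>torus))"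
      by (subst Bochner_Integration.integral_sum) (simp_all add: sum_distrib_left mult.assoc)
  qed
  also have "\<dots> = (\<Sum>j\<in>J. \<Sum>k\<in>J - {j}. ?s j k * E j k)
      - (\<Sum>j\<in>J. \<Sum>k\<in>J - {j}. ?s j k * (\<integral>x. \<phi> x * (e' x $ k * G (J - {j} - {k}) x $ j) \<partial>torus))"
    by (simp add: torus_integral_mult_gradient_by_parts[OF e \<phi> g_C1] E_def right_diff_distrib sum_subtractf)
  also have "(\<Sum>j\<in>J. \<Sum>k\<in>J - {j}. ?s j k * E j k) = 0"
    by (rule sum_fsign_symmetric[OF E_symmetric])
  also have "(\<Sum>j\<in>J. \<Sum>k\<in>J - {j}. ?s j k * (\<integral>x. \<phi> x * (e' x $ k * G (J - {j} - {k}) x $ j) \<partial>torus))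
      = (\<integral>x. (\<Sum>j\<in>J. \<Sum>k\<in>J - {j}. ?s j k * (\<phi> x * (e' x $ k * G (J - {j} - {k}) x $ j))) \<partial>torus)"
    using g_C1 e \<phi>
    by (intro integral_double_sum[symmetric] periodic_continuous_integrable periodic_continuous_intros C1_periodic_imp_periodic_continuous)
  also have "\<dots> = (\<integral>x. \<phi> x * (\<Sum>j\<in>J. \<Sum>k\<in>J - {j}. ?s j k * (e' x $ k * G (J - {j} - {k}) x $ j)) \<partial>torus)"
    by (simp add: sum_distrib_left mult_ac)
  finally show ?thesis
    using exterior_derivative_covector_wedge[of J "e' x" "\<lambda>I. G I x" for x] by simp
qed

lemma torus_integral_mult_tendsto:
  fixes v :: "real^'n \<Rightarrow> real"
  assumes f: "\<And>k. integrable torus (f k)" and v: "integrable torus v"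
    and lim: "(\<lambda>k. torus_L1_norm (\<lambda>x. f k x - v x)) \<longlonglongrightarrow> 0"
    and b [measurable]: "b \<in> borel_measurable borel" and B: "\<And>x. \<bar>b x\<bar> \<le> B"
  shows "(\<lambda>k. \<integral>x. f k x * b x \<partial>torus) \<longlonglongrightarrow> (\<integral>x. v x * b x \<partial>torus)"
proof (rule tendsto_L1_int)
  note [measurable] = borel_measurable_integrable[OF f] borel_measurable_integrable[OF v]
  have B_nonneg: "0 \<le> B" using order_trans[OF abs_ge_zero B] .
  show "integrable torus (\<lambda>x. f k x * b x)" for k
    using B by (intro torus_integrable_mult_bounded[OF f b]) simp
  show "integrable torus (\<lambda>x. v x * b x)"
    using B by (intro torus_integrable_mult_bounded[OF v b]) simp
  show "(\<lambda>k. \<integral>\<^sup>+x. ennreal (norm (f k x * b x - v x * b x)) \<partial>torus) \<longlonglongrightarrow> 0"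
  proof (rule tendsto_sandwich[OF always_eventually always_eventually tendsto_const])
    have "torus_L1_norm (\<lambda>x. f k x * b x - v x * b x) \<le> torus_L1_norm (\<lambda>x. B * (f k x - v x))" for k
    proof (rule torus_L1_norm_mono)
      fix x
      have "\<bar>f k x - v x\<bar> * \<bar>b x\<bar> \<le> \<bar>f k x - v x\<bar> * B" by (intro mult_left_mono B) simp
      then show "\<bar>f k x * b x - v x * b x\<bar> \<le> \<bar>B * (f k x - v x)\<bar>"
        using B_nonneg by (simp only: left_diff_distrib[symmetric] abs_mult abs_of_nonneg mult.commute[of B])
    qed
    also have "torus_L1_norm (\<lambda>x. B * (f k x - v x)) = ennreal B * torus_L1_norm (\<lambda>x. f k x - v x)" for k
      using B_nonneg by (simp add: torus_L1_norm_cmult)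
    finally show "\<forall>k. (\<integral>\<^sup>+x. ennreal (norm (f k x * b x - v x * b x)) \<partial>torus) \<le> ennreal B * torus_L1_norm (\<lambda>x. f k x - v x)"
      by (simp add: torus_L1_norm_def)
    show "(\<lambda>k. ennreal B * torus_L1_norm (\<lambda>x. f k x - v x)) \<longlonglongrightarrow> 0"
      using ennreal_tendsto_cmult[OF _ lim, of "ennreal B"] by simp
  qed simp
qed

lemma torus_closed_L1_limit:
  assumes closed: "\<And>k. torus_closed r (V k)"
    and int: "\<And>k K. card K = r \<Longrightarrow> integrable torus (\<lambda>x. V k x K)" "\<And>K. card K = r \<Longrightarrow> integrable torus (\<lambda>x. v x K)"
    and lim: "\<And>K. card K = r \<Longrightarrow> (\<lambda>k. torus_L1_norm (\<lambda>x. V k x K - v x K)) \<longlonglongrightarrow> 0"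
  shows "torus_closed r v"
  unfolding torus_closed_def
proof (intro allI impI)
  fix J :: "'a set" and \<phi> :: "(real,'a) vec \<Rightarrow> real" assume A: "card J = Suc r \<and> smooth_fun \<phi> \<and> periodic_fun \<phi>"
  then have \<phi>: "C1_periodic \<phi> (gradient \<phi>)" by (intro smooth_fun_C1_periodic) auto
  obtain B where "\<And>x. norm (gradient \<phi> x) \<le> B" using C1_periodic_bounds[OF \<phi>] by metis
  then have B: "\<bar>gradient \<phi> x $ j\<bar> \<le> B" for j x
    using component_le_norm_cart order_trans by blast
  have "(\<lambda>k. differential_pairing (V k) (gradient \<phi>) J) \<longlonglongrightarrow> differential_pairing v (gradient \<phi>) J"
    unfolding differential_pairing_def using A
    by (intro tendsto_sum tendsto_mult tendsto_const torus_integral_mult_tendsto[where B=B] int lim B)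
      (auto intro: smooth_fun_pderiv_measurable)
  moreover have "differential_pairing (V k) (gradient \<phi>) J = 0" for k
    using A by (intro torus_closedD[OF closed]) auto
  ultimately show "differential_pairing v (gradient \<phi>) J = 0"
    by (simp add: LIMSEQ_const_iff)
qed

subsection \<open>Pullback under a displacement\<close>

text \<open>The pullback of \<open>w\<close> under \<open>displace e y\<close>, where \<open>e'\<close> is the gradient of \<open>e\<close>. Since this map is a rank-one
  perturbation of the identity, the pullback is just \<open>w + de \<and> \<iota>\<^sub>y w\<close>, evaluated at the image point.\<close>

definition pull :: "((real,'n) vec \<Rightarrow> real) \<Rightarrow> ((real,'n) vec \<Rightarrow> (real,'n) vec) \<Rightarrow> (real,'n) vec
    \<Rightarrow> 'n::{finite,linorder} form \<Rightarrow> 'n form" where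
  "pull e e' y w x = pullback_at (e' x) y (w (displace e y x))"

lemma pull_closed_C1:
  fixes w :: "'n::{finite,linorder} form"
  assumes w: "\<And>K. card K = r \<Longrightarrow> C1_periodic (\<lambda>x. w x K) (W K)"
    and closed: "\<And>J x. card J = Suc r \<Longrightarrow> exterior_derivative (\<lambda>K. W K x) J = 0"
    and e: "C1_periodic e e'" and \<phi>: "C1_periodic \<phi> \<phi>'" and J: "card J = Suc r"
  shows "differential_pairing (pull e e' y w) \<phi>' J = 0"
proof -
  define u where "u x = w (displace e y x)" for x
  define U where "U K x = W K (displace e y x) + (W K (displace e y x) \<bullet> y) *\<^sub>R e' x" for K x
  define g where "g x = interior_product y (u x)" for x
  define G where "G I x = interior_product y (\<lambda>K. U K x) I" for I x
  have u: "C1_periodic (\<lambda>x. u x K) (U K)" if "card K = r" for K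
    unfolding u_def U_def by (rule C1_periodic_displace[OF w[OF that] e])
  have g: "C1_periodic (\<lambda>x. g x I) (G I)" if "Suc (Suc (card I)) = card J" for I
    unfolding g_def G_def interior_product_def real_scaleR_def
    by (intro C1_periodic_sum C1_periodic_scale u) (use that J in auto)
  have wedge_integrable: "integrable torus (\<lambda>x. covector_wedge (e' x) (g x) (J - {j}) * \<phi>' x $ j)" if j: "j \<in> J" for j
    unfolding covector_wedge_def sum_distrib_right
  proof (intro Bochner_Integration.integrable_sum periodic_continuous_integrable periodic_continuous_intros)
    fix k assume k: "k \<in> J - {j}"
    have "Suc (Suc (card (J - {j} - {k}))) = card J"
      using j k card_Suc_Diff1[of J j] card_Suc_Diff1[of "J - {j}" k] by simp
    then show "periodic_continuous (\<lambda>x. g x (J - {j} - {k}))"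
      by (rule C1_periodic_imp_periodic_continuous[OF g])
  qed (rule C1_periodic_imp_periodic_continuous[OF e] C1_periodic_imp_periodic_continuous[OF \<phi>])+
  have "differential_pairing (pull e e' y w) \<phi>' J
      = differential_pairing (\<lambda>x K. u x K + covector_wedge (e' x) (g x) K) \<phi>' J"
    by (simp add: differential_pairing_def pull_def pullback_at_def u_def g_def)
  also have "\<dots> = differential_pairing u \<phi>' J + differential_pairing (\<lambda>x. covector_wedge (e' x) (g x)) \<phi>' J"
    using J by (intro differential_pairing_add wedge_integrable periodic_continuous_integrable periodic_continuous_intros
        C1_periodic_imp_periodic_continuous[OF u] C1_periodic_imp_periodic_continuous[OF \<phi>]) simp_all
  also have "\<dots> = - (\<integral>x. \<phi> x * exterior_derivative (\<lambda>K. U K x) J \<partial>torus)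
      + (\<integral>x. \<phi> x * covector_wedge (e' x) (exterior_derivative (\<lambda>I. G I x)) J \<partial>torus)"
    using differential_pairing_C1[of r u U, OF u \<phi> J] differential_pairing_covector_wedge[of e e' \<phi> \<phi>' J g G, OF e \<phi> g]
    by simp
  also have "\<dots> = 0"
  proof -
    have "exterior_derivative (\<lambda>K. U K x) J = covector_wedge (e' x) (exterior_derivative (\<lambda>I. G I x)) J" for x
      unfolding U_def G_def by (rule exterior_derivative_displaced[OF closed J])
    then show ?thesis by simp
  qed
  finally show ?thesis .
qed

definition mollify_form :: "nat \<Rightarrow> 'n::finite form \<Rightarrow> 'n form" where
  "mollify_form m w x K = mollify m (\<lambda>z. w z K) x"

lemma gradient_reflect:
  assumes "C1_periodic f f'" shows "gradient (\<lambda>z. f (c - z)) z = - f' (c - z)"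
proof (rule gradient_eq)
  have "((\<lambda>z. c - z) has_derivative (\<lambda>h. - h)) (at z)" by (auto intro!: derivative_eq_intros)
  from has_derivative_compose[OF this C1_periodic_has_derivative[OF assms]]
  show "((\<lambda>z. f (c - z)) has_derivative (\<lambda>h. - f' (c - z) \<bullet> h)) (at z)" by simp
qed

lemma torus_convolution_nth:
  fixes K :: "real^'n \<Rightarrow> real^'n"
  assumes K: "periodic_continuous K" and w: "integrable torus w"
  shows "torus_convolution w K x $ j = (\<integral>z. w z * K (x - z) $ j \<partial>torus)"
proof -
  have K_continuous: "continuous_on UNIV K" "lattice_periodic K" using K by (simp_all add: periodic_continuous_def)
  have [measurable]: "K \<in> borel_measurable borel" using K_continuous(1) by (rule borel_measurable_continuous_onI)
  note [measurable] = borel_measurable_integrable[OF w]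
  obtain B where B: "\<And>x. norm (K x) \<le> B" using periodic_continuous_bounded[OF K_continuous] by metis
  have "integrable torus (\<lambda>z. w z *\<^sub>R K (x - z))"
  proof (rule Bochner_Integration.integrable_bound)
    show "integrable torus (\<lambda>z. \<bar>w z\<bar> * B)" using w by simp
    show "AE z in torus. norm (w z *\<^sub>R K (x - z)) \<le> norm (\<bar>w z\<bar> * B)"
      using order_trans[OF norm_ge_zero B] by (simp add: abs_mult mult_left_mono B)
  qed measurable
  then have "torus_convolution w K x \<bullet> axis j 1 = (\<integral>z. (w z *\<^sub>R K (x - z)) \<bullet> axis j 1 \<partial>torus)"
    unfolding torus_convolution_def by (intro integral_inner_left[symmetric]) simp
  then show ?thesis by (simp add: inner_axis)
qed

lemma mollify_form_closed:
  fixes w :: "'n::{finite,linorder} form"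
  assumes w: "periodic_L1_form r w" and closed: "torus_closed r w" and J: "card J = Suc r"
  shows "exterior_derivative (\<lambda>K. torus_convolution (\<lambda>z. w z K) (gradient (torus_kernel m)) x) J = 0"
proof -
  note kernel = torus_kernel_C1_periodic[of m, where 'a='n]
  have "torus_convolution (\<lambda>z. w z (J - {j})) (gradient (torus_kernel m)) x $ j
      = - (\<integral>z. w z (J - {j}) * gradient (\<lambda>z. torus_kernel m (x - z)) z $ j \<partial>torus)" if "j \<in> J" for j
    using that J w by (subst torus_convolution_nth)
      (auto simp: gradient_reflect[OF kernel] simp del: gradient_nth
        intro: C1_periodic_imp_periodic_continuous(2)[OF kernel] periodic_L1_form_integrable)
  then have "exterior_derivative (\<lambda>K. torus_convolution (\<lambda>z. w z K) (gradient (torus_kernel m)) x) J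
      = - differential_pairing w (gradient (\<lambda>z. torus_kernel m (x - z))) J"
    by (simp add: exterior_derivative_def differential_pairing_def sum_negf)
  also have "\<dots> = 0"
    using torus_closedD[OF closed J torus_kernel_reflected] by simp
  finally show ?thesis .
qed

lemma mollify_form_periodic_L1:
  assumes "periodic_L1_form r w" shows "periodic_L1_form r (mollify_form m w)"
  unfolding periodic_L1_form_def mollify_form_def
proof (intro allI impI conjI)
  fix K :: "'a set" assume "card K = r"
  note C = mollify_C1_periodic[OF periodic_L1_form_integrable[OF assms this], of m]
  show "lattice_periodic (\<lambda>x. mollify m (\<lambda>z. w z K) x)"
    using C1_periodic_periodic[OF C] .
  show "integrable torus (\<lambda>x. mollify m (\<lambda>z. w z K) x)"
    using periodic_continuous_integrable[OF C1_periodic_imp_periodic_continuous(1)[OF C]] .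
qed

lemma
  fixes w :: "'n::finite form"
  assumes "periodic_L1_form r w"
  shows form_l1_measurable: "(\<lambda>x. form_l1 r (w x)) \<in> borel_measurable borel"
    and form_l1_periodic: "lattice_periodic (\<lambda>x. form_l1 r (w x))"
    and form_l1_integrable: "integrable torus (\<lambda>x. form_l1 r (w x))"
  using assms unfolding form_l1_def
  by (auto intro!: borel_measurable_sum borel_measurable_abs Bochner_Integration.integrable_sum integrable_abs
      periodic_L1_form_measurable simp: periodic_L1_form_def lattice_periodic_def)

lemma pull_measurable:
  fixes w :: "'n::{finite,linorder} form"
  assumes e: "C1_periodic e e'" and w: "periodic_L1_form r w" and K: "card K = r"
  shows "(\<lambda>(x, y). pull e e' y w x K) \<in> borel_measurable (borel \<Otimes>\<^sub>M borel)"
proof -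
  note [measurable] = C1_periodic_measurable[OF e]
  have w_measurable: "(\<lambda>p. w (fst p + e (fst p) *\<^sub>R snd p) I) \<in> borel_measurable (borel \<Otimes>\<^sub>M borel)" if "card I = r" for I
  proof -
    note [measurable] = periodic_L1_form_measurable[OF w that]
    show ?thesis by measurable
  qed
  have "(\<lambda>p. w (fst p + e (fst p) *\<^sub>R snd p) K
      + (\<Sum>k\<in>K. fsign k K * e' (fst p) $ k * (\<Sum>i\<in>- (K - {k}). fsign i (insert i (K - {k})) * snd p $ i
         * w (fst p + e (fst p) *\<^sub>R snd p) (insert i (K - {k}))))) \<in> borel_measurable (borel \<Otimes>\<^sub>M borel)"
    by (intro borel_measurable_add borel_measurable_sum borel_measurable_times borel_measurable_const w_measurable K)
       (measurable, simp only: card_exchange K)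
  then show ?thesis
    by (simp add: pull_def pullback_at_def covector_wedge_def interior_product_def displace_def case_prod_beta')
qed

lemma pull_measurable_left:
  assumes "C1_periodic e e'" "periodic_L1_form r w" "card K = r"
  shows "(\<lambda>x. pull e e' y w x K) \<in> borel_measurable borel"
  using measurable_compose[OF _ pull_measurable[OF assms], of "\<lambda>x. (x, y)" borel] by simp

lemma abs_pull_le:
  fixes w :: "'n::{finite,linorder} form"
  assumes "norm (e' x) \<le> 1" "norm y \<le> 1" "card K = r"
  shows "\<bar>pull e e' y w x K\<bar> \<le> (1 + CARD('n)\<^sup>2) * form_l1 r (w (displace e y x))"
  unfolding pull_def by (rule abs_pullback_at_le[OF assms])

lemma torus_L1_norm_pull_le:
  fixes w :: "'n::{finite,linorder} form"
  assumes e: "small_gradient e e'" and y: "norm y \<le> 1" and w: "periodic_L1_form r w" and K: "card K = r"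
  shows "torus_L1_norm (\<lambda>x. pull e e' y w x K)
    \<le> ennreal (1 + CARD('n)\<^sup>2) * 20 ^ CARD('n) * torus_L1_norm (\<lambda>x. form_l1 r (w x))"
proof -
  note [measurable] = C1_periodic_measurable(1)[OF small_gradient_C1_periodic[OF e]] form_l1_measurable[OF w]
  have "torus_L1_norm (\<lambda>x. pull e e' y w x K) \<le> torus_L1_norm (\<lambda>x. (1 + CARD('n)\<^sup>2) * form_l1 r (w (displace e y x)))"
    using abs_pull_le[where e'=e', OF small_gradient_norm_le[OF e] y K, of e w]
    by (intro torus_L1_norm_mono) (simp add: abs_mult)
  also have "\<dots> = ennreal (1 + CARD('n)\<^sup>2) * torus_L1_norm (\<lambda>x. form_l1 r (w (displace e y x)))"
    by (subst torus_L1_norm_cmult) simp_all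
  also have "\<dots> \<le> ennreal (1 + CARD('n)\<^sup>2) * (20 ^ CARD('n) * torus_L1_norm (\<lambda>x. form_l1 r (w x)))"
    unfolding torus_L1_norm_def
    by (intro mult_left_mono nn_integral_displace_le[OF e y] lattice_periodic_compose[OF form_l1_periodic[OF w]]) simp_all
  finally show ?thesis by (simp add: mult.assoc)
qed

lemma pull_L1_norm_finite:
  fixes w :: "'n::{finite,linorder} form"
  assumes "periodic_L1_form r w"
  shows "ennreal (1 + CARD('n)\<^sup>2) * 20 ^ CARD('n) * torus_L1_norm (\<lambda>x. form_l1 r (w x)) < \<infinity>"
  using form_l1_integrable[OF assms]
  by (simp add: torus_integrable_iff_L1_norm ennreal_mult_less_top power_less_top_ennreal)

lemma pull_integrable:
  assumes "small_gradient e e'" "norm y \<le> 1" "periodic_L1_form r w" "card K = r"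
  shows "integrable torus (\<lambda>x. pull e e' y w x K)"
  using torus_L1_norm_pull_le[OF assms] pull_L1_norm_finite[OF assms(3)]
    pull_measurable_left[OF small_gradient_C1_periodic[OF assms(1)] assms(3,4)]
  by (simp add: torus_integrable_iff_L1_norm order.strict_trans1)

lemma mollify_form_tendsto_L1:
  fixes w :: "'n::finite form"
  assumes w: "periodic_L1_form r w"
  shows "(\<lambda>m. torus_L1_norm (\<lambda>x. form_l1 r (\<lambda>K. mollify_form m w x K - w x K))) \<longlonglongrightarrow> 0"
proof -
  have "torus_L1_norm (\<lambda>x. form_l1 r (\<lambda>K. mollify_form m w x K - w x K))
      = (\<Sum>K\<in>{K. card K = r}. torus_L1_norm (\<lambda>x. mollify m (\<lambda>z. w z K) x - w x K))" for m
  proof -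
    note diff = periodic_L1_form_diff[OF mollify_form_periodic_L1[OF w] w]
    have "torus_L1_norm (\<lambda>x. form_l1 r (\<lambda>K. mollify_form m w x K - w x K))
        = (\<integral>\<^sup>+x. (\<Sum>K\<in>{K. card K = r}. ennreal \<bar>mollify_form m w x K - w x K\<bar>) \<partial>torus)"
      by (simp add: torus_L1_norm_def form_l1_def sum_nonneg)
    also have "\<dots> = (\<Sum>K\<in>{K. card K = r}. torus_L1_norm (\<lambda>x. mollify m (\<lambda>z. w z K) x - w x K))"
      unfolding torus_L1_norm_def mollify_form_def[symmetric]
      using periodic_L1_form_measurable[OF diff[of m]] by (intro nn_integral_sum) simp
    finally show ?thesis .
  qed
  moreover have "(\<lambda>m. \<Sum>K\<in>{K. card K = r}. torus_L1_norm (\<lambda>x. mollify m (\<lambda>z. w z K) x - w x K)) \<longlonglongrightarrow> 0"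
    by (intro tendsto_null_sum mollify_tendsto_L1 periodic_L1_form_integrable[OF w]) simp
  ultimately show ?thesis by simp
qed

lemma pull_closed:
  fixes w :: "'n::{finite,linorder} form"
  assumes e: "small_gradient e e'" and y: "norm y \<le> 1" and w: "periodic_L1_form r w" and closed: "torus_closed r w"
  shows "torus_closed r (pull e e' y w)"
proof (rule torus_closed_L1_limit)
  let ?w = "\<lambda>m. mollify_form m w"
  show "torus_closed r (pull e e' y (?w m))" for m
    unfolding torus_closed_def
  proof (intro allI impI)
    fix J :: "'n set" and \<phi> :: "(real,'n) vec \<Rightarrow> real" assume "card J = Suc r \<and> smooth_fun \<phi> \<and> periodic_fun \<phi>"
    then have J: "card J = Suc r" and \<phi>: "C1_periodic \<phi> (gradient \<phi>)" by (auto intro: smooth_fun_C1_periodic)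
    have "C1_periodic (\<lambda>x. ?w m x K) (torus_convolution (\<lambda>z. w z K) (gradient (torus_kernel m)))" if "card K = r" for K
      unfolding mollify_form_def by (rule mollify_C1_periodic[OF periodic_L1_form_integrable[OF w that]])
    from pull_closed_C1[OF this mollify_form_closed[OF w closed] small_gradient_C1_periodic[OF e] \<phi> J]
    show "differential_pairing (pull e e' y (?w m)) (gradient \<phi>) J = 0" .
  qed
  fix K :: "'n set" assume K: "card K = r"
  show "integrable torus (\<lambda>x. pull e e' y (?w m) x K)" for m
    by (rule pull_integrable[OF e y mollify_form_periodic_L1[OF w] K])
  show "integrable torus (\<lambda>x. pull e e' y w x K)"
    by (rule pull_integrable[OF e y w K])
  let ?C = "ennreal (1 + CARD('n)\<^sup>2) * 20 ^ CARD('n)"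
  have bound: "torus_L1_norm (\<lambda>x. pull e e' y (?w m) x K - pull e e' y w x K)
      \<le> ?C * torus_L1_norm (\<lambda>x. form_l1 r (\<lambda>K. ?w m x K - w x K))" for m
    using torus_L1_norm_pull_le[OF e y periodic_L1_form_diff[OF mollify_form_periodic_L1[OF w] w] K]
    by (simp add: pull_def pullback_at_diff)
  show "(\<lambda>m. torus_L1_norm (\<lambda>x. pull e e' y (?w m) x K - pull e e' y w x K)) \<longlonglongrightarrow> 0"
  proof (rule tendsto_sandwich[OF always_eventually always_eventually tendsto_const])
    have "(\<lambda>m. ?C * torus_L1_norm (\<lambda>x. form_l1 r (\<lambda>K. ?w m x K - w x K))) \<longlonglongrightarrow> ?C * 0"
      by (intro ennreal_tendsto_cmult mollify_form_tendsto_L1[OF w])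
        (simp add: ennreal_mult_less_top power_less_top_ennreal)
    then show "(\<lambda>m. ?C * torus_L1_norm (\<lambda>x. form_l1 r (\<lambda>K. ?w m x K - w x K))) \<longlonglongrightarrow> 0"
      by simp
  qed (use bound in auto)
qed

subsection \<open>Averaging over the unit ball\<close>

definition unit_ball_measure :: "'a::euclidean_space measure" where
  "unit_ball_measure = uniform_measure lborel (cball 0 1)"

lemma sets_unit_ball_measure [simp, measurable_cong]: "sets unit_ball_measure = sets borel"
  by (simp add: unit_ball_measure_def)

lemma space_unit_ball_measure [simp]: "space unit_ball_measure = UNIV"
  by (simp add: unit_ball_measure_def)

lemma emeasure_unit_ball_measure_UNIV [simp]: "emeasure (unit_ball_measure :: 'a::euclidean_space measure) UNIV = 1"
  unfolding unit_ball_measure_def using unit_ball_vol_pos[of "DIM('a)"]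
  by (subst emeasure_uniform_measure)
    (simp_all add: emeasure_cball ennreal_divide_self ennreal_eq_0_iff not_le del: unit_ball_vol_pos)

interpretation unit_ball: finite_measure "unit_ball_measure :: 'a::euclidean_space measure"
  by standard simp

lemma AE_unit_ball_measure: "AE y in unit_ball_measure. norm y \<le> 1"
  unfolding unit_ball_measure_def by (rule AE_uniform_measureI) auto

definition smoothing :: "((real,'n) vec \<Rightarrow> real) \<Rightarrow> ((real,'n) vec \<Rightarrow> (real,'n) vec)
    \<Rightarrow> 'n::{finite,linorder} form \<Rightarrow> 'n form" where
  "smoothing e e' w x K = (\<integral>y. pull e e' y w x K \<partial>unit_ball_measure)"

lemma smoothing_cong: "e x = f x \<Longrightarrow> e' x = f' x \<Longrightarrow> smoothing e e' w x K = smoothing f f' w x K"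
  by (simp add: smoothing_def pull_def displace_def)

lemma smoothing_trivial: "e x = 0 \<Longrightarrow> e' x = 0 \<Longrightarrow> smoothing e e' w x K = w x K"
  by (simp add: smoothing_def pull_def displace_def measure_def)

lemma ennreal_abs_smoothing_le:
  fixes w :: "'n::{finite,linorder} form"
  assumes e: "norm (e' x) \<le> 1" and K: "card K = r"
  shows "ennreal \<bar>smoothing e e' w x K\<bar>
    \<le> (\<integral>\<^sup>+y. ennreal ((1 + CARD('n)\<^sup>2) * form_l1 r (w (displace e y x))) \<partial>unit_ball_measure)"
proof (cases "integrable unit_ball_measure (\<lambda>y. pull e e' y w x K)")
  case True
  have "ennreal (norm (smoothing e e' w x K)) \<le> (\<integral>\<^sup>+y. ennreal (norm (pull e e' y w x K)) \<partial>unit_ball_measure)"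
    unfolding smoothing_def by (rule integral_norm_bound_ennreal[OF True])
  also have "\<dots> \<le> (\<integral>\<^sup>+y. ennreal ((1 + CARD('n)\<^sup>2) * form_l1 r (w (displace e y x))) \<partial>unit_ball_measure)"
  proof (rule nn_integral_mono_AE, use AE_unit_ball_measure in eventually_elim)
    case (elim y)
    then show ?case
      using abs_pull_le[of e' x y K r e w, OF e _ K] by (intro ennreal_leI) simp
  qed
  finally show ?thesis by simp
next
  case False
  then show ?thesis by (simp add: smoothing_def not_integrable_integral_eq)
qed

lemma
  fixes w :: "'n::{finite,linorder} form"
  assumes e: "small_gradient e e'" and w: "periodic_L1_form r w" and K: "card K = r"
  shows smoothing_measurable: "(\<lambda>x. smoothing e e' w x K) \<in> borel_measurable borel"
    and pull_pair_integrable: "integrable (unit_ball_measure \<Otimes>\<^sub>M torus) (\<lambda>(y, x). pull e e' y w x K)"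
    and smoothing_integrable: "integrable torus (\<lambda>x. smoothing e e' w x K)"
proof -
  interpret P: pair_sigma_finite "unit_ball_measure :: (real,'n) vec measure" "torus :: (real,'n) vec measure" ..
  note [measurable] = pull_measurable[OF small_gradient_C1_periodic[OF e] w K]
  let ?C = "ennreal (1 + CARD('n)\<^sup>2) * 20 ^ CARD('n) * torus_L1_norm (\<lambda>x. form_l1 r (w x))"
  show "(\<lambda>x. smoothing e e' w x K) \<in> borel_measurable borel"
    unfolding smoothing_def by measurable
  show pair: "integrable (unit_ball_measure \<Otimes>\<^sub>M torus) (\<lambda>(y, x). pull e e' y w x K)"
  proof (rule integrableI_bounded)
    show "(\<lambda>(y, x). pull e e' y w x K) \<in> borel_measurable (unit_ball_measure \<Otimes>\<^sub>M torus)" by measurable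
    have "(\<integral>\<^sup>+p. ennreal (norm (case p of (y, x) \<Rightarrow> pull e e' y w x K)) \<partial>(unit_ball_measure \<Otimes>\<^sub>M torus))
        = (\<integral>\<^sup>+y. torus_L1_norm (\<lambda>x. pull e e' y w x K) \<partial>unit_ball_measure)"
      unfolding torus_L1_norm_def by (subst torus.nn_integral_fst[symmetric]) (simp_all add: case_prod_beta')
    also have "\<dots> \<le> (\<integral>\<^sup>+y. ?C \<partial>(unit_ball_measure :: (real,'n) vec measure))"
    proof (rule nn_integral_mono_AE, use AE_unit_ball_measure in eventually_elim)
      case (elim y)
      then show ?case by (rule torus_L1_norm_pull_le[OF e _ w K])
    qed
    also have "\<dots> < \<infinity>" using pull_L1_norm_finite[OF w] by simp
    finally show "(\<integral>\<^sup>+p. ennreal (norm (case p of (y, x) \<Rightarrow> pull e e' y w x K)) \<partial>(unit_ball_measure \<Otimes>\<^sub>M torus)) < \<infinity>" .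
  qed
  show "integrable torus (\<lambda>x. smoothing e e' w x K)"
    unfolding smoothing_def by (rule P.integrable_snd[OF pair])
qed

lemma
  fixes w :: "'n::{finite,linorder} form"
  assumes e: "small_gradient e e'" and w: "periodic_L1_form r w" and K: "card K = r"
    and [measurable]: "b \<in> borel_measurable borel" and b: "\<And>x. \<bar>b x\<bar> \<le> B"
  shows smoothing_mult_integral: "(\<integral>x. smoothing e e' w x K * b x \<partial>torus)
      = (\<integral>y. (\<integral>x. pull e e' y w x K * b x \<partial>torus) \<partial>unit_ball_measure)"
    and pull_mult_integral_integrable: "integrable unit_ball_measure (\<lambda>y. \<integral>x. pull e e' y w x K * b x \<partial>torus)"
proof -
  interpret P: pair_sigma_finite "unit_ball_measure :: (real,'n) vec measure" "torus :: (real,'n) vec measure" ..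
  note [measurable] = pull_measurable[OF small_gradient_C1_periodic[OF e] w K]
  have integrable_product: "integrable (unit_ball_measure \<Otimes>\<^sub>M torus) (\<lambda>(y, x). pull e e' y w x K * b x)"
  proof (rule Bochner_Integration.integrable_bound)
    show "integrable (unit_ball_measure \<Otimes>\<^sub>M torus) (\<lambda>p. B * (case p of (y, x) \<Rightarrow> pull e e' y w x K))"
      by (rule integrable_mult_right[OF pull_pair_integrable[OF e w K]])
    show "(\<lambda>(y, x). pull e e' y w x K * b x) \<in> borel_measurable (unit_ball_measure \<Otimes>\<^sub>M torus)"
      by measurable
    have "\<bar>pull e e' y w x K\<bar> * \<bar>b x\<bar> \<le> \<bar>pull e e' y w x K\<bar> * \<bar>B\<bar>" for x y
      by (rule mult_left_mono[OF order_trans[OF b abs_ge_self]]) simp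
    then show "AE p in unit_ball_measure \<Otimes>\<^sub>M torus. norm (case p of (y, x) \<Rightarrow> pull e e' y w x K * b x)
        \<le> norm (B * (case p of (y, x) \<Rightarrow> pull e e' y w x K))"
      by (intro AE_I2) (auto simp: abs_mult mult.commute)
  qed
  have "(\<integral>x. smoothing e e' w x K * b x \<partial>torus) = (\<integral>x. (\<integral>y. pull e e' y w x K * b x \<partial>unit_ball_measure) \<partial>torus)"
    by (simp add: smoothing_def)
  also have "\<dots> = (\<integral>y. (\<integral>x. pull e e' y w x K * b x \<partial>torus) \<partial>unit_ball_measure)"
    using P.Fubini_integral[OF integrable_product] by simp
  finally show "(\<integral>x. smoothing e e' w x K * b x \<partial>torus)
      = (\<integral>y. (\<integral>x. pull e e' y w x K * b x \<partial>torus) \<partial>unit_ball_measure)" .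
  show "integrable unit_ball_measure (\<lambda>y. \<integral>x. pull e e' y w x K * b x \<partial>torus)"
    using P.integrable_fst[OF integrable_product] by simp
qed

lemma smoothing_closed:
  fixes w :: "'n::{finite,linorder} form"
  assumes e: "small_gradient e e'" and w: "periodic_L1_form r w" and closed: "torus_closed r w"
  shows "torus_closed r (smoothing e e' w)"
  unfolding torus_closed_def
proof (intro allI impI)
  fix J :: "'n set" and \<phi> :: "(real,'n) vec \<Rightarrow> real" assume "card J = Suc r \<and> smooth_fun \<phi> \<and> periodic_fun \<phi>"
  then have J: "card J = Suc r" and \<phi>: "smooth_fun \<phi>" "periodic_fun \<phi>" by auto
  obtain B where "\<And>x. norm (gradient \<phi> x) \<le> B"
    using C1_periodic_bounds[OF smooth_fun_C1_periodic[OF \<phi>]] by metis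
  then have B: "\<bar>gradient \<phi> x $ j\<bar> \<le> B" for j x
    using component_le_norm_cart order_trans by blast
  have gradient_measurable: "(\<lambda>x. gradient \<phi> x $ j) \<in> borel_measurable borel" for j
    by (simp add: smooth_fun_pderiv_measurable[OF \<phi>(1)])
  have card_remove: "card (J - {j}) = r" if "j \<in> J" for j using J that by simp
  have "differential_pairing (smoothing e e' w) (gradient \<phi>) J
      = (\<integral>y. differential_pairing (pull e e' y w) (gradient \<phi>) J \<partial>unit_ball_measure)"
    unfolding differential_pairing_def using pull_mult_integral_integrable[OF e w card_remove gradient_measurable B]
    by (simp add: smoothing_mult_integral[OF e w card_remove gradient_measurable B] Bochner_Integration.integral_sum del: gradient_nth)
  also have "\<dots> = (\<integral>y. 0 \<partial>(unit_ball_measure :: (real,'n) vec measure))"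
  proof (rule integral_cong_AE)
    show "AE y in unit_ball_measure. differential_pairing (pull e e' y w) (gradient \<phi>) J = 0"
      using AE_unit_ball_measure
    proof eventually_elim
      case (elim y)
      show ?case by (rule torus_closedD[OF pull_closed[OF e elim w closed] J \<phi>])
    qed
    show "(\<lambda>y. differential_pairing (pull e e' y w) (gradient \<phi>) J) \<in> borel_measurable unit_ball_measure"
      unfolding differential_pairing_def
      by (intro borel_measurable_sum borel_measurable_times borel_measurable_const
          borel_measurable_integrable pull_mult_integral_integrable[OF e w card_remove gradient_measurable B])
  qed simp
  finally show "differential_pairing (smoothing e e' w) (gradient \<phi>) J = 0" by simp
qed

section \<open>Regularised distance functions\<close>

subsection \<open>A C1 step function\<close>

definition pos_sq :: "real \<Rightarrow> real" where
  "pos_sq s = (max 0 s)\<^sup>2"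

lemma pos_sq_deriv: "(pos_sq has_real_derivative 2 * max 0 s) (at s)"
proof (cases s "0::real" rule: linorder_cases)
  case less
  have "((\<lambda>_. 0::real) has_real_derivative 0) (at s)" by simp
  then have "(pos_sq has_real_derivative 0) (at s)"
    by (rule has_field_derivative_transform_within_open[of _ _ _ "{..<0}"]) (use less in \<open>auto simp: pos_sq_def\<close>)
  then show ?thesis using less by simp
next
  case greater
  have "((\<lambda>s. s\<^sup>2) has_real_derivative 2 * s) (at s)" by (auto intro!: derivative_eq_intros)
  then have "(pos_sq has_real_derivative 2 * s) (at s)"
    by (rule has_field_derivative_transform_within_open[of _ _ _ "{0<..}"]) (use greater in \<open>auto simp: pos_sq_def\<close>)
  then show ?thesis using greater by simp
next
  case equal
  have "((\<lambda>h. (pos_sq (0 + h) - pos_sq 0) / h) \<longlongrightarrow> 0) (at 0)"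
  proof (rule Lim_null_comparison)
    show "((\<lambda>h::real. \<bar>h\<bar>) \<longlongrightarrow> 0) (at 0)" using tendsto_rabs_zero[OF tendsto_ident_at] by blast
    have "norm ((pos_sq (0 + h) - pos_sq 0) / h) \<le> \<bar>h\<bar>" for h :: real
      by (cases "h > 0") (auto simp: pos_sq_def power2_eq_square max_def)
    then show "\<forall>\<^sub>F h in at 0. norm ((pos_sq (0 + h) - pos_sq 0) / h) \<le> \<bar>h\<bar>" by simp
  qed
  then show ?thesis using equal by (simp add: DERIV_def)
qed

definition C1_step :: "real \<Rightarrow> real" where
  "C1_step s = pos_sq (1 - pos_sq (1 - s))"

definition C1_step' :: "real \<Rightarrow> real" where
  "C1_step' s = 4 * max 0 (1 - pos_sq (1 - s)) * max 0 (1 - s)"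

lemma C1_step_deriv: "(C1_step has_real_derivative C1_step' s) (at s)"
proof -
  have "((\<lambda>s. 1 - pos_sq (1 - s)) has_real_derivative - (2 * max 0 (1 - s) * (-1))) (at s)"
    by (rule derivative_eq_intros DERIV_chain2[OF pos_sq_deriv] refl | simp)+
  from DERIV_chain2[OF pos_sq_deriv this] show ?thesis
    unfolding C1_step_def C1_step'_def by (simp add: mult_ac)
qed

lemma C1_step_nonpos: "s \<le> 0 \<Longrightarrow> C1_step s = 0 \<and> C1_step' s = 0"
proof -
  assume "s \<le> 0"
  then have "1 \<le> pos_sq (1 - s)" by (simp add: pos_sq_def max_def)
  then show "C1_step s = 0 \<and> C1_step' s = 0"
    unfolding C1_step_def C1_step'_def by (simp add: pos_sq_def max_def)
qed

lemma C1_step_ge_1: "1 \<le> s \<Longrightarrow> C1_step s = 1 \<and> C1_step' s = 0"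
  by (simp add: C1_step_def C1_step'_def pos_sq_def)

lemma C1_step_bounds: "0 \<le> C1_step s" "C1_step s \<le> 1" "\<bar>C1_step' s\<bar> \<le> 4"
proof -
  have "0 \<le> pos_sq (1 - s)" by (simp add: pos_sq_def)
  then have base_bounds: "0 \<le> max 0 (1 - pos_sq (1 - s))" "max 0 (1 - pos_sq (1 - s)) \<le> 1" by auto
  show "0 \<le> C1_step s" by (simp add: C1_step_def pos_sq_def)
  show "C1_step s \<le> 1" unfolding C1_step_def using power_le_one[OF base_bounds, of 2] by (subst pos_sq_def)
  show "\<bar>C1_step' s\<bar> \<le> 4"
  proof (cases "s \<le> 0")
    case False
    then have "max 0 (1 - pos_sq (1 - s)) * max 0 (1 - s) \<le> 1 * 1" using base_bounds by (intro mult_mono) auto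
    then show ?thesis unfolding C1_step'_def using base_bounds by (simp add: abs_mult)
  qed (simp add: C1_step_nonpos)
qed

lemma C1_step'_continuous: "continuous_on UNIV C1_step'"
  unfolding C1_step'_def pos_sq_def by (intro continuous_intros)

subsection \<open>Dyadic cutoffs of a Lipschitz function\<close>

lemma lipschitz_imp_gradient_le:
  fixes f :: "'a::real_inner \<Rightarrow> real"
  assumes d: "(f has_derivative (\<lambda>h. g \<bullet> h)) (at x)" and lip: "\<And>y. \<bar>f y - f x\<bar> \<le> norm (y - x)"
  shows "norm g \<le> 1"
proof (cases "g = 0")
  case False
  have "((\<lambda>t. x + t *\<^sub>R g) has_derivative (\<lambda>t. t *\<^sub>R g)) (at 0)" by (auto intro!: derivative_eq_intros)
  then have "((\<lambda>t. f (x + t *\<^sub>R g)) has_derivative (\<lambda>t. g \<bullet> (t *\<^sub>R g))) (at 0)"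
    by (rule has_derivative_compose) (use d in simp)
  then have "((\<lambda>t. f (x + t *\<^sub>R g)) has_real_derivative (norm g)\<^sup>2) (at 0)"
    by (simp add: has_field_derivative_def power2_norm_eq_inner mult_commute_abs)
  then have quotient_tendsto: "((\<lambda>t. (f (x + t *\<^sub>R g) - f x) / t) \<longlongrightarrow> (norm g)\<^sup>2) (at 0)" by (simp add: DERIV_def)
  have "(norm g)\<^sup>2 \<le> norm g"
  proof (rule tendsto_upperbound[OF quotient_tendsto])
    have "(f (x + t *\<^sub>R g) - f x) / t \<le> norm g" if "t \<noteq> 0" for t
    proof -
      have "\<bar>(f (x + t *\<^sub>R g) - f x) / t\<bar> \<le> norm g"
        using lip[of "x + t *\<^sub>R g"] that by (simp add: divide_le_eq mult.commute)
      then show ?thesis by linarith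
    qed
    then show "\<forall>\<^sub>F t in at 0. (f (x + t *\<^sub>R g) - f x) / t \<le> norm g"
      by (auto simp: eventually_at_filter)
  qed simp
  then show ?thesis using False by (simp add: power2_eq_square)
qed simp

lemma lipschitz_C1_approximation:
  fixes \<delta> :: "real^'n \<Rightarrow> real"
  assumes lip: "\<And>x y. \<bar>\<delta> x - \<delta> y\<bar> \<le> norm (x - y)" and per: "lattice_periodic \<delta>" and t: "t > 0"
  obtains d d' where "C1_periodic d d'" "\<And>x. \<bar>d x - \<delta> x\<bar> \<le> t" "\<And>x. norm (d' x) \<le> 1"
proof -
  have "1-lipschitz_on UNIV \<delta>" using lip by (intro lipschitz_onI) (auto simp: dist_norm)
  then have cont: "continuous_on UNIV \<delta>" by (rule lipschitz_on_continuous_on)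
  then have integrable: "integrable torus \<delta>" using per by (rule torus_integrable_continuous)
  obtain m where m: "\<And>x. \<bar>mollify m \<delta> x - \<delta> x\<bar> < t"
    using uniform_limitD[OF mollify_uniform_limit[OF cont per] t] by (auto simp: eventually_sequentially dist_real_def)
  show thesis
  proof
    show C1: "C1_periodic (mollify m \<delta>) (torus_convolution \<delta> (gradient (torus_kernel m)))"
      by (rule mollify_C1_periodic[OF integrable])
    show "\<bar>mollify m \<delta> x - \<delta> x\<bar> \<le> t" for x using m[of x] by simp
    show "norm (torus_convolution \<delta> (gradient (torus_kernel m)) x) \<le> 1" for x
      by (rule lipschitz_imp_gradient_le[OF C1_periodic_has_derivative[OF C1] mollify_lipschitz[OF lip integrable per]])
  qed
qed

definition dyadic_cutoff :: "(real^'n \<Rightarrow> real) \<Rightarrow> nat \<Rightarrow> (real^'n \<Rightarrow> real) \<Rightarrow> (real^'n \<Rightarrow> real^'n) \<Rightarrow> bool" where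
  "dyadic_cutoff \<delta> n g g' \<longleftrightarrow> C1_periodic g g' \<and> (\<forall>x. 0 \<le> g x \<and> g x \<le> 1 \<and> norm (g' x) \<le> 8 * 2 ^ n) \<and>
    (\<forall>x. \<delta> x \<le> (1/2) ^ n \<longrightarrow> g x = 0 \<and> g' x = 0) \<and> (\<forall>x. 2 * (1/2) ^ n \<le> \<delta> x \<longrightarrow> g x = 1 \<and> g' x = 0)"

lemma dyadic_cutoff_exists:
  fixes \<delta> :: "real^'n \<Rightarrow> real"
  assumes lip: "\<And>x y. \<bar>\<delta> x - \<delta> y\<bar> \<le> norm (x - y)" and per: "lattice_periodic \<delta>"
  shows "\<exists>g g'. dyadic_cutoff \<delta> n g g'"
proof -
  define q :: real where "q = 2 ^ n"
  have q: "q > 0" "(1/2) ^ n = 1 / q" by (simp_all add: q_def power_divide)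
  obtain d d' where d: "C1_periodic d d'" "\<And>x. \<bar>d x - \<delta> x\<bar> \<le> 1 / (4 * q)" "\<And>x. norm (d' x) \<le> 1"
    using lipschitz_C1_approximation[OF lip per, of "1 / (4 * q)"] q by auto
  have scaled_close: "\<bar>q * d x - q * \<delta> x\<bar> \<le> 1/4" for x
  proof -
    have "q * \<bar>d x - \<delta> x\<bar> \<le> q * (1 / (4 * q))" using d(2)[of x] q by (intro mult_left_mono) auto
    then show ?thesis using q by (simp add: right_diff_distrib[symmetric] abs_mult)
  qed
  define a where "a x = - (5/2) + 2 * q * d x" for x
  have a: "C1_periodic a (\<lambda>x. 0 + (2 * q) *\<^sub>R d' x)"
    unfolding a_def by (intro C1_periodic_add C1_periodic_const C1_periodic_scale d(1))
  define g where "g x = C1_step (a x)" for x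
  define g' where "g' x = C1_step' (a x) *\<^sub>R (0 + (2 * q) *\<^sub>R d' x)" for x
  have "C1_periodic g g'"
    unfolding g_def g'_def by (rule C1_periodic_compose_real[OF C1_step_deriv C1_step'_continuous a])
  moreover have "norm (g' x) \<le> 8 * 2 ^ n" for x
  proof -
    have "\<bar>C1_step' (a x)\<bar> * (2 * q * norm (d' x)) \<le> 4 * (2 * q * 1)"
      using q d(3)[of x] by (intro mult_mono C1_step_bounds) auto
    moreover have "norm (g' x) = \<bar>C1_step' (a x)\<bar> * (2 * q * norm (d' x))" using q(1) by (simp add: g'_def abs_mult)
    ultimately show ?thesis by (simp add: q_def)
  qed
  moreover have "g x = 0 \<and> g' x = 0" if "\<delta> x \<le> (1/2) ^ n" for x
  proof -
    have "q * \<delta> x \<le> 1" using that q by (simp add: field_simps)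
    then have "a x \<le> 0" using scaled_close[of x] unfolding a_def by linarith
    then show ?thesis by (simp add: g_def g'_def C1_step_nonpos)
  qed
  moreover have "g x = 1 \<and> g' x = 0" if "2 * (1/2) ^ n \<le> \<delta> x" for x
  proof -
    have "2 \<le> q * \<delta> x" using that q by (simp add: field_simps)
    then have "1 \<le> a x" using scaled_close[of x] unfolding a_def by linarith
    then show ?thesis by (simp add: g_def g'_def C1_step_ge_1)
  qed
  ultimately have "dyadic_cutoff \<delta> n g g'"
    by (simp add: dyadic_cutoff_def g_def C1_step_bounds)
  then show ?thesis by blast
qed

subsection \<open>Approximation by functions with small gradient\<close>

definition regularised_distance :: "(real^'n \<Rightarrow> real) \<Rightarrow> (nat \<Rightarrow> real^'n \<Rightarrow> real) \<Rightarrow> (nat \<Rightarrow> real^'n \<Rightarrow> real^'n) \<Rightarrow> bool" where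
  "regularised_distance \<delta> \<epsilon> \<epsilon>' \<longleftrightarrow> (\<forall>k. small_gradient (\<epsilon> k) (\<epsilon>' k)) \<and>
    (\<forall>k x. 0 \<le> \<epsilon> k x \<and> \<epsilon> k x \<le> \<delta> x / 16) \<and> (\<forall>k x. \<delta> x = 0 \<longrightarrow> \<epsilon>' k x = 0) \<and>
    (\<forall>k x. 2 * (1/2) ^ k \<le> \<delta> x \<longrightarrow> \<delta> x / 64 \<le> \<epsilon> k x \<and> \<epsilon> (Suc k) x = \<epsilon> k x \<and> \<epsilon>' (Suc k) x = \<epsilon>' k x)"

locale dyadic_cutoffs =
  fixes \<delta> :: "real^'n \<Rightarrow> real" and g :: "nat \<Rightarrow> real^'n \<Rightarrow> real" and g' :: "nat \<Rightarrow> real^'n \<Rightarrow> real^'n"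
  assumes cutoff: "dyadic_cutoff \<delta> n (g n) (g' n)"
    and nonneg: "0 \<le> \<delta> x" and le_1: "\<delta> x \<le> 1"
begin

text \<open>Weights \<open>1/2, 1/4, \<dots>, 2\<^sup>-\<^sup>k, 2\<^sup>-\<^sup>k\<close>: the last one is repeated so that the sum no longer changes once both final
  cutoffs equal one.\<close>

definition \<epsilon> :: "nat \<Rightarrow> real^'n \<Rightarrow> real" where
  "\<epsilon> k x = 1/16 * ((\<Sum>i<k. (1/2) ^ Suc i * g i x) + (1/2) ^ k * g k x)"

definition \<epsilon>' :: "nat \<Rightarrow> real^'n \<Rightarrow> real^'n" where
  "\<epsilon>' k x = (1/16) *\<^sub>R ((\<Sum>i<k. (1/2) ^ Suc i *\<^sub>R g' i x) + (1/2) ^ k *\<^sub>R g' k x)"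

lemma C1_periodic_\<epsilon>: "C1_periodic (\<epsilon> k) (\<epsilon>' k)"
  unfolding \<epsilon>_def \<epsilon>'_def using cutoff
  by (intro C1_periodic_scale C1_periodic_add C1_periodic_sum) (auto simp: dyadic_cutoff_def)

lemma cutoff_low: "\<delta> x \<le> (1/2) ^ n \<Longrightarrow> g n x = 0 \<and> g' n x = 0"
  and cutoff_high: "2 * (1/2) ^ n \<le> \<delta> x \<Longrightarrow> g n x = 1 \<and> g' n x = 0"
  and cutoff_bounds: "0 \<le> g n x" "g n x \<le> 1" "norm (g' n x) \<le> 8 * 2 ^ n"
  using cutoff[of n] by (auto simp: dyadic_cutoff_def)

lemma \<epsilon>_stable:
  assumes "2 * (1/2) ^ k \<le> \<delta> x"
  shows "\<epsilon> (Suc k) x = \<epsilon> k x \<and> \<epsilon>' (Suc k) x = \<epsilon>' k x"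
proof -
  have "2 * (1/2) ^ Suc k \<le> \<delta> x" using assms by (rule order_trans[rotated]) simp
  then show ?thesis
    using cutoff_high[OF assms] cutoff_high[of "Suc k" x] by (simp add: \<epsilon>_def \<epsilon>'_def)
qed

lemma dyadic_level_exists:
  assumes "0 < \<delta> x"
  obtains j where "(1/2) ^ j < \<delta> x" "\<delta> x \<le> 2 * (1/2) ^ j" "\<And>i. i < j \<Longrightarrow> \<delta> x \<le> (1/2) ^ i"
proof -
  define j where "j = (LEAST j. (1/2) ^ j < \<delta> x)"
  obtain n :: nat where "(1/2) ^ n < \<delta> x" using real_arch_pow_inv[OF assms, of "1/2"] by auto
  then have j: "(1/2) ^ j < \<delta> x" unfolding j_def by (rule LeastI)
  have below: "\<delta> x \<le> (1/2) ^ i" if "i < j" for i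
    using not_less_Least[of i "\<lambda>j. (1/2) ^ j < \<delta> x"] that by (simp add: j_def)
  have "j \<noteq> 0" using j le_1[of x] by (cases j) auto
  then have "\<delta> x \<le> 2 * (1/2) ^ j" using below[of "j - 1"] by (cases j) auto
  with j below show thesis by (intro that) auto
qed

lemma \<epsilon>_at_level:
  assumes j: "(1/2) ^ j < \<delta> x" "\<And>i. i < j \<Longrightarrow> \<delta> x \<le> (1/2) ^ i"
  shows "k < j \<Longrightarrow> \<epsilon> k x = 0 \<and> \<epsilon>' k x = 0"
    and "\<epsilon> j x = 1/16 * (1/2) ^ j * g j x \<and> \<epsilon>' j x = (1/16 * (1/2) ^ j) *\<^sub>R g' j x"
    and "j < k \<Longrightarrow> \<epsilon> k x = 1/32 * (1/2) ^ j * (1 + g j x) \<and> \<epsilon>' k x = (1/32 * (1/2) ^ j) *\<^sub>R g' j x"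
proof -
  have g_zero: "g i x = 0 \<and> g' i x = 0" if "i < j" for i using cutoff_low j(2)[OF that] .
  then show "k < j \<Longrightarrow> \<epsilon> k x = 0 \<and> \<epsilon>' k x = 0"
    and "\<epsilon> j x = 1/16 * (1/2) ^ j * g j x \<and> \<epsilon>' j x = (1/16 * (1/2) ^ j) *\<^sub>R g' j x"
    by (simp_all add: \<epsilon>_def \<epsilon>'_def)
  assume "j < k"
  then have "Suc j \<le> k" by simp
  then show "\<epsilon> k x = 1/32 * (1/2) ^ j * (1 + g j x) \<and> \<epsilon>' k x = (1/32 * (1/2) ^ j) *\<^sub>R g' j x"
  proof (induction k rule: dec_induct)
    case base
    have "g (Suc j) x = 1 \<and> g' (Suc j) x = 0" using j(1) by (intro cutoff_high) simp
    then show ?case using g_zero by (simp add: \<epsilon>_def \<epsilon>'_def algebra_simps)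
  next
    case (step k)
    have "2 * (1/2 :: real) ^ k \<le> 2 * (1/2) ^ Suc j" using step.hyps by (intro mult_left_mono power_decreasing) auto
    also have "\<dots> \<le> \<delta> x" using j(1) by simp
    finally show ?case using \<epsilon>_stable step.IH by simp
  qed
qed

lemma \<epsilon>_bounds: "0 \<le> \<epsilon> k x \<and> \<epsilon> k x \<le> \<delta> x / 16 \<and> norm (\<epsilon>' k x) \<le> 1/2 \<and> (\<delta> x = 0 \<longrightarrow> \<epsilon>' k x = 0)"
proof (cases "\<delta> x = 0")
  case True
  then show ?thesis using cutoff_low[of x] by (simp add: \<epsilon>_def \<epsilon>'_def)
next
  case False
  then have "0 < \<delta> x" using nonneg[of x] by simp
  then obtain j where j: "(1/2) ^ j < \<delta> x" "\<delta> x \<le> 2 * (1/2) ^ j" "\<And>i. i < j \<Longrightarrow> \<delta> x \<le> (1/2) ^ i"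
    by (rule dyadic_level_exists) blast
  define h :: real where "h = (1/2) ^ j"
  have h: "0 < h" "h * 2 ^ j = 1" "h < \<delta> x" using j(1) by (simp_all add: h_def power_divide)
  have "h * g j x \<le> h * 1" using h(1) by (intro mult_left_mono cutoff_bounds) simp
  then have hg_le: "h * g j x \<le> \<delta> x" using h(3) by linarith
  have hg_nonneg: "0 \<le> h * g j x" using h(1) cutoff_bounds(1)[of j x] by simp
  have "h * norm (g' j x) \<le> h * (8 * 2 ^ j)" using h(1) by (intro mult_left_mono cutoff_bounds) simp
  then have hg'_le: "h * norm (g' j x) \<le> 8" using h(2) by (simp add: mult.left_commute)
  note at_level = \<epsilon>_at_level[OF j(1,3), folded h_def]
  consider "k < j" | "k = j" | "j < k" by linarith
  then show ?thesis
  proof cases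
    case 1
    with at_level(1)[of k] False \<open>0 < \<delta> x\<close> show ?thesis by simp
  next
    case 2
    with at_level(2) have "\<epsilon> k x = 1/16 * (h * g j x)" "norm (\<epsilon>' k x) = 1/16 * (h * norm (g' j x))"
      using h by simp_all
    then show ?thesis using False hg_le hg_nonneg hg'_le by simp
  next
    case 3
    with at_level(3)[of k] have "\<epsilon> k x = 1/32 * (h + h * g j x)" "norm (\<epsilon>' k x) = 1/32 * (h * norm (g' j x))"
      using h by (simp_all add: distrib_left)
    then show ?thesis using False h hg_le hg_nonneg hg'_le by simp
  qed
qed

lemma \<epsilon>_ge:
  assumes "2 * (1/2) ^ k \<le> \<delta> x" shows "\<delta> x / 64 \<le> \<epsilon> k x"
proof -
  have "0 < \<delta> x" by (rule less_le_trans[OF _ assms]) simp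
  then obtain j where j: "(1/2) ^ j < \<delta> x" "\<delta> x \<le> 2 * (1/2) ^ j" "\<And>i. i < j \<Longrightarrow> \<delta> x \<le> (1/2) ^ i"
    by (rule dyadic_level_exists) blast
  have "j \<le> k" using j(3)[of k] assms zero_less_power[of "1/2 :: real" k] by fastforce
  then have "\<epsilon> (Suc k) x = 1/32 * (1/2) ^ j * (1 + g j x)" using \<epsilon>_at_level(3)[OF j(1,3), of "Suc k"] by simp
  also have "\<dots> \<ge> 1/32 * (1/2) ^ j" using cutoff_bounds(1)[of j x] by (simp add: mult_le_cancel_left1)
  finally show ?thesis using j(2) \<epsilon>_stable[OF assms] by simp
qed

lemma regularised_distance: "regularised_distance \<delta> \<epsilon> \<epsilon>'"
  using C1_periodic_\<epsilon> \<epsilon>_bounds \<epsilon>_ge \<epsilon>_stable by (simp add: regularised_distance_def small_gradient_def)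

end

lemma regularised_distance_exists:
  fixes \<delta> :: "real^'n \<Rightarrow> real"
  assumes "\<And>x y. \<bar>\<delta> x - \<delta> y\<bar> \<le> norm (x - y)" "lattice_periodic \<delta>" "\<And>x. 0 \<le> \<delta> x" "\<And>x. \<delta> x \<le> 1"
  obtains \<epsilon> \<epsilon>' where "regularised_distance \<delta> \<epsilon> \<epsilon>'"
proof -
  obtain g g' where "\<And>n. dyadic_cutoff \<delta> n (g n) (g' n)"
    using dyadic_cutoff_exists[OF assms(1,2)] by metis
  then interpret dyadic_cutoffs \<delta> g g'
    using assms by unfold_locales
  show thesis using regularised_distance by (rule that)
qed

section \<open>The limit of the smoothed forms\<close>

locale smoothing_limit =
  fixes r :: nat and w :: "'n::{finite,linorder} form" and \<delta> :: "(real,'n) vec \<Rightarrow> real"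
    and \<epsilon> :: "nat \<Rightarrow> (real,'n) vec \<Rightarrow> real" and \<epsilon>' :: "nat \<Rightarrow> (real,'n) vec \<Rightarrow> (real,'n) vec" and M :: real
  assumes w: "periodic_L1_form r w" and closed: "torus_closed r w"
    and lip: "\<bar>\<delta> x - \<delta> x'\<bar> \<le> norm (x - x')" and per: "lattice_periodic \<delta>" and nonneg: "0 \<le> \<delta> x"
    and regularised: "regularised_distance \<delta> \<epsilon> \<epsilon>'"
    and M: "0 \<le> M"
    and average_le: "0 < \<delta> x \<Longrightarrow> \<delta> x / 64 \<le> s \<Longrightarrow> s \<le> \<delta> x \<Longrightarrow>
      (\<integral>\<^sup>+y. ennreal (form_l1 r (w (x + s *\<^sub>R y))) \<partial>unit_ball_measure) \<le> ennreal M"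
begin

definition pull_const :: real where
  "pull_const = 1 + CARD('n)\<^sup>2"

definition smoothed :: "nat \<Rightarrow> 'n form" where
  "smoothed k = smoothing (\<epsilon> k) (\<epsilon>' k) w"

definition limit_form :: "'n form" where
  "limit_form x K = lim (\<lambda>k. smoothed k x K)"

lemma pull_const_ge_1: "1 \<le> pull_const"
  by (simp add: pull_const_def)

lemma small_gradient_\<epsilon>: "small_gradient (\<epsilon> k) (\<epsilon>' k)"
  and \<epsilon>_nonneg: "0 \<le> \<epsilon> k x" and \<epsilon>_le: "\<epsilon> k x \<le> \<delta> x / 16"
  and \<epsilon>_ge: "2 * (1/2) ^ k \<le> \<delta> x \<Longrightarrow> \<delta> x / 64 \<le> \<epsilon> k x"
  using regularised by (auto simp: regularised_distance_def)

lemma \<epsilon>_eventually_constant: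
  assumes "2 * (1/2) ^ k \<le> \<delta> x" "k \<le> l"
  shows "\<epsilon> l x = \<epsilon> k x \<and> \<epsilon>' l x = \<epsilon>' k x"
  using assms(2)
proof (induction l rule: dec_induct)
  case (step l)
  have "(1/2 :: real) ^ l \<le> (1/2) ^ k" using step.hyps by (intro power_decreasing) auto
  then have "2 * (1/2) ^ l \<le> \<delta> x" using assms(1) by linarith
  then show ?case using regularised step.IH by (simp add: regularised_distance_def)
qed simp

lemma smoothed_eq: "\<delta> x = 0 \<Longrightarrow> smoothed k x K = w x K"
proof -
  assume "\<delta> x = 0"
  moreover have "\<epsilon> k x = 0" using \<epsilon>_nonneg[of k x] \<epsilon>_le[of k x] \<open>\<delta> x = 0\<close> by simp
  ultimately show ?thesis
    using regularised unfolding smoothed_def regularised_distance_def by (intro smoothing_trivial) auto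
qed

lemma limit_form_eq: "\<delta> x = 0 \<Longrightarrow> limit_form x K = w x K"
  unfolding limit_form_def by (simp add: smoothed_eq)

lemma limit_form_eq_smoothed:
  assumes "2 * (1/2) ^ k \<le> \<delta> x"
  shows "limit_form x K = smoothed k x K"
proof -
  have "smoothed l x K = smoothed k x K" if "k \<le> l" for l
    unfolding smoothed_def by (rule smoothing_cong) (simp_all only: \<epsilon>_eventually_constant[OF assms that])
  then have "\<forall>\<^sub>F l in sequentially. smoothed l x K = smoothed k x K"
    unfolding eventually_sequentially by blast
  then show ?thesis
    unfolding limit_form_def by (intro limI tendsto_eventually)
qed

lemma eventually_dyadic_le:
  assumes "0 < \<delta> x"
  shows "\<forall>\<^sub>F k in sequentially. c * (1/2) ^ k \<le> \<delta> x"
proof -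
  have "(\<lambda>k. c * (1/2) ^ k) \<longlonglongrightarrow> c * 0"
    by (intro tendsto_mult tendsto_const LIMSEQ_power_zero) simp
  then have "\<forall>\<^sub>F k in sequentially. c * (1/2) ^ k < \<delta> x"
    using assms by (intro order_tendstoD(2)) auto
  then show ?thesis by (rule eventually_mono) simp
qed

lemma smoothed_tendsto: "(\<lambda>k. smoothed k x K) \<longlonglongrightarrow> limit_form x K"
proof (cases "\<delta> x = 0")
  case False
  then have "0 < \<delta> x" using nonneg[of x] by simp
  then have "\<forall>\<^sub>F k in sequentially. smoothed k x K = limit_form x K"
    by (rule eventually_mono[OF eventually_dyadic_le[of x 2]]) (simp add: limit_form_eq_smoothed)
  then show ?thesis by (rule tendsto_eventually)
qed (simp add: smoothed_eq limit_form_eq)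

lemma smoothed_measurable: "card K = r \<Longrightarrow> (\<lambda>x. smoothed k x K) \<in> borel_measurable borel"
  unfolding smoothed_def by (rule smoothing_measurable[OF small_gradient_\<epsilon> w])

lemma limit_form_measurable: "card K = r \<Longrightarrow> (\<lambda>x. limit_form x K) \<in> borel_measurable borel"
  by (rule borel_measurable_LIMSEQ_real[OF smoothed_tendsto smoothed_measurable])

lemma ennreal_abs_smoothed_le:
  assumes "card K = r"
  shows "ennreal \<bar>smoothed k x K\<bar> \<le> ennreal pull_const * (\<integral>\<^sup>+y. ennreal (form_l1 r (w (displace (\<epsilon> k) y x))) \<partial>unit_ball_measure)"
proof -
  note [measurable] = form_l1_measurable[OF w]
  have "ennreal \<bar>smoothed k x K\<bar> \<le> (\<integral>\<^sup>+y. ennreal (pull_const * form_l1 r (w (displace (\<epsilon> k) y x))) \<partial>unit_ball_measure)"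
    unfolding smoothed_def pull_const_def
    by (rule ennreal_abs_smoothing_le[where e'="\<epsilon>' k", OF small_gradient_norm_le[OF small_gradient_\<epsilon>] assms])
  also have "\<dots> = ennreal pull_const * (\<integral>\<^sup>+y. ennreal (form_l1 r (w (displace (\<epsilon> k) y x))) \<partial>unit_ball_measure)"
    using pull_const_ge_1 unfolding displace_def by (simp add: ennreal_mult nn_integral_cmult)
  finally show ?thesis .
qed

lemma abs_limit_form_le:
  assumes K: "card K = r" and pos: "0 < \<delta> x"
  shows "\<bar>limit_form x K\<bar> \<le> pull_const * M"
proof -
  obtain k where k: "2 * (1/2) ^ k \<le> \<delta> x"
    using eventually_dyadic_le[OF pos, of 2] by (auto simp: eventually_sequentially)
  have "ennreal \<bar>smoothed k x K\<bar> \<le> ennreal pull_const * (\<integral>\<^sup>+y. ennreal (form_l1 r (w (x + \<epsilon> k x *\<^sub>R y))) \<partial>unit_ball_measure)"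
    using ennreal_abs_smoothed_le[OF K] by (simp add: displace_def)
  also have "\<dots> \<le> ennreal pull_const * ennreal M"
    using \<epsilon>_ge[OF k] \<epsilon>_le[of k x] pos by (intro mult_left_mono average_le) auto
  also have "\<dots> = ennreal (pull_const * M)" using pull_const_ge_1 M by (simp add: ennreal_mult)
  finally have "\<bar>smoothed k x K\<bar> \<le> pull_const * M"
    using pull_const_ge_1 M by (subst (asm) ennreal_le_iff) auto
  then show ?thesis by (simp add: limit_form_eq_smoothed[OF k])
qed

text \<open>The smoothed forms differ from their limit only on \<open>0 < \<delta> < 2 \<cdot> 2\<^sup>-\<^sup>k\<close>, and there the difference is controlled
  by averages of this function, since a displacement changes \<open>\<delta>\<close> by at most a factor two.\<close>

definition layer :: "nat \<Rightarrow> (real,'n) vec \<Rightarrow> real" where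
  "layer k x = (if 0 < \<delta> x \<and> \<delta> x < 4 * (1/2) ^ k then form_l1 r (w x) + M else 0)"

lemma \<delta>_measurable [measurable]: "\<delta> \<in> borel_measurable borel"
proof -
  have "1-lipschitz_on UNIV \<delta>" using lip by (intro lipschitz_onI) (auto simp: dist_norm)
  then show ?thesis by (intro borel_measurable_continuous_onI lipschitz_on_continuous_on)
qed

lemma layer_measurable [measurable]: "layer k \<in> borel_measurable borel"
  using form_l1_measurable[OF w] unfolding layer_def by measurable

lemma layer_nonneg: "0 \<le> layer k x"
  using M by (simp add: layer_def)

lemma layer_periodic: "lattice_periodic (layer k)"
  by (intro lattice_periodicI) (simp add: layer_def lattice_periodicD[OF per] lattice_periodicD[OF form_l1_periodic[OF w]])

lemma layer_tendsto_L1: "(\<lambda>k. torus_L1_norm (layer k)) \<longlonglongrightarrow> 0"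
proof -
  have "(\<lambda>k. torus_L1_norm (\<lambda>x. layer k x - 0)) \<longlonglongrightarrow> 0"
  proof (rule torus_L1_norm_dominated[where w="\<lambda>x. form_l1 r (w x) + M"])
    show "integrable torus (\<lambda>x. form_l1 r (w x) + M)" using form_l1_integrable[OF w] by simp
    show "\<bar>layer k x\<bar> \<le> form_l1 r (w x) + M" for k x using M by (simp add: layer_def)
    have "(\<lambda>k. layer k x) \<longlonglongrightarrow> 0" for x
    proof (cases "0 < \<delta> x")
      case True
      then have "\<forall>\<^sub>F k in sequentially. layer k x = 0"
        by (rule eventually_mono[OF eventually_dyadic_le[of x 4]]) (simp add: layer_def)
      then show ?thesis by (rule tendsto_eventually)
    qed (simp add: layer_def)
    then show "AE x in torus. (\<lambda>k. layer k x) \<longlonglongrightarrow> 0" by simp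
  qed simp_all
  then show ?thesis by simp
qed

lemma layer_displace:
  assumes "0 < \<delta> x" "\<delta> x < 2 * (1/2) ^ k" and y: "norm y \<le> 1"
  shows "layer k (displace (\<epsilon> k) y x) = form_l1 r (w (displace (\<epsilon> k) y x)) + M"
proof -
  have "norm (\<epsilon> k x *\<^sub>R y) \<le> \<delta> x / 16 * 1"
    unfolding norm_scaleR using y \<epsilon>_nonneg[of k x] \<epsilon>_le[of k x] by (intro mult_mono) auto
  then have "\<bar>\<delta> (displace (\<epsilon> k) y x) - \<delta> x\<bar> \<le> \<delta> x / 16"
    using lip[of "displace (\<epsilon> k) y x" x] by (simp add: displace_def)
  with assms(1,2) show ?thesis by (auto simp: layer_def)
qed

lemma smoothed_diff_le:
  assumes K: "card K = r"
  shows "ennreal \<bar>smoothed k x K - limit_form x K\<bar> \<le> ennreal pull_const * (\<integral>\<^sup>+y. ennreal (layer k (displace (\<epsilon> k) y x)) \<partial>unit_ball_measure)"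
proof -
  consider "\<delta> x = 0" | "2 * (1/2) ^ k \<le> \<delta> x" | "0 < \<delta> x" "\<delta> x < 2 * (1/2) ^ k"
    using nonneg[of x] by linarith
  then show ?thesis
  proof cases
    case 3
    note [measurable] = form_l1_measurable[OF w]
    have "ennreal \<bar>smoothed k x K - limit_form x K\<bar> \<le> ennreal (\<bar>smoothed k x K\<bar> + pull_const * M)"
      using abs_limit_form_le[OF K 3(1)] by (intro ennreal_leI) linarith
    also have "\<dots> = ennreal \<bar>smoothed k x K\<bar> + ennreal pull_const * ennreal M"
      using pull_const_ge_1 M by (simp add: ennreal_plus ennreal_mult)
    also have "\<dots> \<le> ennreal pull_const * (\<integral>\<^sup>+y. ennreal (form_l1 r (w (displace (\<epsilon> k) y x))) \<partial>unit_ball_measure)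
        + ennreal pull_const * (\<integral>\<^sup>+y. ennreal M \<partial>(unit_ball_measure :: (real,'n) vec measure))"
      using ennreal_abs_smoothed_le[OF K] by (simp add: add_right_mono)
    also have "\<dots> = ennreal pull_const * (\<integral>\<^sup>+y. ennreal (form_l1 r (w (displace (\<epsilon> k) y x))) + ennreal M \<partial>unit_ball_measure)"
      unfolding displace_def by (subst nn_integral_add) (simp_all add: distrib_left)
    also have "\<dots> = ennreal pull_const * (\<integral>\<^sup>+y. ennreal (layer k (displace (\<epsilon> k) y x)) \<partial>unit_ball_measure)"
      using AE_unit_ball_measure M
      by (intro arg_cong2[where f="(*)"] refl nn_integral_cong_AE) (auto elim!: eventually_mono simp: layer_displace[OF 3])
    finally show ?thesis .
  qed (simp_all add: smoothed_eq limit_form_eq limit_form_eq_smoothed)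
qed

lemma smoothed_tendsto_L1:
  assumes K: "card K = r"
  shows "(\<lambda>k. torus_L1_norm (\<lambda>x. smoothed k x K - limit_form x K)) \<longlonglongrightarrow> 0"
proof (rule tendsto_sandwich[OF always_eventually always_eventually tendsto_const])
  interpret P: pair_sigma_finite "unit_ball_measure :: (real,'n) vec measure" "torus :: (real,'n) vec measure" ..
  let ?C = "ennreal pull_const * 20 ^ CARD('n)"
  have "torus_L1_norm (\<lambda>x. smoothed k x K - limit_form x K) \<le> ?C * torus_L1_norm (layer k)" for k
  proof -
    note [measurable] = C1_periodic_measurable(1)[OF small_gradient_C1_periodic[OF small_gradient_\<epsilon>], of k]
    have "torus_L1_norm (\<lambda>x. smoothed k x K - limit_form x K)
        \<le> (\<integral>\<^sup>+x. ennreal pull_const * (\<integral>\<^sup>+y. ennreal (layer k (displace (\<epsilon> k) y x)) \<partial>unit_ball_measure) \<partial>torus)"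
      unfolding torus_L1_norm_def by (intro nn_integral_mono smoothed_diff_le[OF K])
    also have "\<dots> = ennreal pull_const * (\<integral>\<^sup>+x. (\<integral>\<^sup>+y. ennreal (layer k (displace (\<epsilon> k) y x)) \<partial>unit_ball_measure) \<partial>torus)"
      unfolding displace_def by (rule nn_integral_cmult) measurable
    also have "(\<integral>\<^sup>+x. (\<integral>\<^sup>+y. ennreal (layer k (displace (\<epsilon> k) y x)) \<partial>unit_ball_measure) \<partial>torus)
        = (\<integral>\<^sup>+y. (\<integral>\<^sup>+x. ennreal (layer k (displace (\<epsilon> k) y x)) \<partial>torus) \<partial>unit_ball_measure)"
      unfolding displace_def by (rule P.Fubini') measurable
    also have "\<dots> \<le> (\<integral>\<^sup>+y. 20 ^ CARD('n) * torus_L1_norm (layer k) \<partial>(unit_ball_measure :: (real,'n) vec measure))"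
    proof (rule nn_integral_mono_AE, use AE_unit_ball_measure in eventually_elim)
      case (elim y)
      show ?case
        using nn_integral_displace_le[OF small_gradient_\<epsilon> elim _ lattice_periodic_compose[OF layer_periodic], of ennreal k k]
        by (simp add: torus_L1_norm_def layer_nonneg)
    qed
    finally show ?thesis by (simp add: mult_left_mono mult.assoc)
  qed
  then show "\<forall>k. torus_L1_norm (\<lambda>x. smoothed k x K - limit_form x K) \<le> ?C * torus_L1_norm (layer k)" ..
  show "(\<lambda>k. ?C * torus_L1_norm (layer k)) \<longlonglongrightarrow> 0"
    using ennreal_tendsto_cmult[OF _ layer_tendsto_L1, of ?C]
    by (simp add: ennreal_mult_less_top power_less_top_ennreal)
qed simp

lemma smoothed_integrable: "card K = r \<Longrightarrow> integrable torus (\<lambda>x. smoothed k x K)"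
  unfolding smoothed_def by (rule smoothing_integrable[OF small_gradient_\<epsilon> w])

lemma limit_form_integrable:
  assumes K: "card K = r"
  shows "integrable torus (\<lambda>x. limit_form x K)"
proof -
  note [measurable] = smoothed_measurable[OF K] limit_form_measurable[OF K]
  have "\<forall>\<^sub>F k in sequentially. torus_L1_norm (\<lambda>x. smoothed k x K - limit_form x K) < 1"
    by (rule order_tendstoD(2)[OF smoothed_tendsto_L1[OF K]]) simp
  then obtain k where "torus_L1_norm (\<lambda>x. smoothed k x K - limit_form x K) < 1" by (auto simp: eventually_sequentially)
  then have "integrable torus (\<lambda>x. smoothed k x K - limit_form x K)"
    using less_trans[OF _ ennreal_one_less_top] by (simp add: torus_integrable_iff_L1_norm)
  from Bochner_Integration.integrable_diff[OF smoothed_integrable[OF K, of k] this] show ?thesis by simp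
qed

lemma limit_form_closed: "torus_closed r limit_form"
proof (rule torus_closed_L1_limit[where V=smoothed])
  show "torus_closed r (smoothed k)" for k
    unfolding smoothed_def by (rule smoothing_closed[OF small_gradient_\<epsilon> w closed])
qed (simp_all add: smoothed_integrable limit_form_integrable smoothed_tendsto_L1)

end

section \<open>The bad set\<close>

subsection \<open>Ball averages\<close>

lemma
  fixes x :: "'a::euclidean_space"
  shows emeasure_lborel_cball_neq_0: "0 < s \<Longrightarrow> emeasure lborel (cball x s) \<noteq> 0"
    and emeasure_lborel_cball_neq_top: "0 \<le> s \<Longrightarrow> emeasure lborel (cball x s) \<noteq> top"
  using unit_ball_vol_pos[of "DIM('a)"]
  by (simp_all add: emeasure_cball ennreal_eq_0_iff not_le del: unit_ball_vol_pos)

lemma nn_integral_cball_eq_average: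
  fixes h :: "'a::euclidean_space \<Rightarrow> ennreal"
  assumes [measurable]: "h \<in> borel_measurable borel" and s: "0 < s"
  shows "(\<integral>\<^sup>+z\<in>cball x s. h z \<partial>lborel) = emeasure lborel (cball x s) * (\<integral>\<^sup>+y. h (x + s *\<^sub>R y) \<partial>unit_ball_measure)"
proof -
  let ?B = "cball (0 :: 'a) 1"
  have [measurable]: "cball x s \<in> sets borel" "?B \<in> sets borel" by (simp_all add: borel_closed)
  have unit_ball: "(\<integral>\<^sup>+y. h (x + s *\<^sub>R y) * indicator ?B y \<partial>lborel)
      = emeasure lborel ?B * (\<integral>\<^sup>+y. h (x + s *\<^sub>R y) \<partial>unit_ball_measure)"
    unfolding unit_ball_measure_def
    by (subst nn_integral_uniform_measure)
      (simp_all add: ennreal_times_divide mult.commute[of "emeasure lborel ?B"] ennreal_mult_divide_eq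
        emeasure_lborel_cball_neq_0 emeasure_lborel_cball_neq_top)
  have "(\<integral>\<^sup>+z\<in>cball x s. h z \<partial>lborel)
      = (\<integral>\<^sup>+z. h z * indicator (cball x s) z \<partial>density (distr lborel borel (\<lambda>y. x + s *\<^sub>R y)) (\<lambda>_. ennreal (s ^ DIM('a))))"
    using lborel_affine[of s x] s by simp
  also have "\<dots> = (\<integral>\<^sup>+y. ennreal (s ^ DIM('a)) * (h (x + s *\<^sub>R y) * indicator (cball x s) (x + s *\<^sub>R y)) \<partial>lborel)"
    by (simp add: nn_integral_density nn_integral_distr)
  also have "\<dots> = (\<integral>\<^sup>+y. ennreal (s ^ DIM('a)) * (h (x + s *\<^sub>R y) * indicator ?B y) \<partial>lborel)"
    using s by (intro nn_integral_cong) (auto split: split_indicator simp: dist_norm)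
  also have "\<dots> = ennreal (s ^ DIM('a)) * (emeasure lborel ?B * (\<integral>\<^sup>+y. h (x + s *\<^sub>R y) \<partial>unit_ball_measure))"
    by (simp add: nn_integral_cmult unit_ball)
  finally show ?thesis
    using emeasure_lborel_cball_scale[of s 1 x 0] s by (simp add: mult.assoc)
qed

definition ball_means_le :: "real \<Rightarrow> real \<Rightarrow> ('a::euclidean_space \<Rightarrow> ennreal) \<Rightarrow> 'a \<Rightarrow> bool" where
  "ball_means_le R T f p \<longleftrightarrow> (\<forall>\<rho>. 0 < \<rho> \<and> \<rho> \<le> R \<longrightarrow>
     (\<integral>\<^sup>+z\<in>cball p \<rho>. f z \<partial>lborel) \<le> ennreal T * emeasure lborel (cball p \<rho>))"

lemma ball_means_leD:
  "ball_means_le R T f p \<Longrightarrow> 0 < \<rho> \<Longrightarrow> \<rho> \<le> R \<Longrightarrow>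
    (\<integral>\<^sup>+z\<in>cball p \<rho>. f z \<partial>lborel) \<le> ennreal T * emeasure lborel (cball p \<rho>)"
  by (simp add: ball_means_le_def)

lemma ball_average_le:
  fixes h :: "'a::euclidean_space \<Rightarrow> ennreal"
  assumes [measurable]: "h \<in> borel_measurable borel" and s: "0 < s" and T: "0 \<le> T"
    and means: "ball_means_le R T h p" and sub: "cball x s \<subseteq> cball p \<rho>" and \<rho>: "0 < \<rho>" "\<rho> \<le> R" "\<rho> \<le> \<kappa> * s"
  shows "(\<integral>\<^sup>+y. h (x + s *\<^sub>R y) \<partial>unit_ball_measure) \<le> ennreal (T * \<kappa> ^ DIM('a))"
proof -
  have \<kappa>: "0 < \<kappa>" using \<rho> s by (metis less_le_trans zero_less_mult_pos2)
  have "emeasure lborel (cball x s) * (\<integral>\<^sup>+y. h (x + s *\<^sub>R y) \<partial>unit_ball_measure) = (\<integral>\<^sup>+z\<in>cball x s. h z \<partial>lborel)"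
    by (simp add: nn_integral_cball_eq_average[OF _ s])
  also have "\<dots> \<le> (\<integral>\<^sup>+z\<in>cball p \<rho>. h z \<partial>lborel)"
    using sub by (intro nn_integral_mono) (auto split: split_indicator)
  also have "\<dots> \<le> ennreal T * emeasure lborel (cball p \<rho>)"
    using means \<rho> by (intro ball_means_leD)
  also have "\<dots> \<le> ennreal T * emeasure lborel (cball p (\<kappa> * s))"
    using \<rho>(3) by (intro mult_left_mono emeasure_mono subset_cball) auto
  also have "\<dots> = emeasure lborel (cball x s) * ennreal (T * \<kappa> ^ DIM('a))"
    using s \<kappa> T by (simp add: emeasure_lborel_cball_scale[of \<kappa> s p x] ennreal_mult mult_ac)
  finally show ?thesis
    using s by (subst (asm) ennreal_mult_le_mult_iff) (simp_all add: emeasure_lborel_cball_neq_0 emeasure_lborel_cball_neq_top)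
qed

lemma lattice_periodic_ball_means_le:
  assumes [measurable]: "f \<in> borel_measurable borel" and per: "lattice_periodic f"
  shows "lattice_periodic (ball_means_le R T f)"
proof (rule lattice_periodicI)
  fix p k :: "real^'a" assume k: "k \<in> int_lattice"
  have "(\<integral>\<^sup>+z\<in>cball (p + k) \<rho>. f z \<partial>lborel) = (\<integral>\<^sup>+z\<in>cball p \<rho>. f z \<partial>lborel)" for \<rho>
  proof -
    have [measurable]: "cball (p + k) \<rho> \<in> sets borel" by (simp add: borel_closed)
    have "(\<integral>\<^sup>+z\<in>cball (p + k) \<rho>. f z \<partial>lborel) = (\<integral>\<^sup>+z. f (z + k) * indicator (cball (p + k) \<rho>) (z + k) \<partial>lborel)"
      by (rule lborel_nn_integral_translate[symmetric]) simp
    also have "\<dots> = (\<integral>\<^sup>+z\<in>cball p \<rho>. f z \<partial>lborel)"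
      by (intro nn_integral_cong) (simp add: lattice_periodicD[OF per k] dist_norm indicator_def)
    finally show ?thesis .
  qed
  moreover have "emeasure lborel (cball (p + k) \<rho>) = emeasure lborel (cball p \<rho>)" if "0 < \<rho>" for \<rho>
    using that by (simp add: emeasure_cball)
  ultimately show "ball_means_le R T f (p + k) = ball_means_le R T f p"
    by (auto simp: ball_means_le_def)
qed

subsection \<open>The weak type estimate and outer regularity\<close>

lemma emeasure_ball_5_le:
  fixes f :: "'a::euclidean_space \<Rightarrow> ennreal"
  assumes "0 < \<rho>" "0 < L" and large: "ennreal L * emeasure lborel (cball p \<rho>) < (\<integral>\<^sup>+z\<in>cball p \<rho>. f z \<partial>lborel)"
  shows "emeasure lborel (ball p (5 * \<rho>)) \<le> ennreal (5 ^ DIM('a) / L) * (\<integral>\<^sup>+z\<in>cball p \<rho>. f z \<partial>lborel)"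
proof -
  have "emeasure lborel (ball p (5 * \<rho>)) \<le> emeasure lborel (cball p (5 * \<rho>))"
    by (intro emeasure_mono) auto
  also have "\<dots> = ennreal (5 ^ DIM('a) / L * L) * emeasure lborel (cball p \<rho>)"
    using assms by (simp add: emeasure_lborel_cball_scale[of 5 \<rho> p p])
  also have "\<dots> = ennreal (5 ^ DIM('a) / L) * (ennreal L * emeasure lborel (cball p \<rho>))"
    using assms(2) by (subst ennreal_mult) (auto simp: mult.assoc)
  also have "\<dots> \<le> ennreal (5 ^ DIM('a) / L) * (\<integral>\<^sup>+z\<in>cball p \<rho>. f z \<partial>lborel)"
    using large by (intro mult_left_mono) auto
  finally show ?thesis .
qed

definition maximal_const :: "'n::finite itself \<Rightarrow> real \<Rightarrow> real" where
  "maximal_const _ R = 5 ^ CARD('n) * card {k \<in> int_lattice :: (real^'n) set. norm k \<le> real CARD('n) + R + real CARD('n)}"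

lemma maximal_const_nonneg: "0 \<le> maximal_const TYPE('n::finite) R"
  by (simp add: maximal_const_def)

lemma bad_centres_cover:
  fixes f :: "real^'n \<Rightarrow> ennreal" and R :: real
  assumes f: "f \<in> borel_measurable borel" and L: "0 < L"
  obtains S where "open S" "{p \<in> unit_cell. \<not> ball_means_le R L f p} \<subseteq> S"
    "emeasure lborel S \<le> ennreal (5 ^ CARD('n) / L) * (\<integral>\<^sup>+z\<in>cball 0 (CARD('n) + R). f z \<partial>lborel)"
proof -
  let ?N = "CARD('n)"
  define F where "F = {p \<in> unit_cell. \<not> ball_means_le R L f p}"
  have "\<exists>\<rho>. 0 < \<rho> \<and> \<rho> \<le> R \<and> ennreal L * emeasure lborel (cball p \<rho>) < (\<integral>\<^sup>+z\<in>cball p \<rho>. f z \<partial>lborel)"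
    if "p \<in> F" for p
    using that by (auto simp: F_def ball_means_le_def not_le)
  then obtain \<rho> where \<rho>: "0 < \<rho> p \<and> \<rho> p \<le> R"
      "ennreal L * emeasure lborel (cball p (\<rho> p)) < (\<integral>\<^sup>+z\<in>cball p (\<rho> p). f z \<partial>lborel)" if "p \<in> F" for p
    by metis
  have balls_bounded: "cball p (\<rho> p) \<subseteq> cball 0 (?N + R)" if "p \<in> F" for p
    using that \<rho>(1)[OF that] norm_unit_cell_le[of p] by (simp add: F_def cball_subset_cball_iff)
  obtain C where "F \<subseteq> (\<Union>j\<in>C. ball j (5 * \<rho> j))"
    "emeasure lborel (\<Union>j\<in>C. ball j (5 * \<rho> j)) \<le> ennreal (5 ^ ?N / L) * (\<integral>\<^sup>+z\<in>cball 0 (?N + R). f z \<partial>lborel)"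
  proof (rule emeasure_Vitali_cover_le[OF f \<rho>(1) _ balls_bounded])
    show "emeasure lborel (ball p (5 * \<rho> p)) \<le> ennreal (5 ^ ?N / L) * (\<integral>\<^sup>+z\<in>cball p (\<rho> p). f z \<partial>lborel)"
      if "p \<in> F" for p
      using emeasure_ball_5_le[OF _ L \<rho>(2)[OF that]] \<rho>(1)[OF that] by simp
  qed (simp_all add: borel_closed)
  then show thesis by (intro that[of "\<Union>j\<in>C. ball j (5 * \<rho> j)"]) (auto simp: F_def)
qed

lemma maximal_function_bad_set:
  fixes f :: "real^'n \<Rightarrow> ennreal"
  assumes f: "f \<in> borel_measurable borel" and per: "lattice_periodic f" and L: "0 < L"
  obtains G where "open G" "lattice_invariant G" "\<And>p. p \<notin> G \<Longrightarrow> ball_means_le R L f p"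
    "emeasure torus G \<le> ennreal (maximal_const TYPE('n) R / L) * (\<integral>\<^sup>+x. f x \<partial>torus)"
proof -
  let ?N = "CARD('n)"
  obtain S where S: "open S" "{p \<in> unit_cell. \<not> ball_means_le R L f p} \<subseteq> S"
    "emeasure lborel S \<le> ennreal (5 ^ ?N / L) * (\<integral>\<^sup>+z\<in>cball 0 (?N + R). f z \<partial>lborel)"
    using bad_centres_cover[OF f L] .
  show thesis
  proof
    show "open (lattice_hull S)" by (rule open_lattice_hull[OF S(1)])
    show "lattice_invariant (lattice_hull S)" by (rule lattice_invariant_hull)
    show "ball_means_le R L f p" if "p \<notin> lattice_hull S" for p
    proof (rule ccontr)
      assume "\<not> ball_means_le R L f p"
      then have "wrap p \<in> S"
        using S(2) by (auto simp: wrap_in_unit_cell lattice_periodic_wrap[OF lattice_periodic_ball_means_le[OF f per]])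
      then have "p \<in> lattice_hull S"
        unfolding lattice_hull_def by (intro CollectI bexI[OF _ wrap_diff_int_lattice[of p]]) simp
      with that show False ..
    qed
    have "emeasure torus (lattice_hull S) \<le> emeasure lborel S"
      by (rule emeasure_torus_lattice_hull_le) (use S(1) in simp)
    also note S(3)
    also have "(\<integral>\<^sup>+z\<in>cball 0 (?N + R). f z \<partial>lborel)
        \<le> of_nat (card {k \<in> int_lattice :: (real^'n) set. norm k \<le> ?N + R + ?N}) * (\<integral>\<^sup>+x. f x \<partial>torus)"
      by (rule nn_integral_cball_le_torus[OF f per])
    finally have "emeasure torus (lattice_hull S) \<le> ennreal (5 ^ ?N / L)
        * (of_nat (card {k \<in> int_lattice :: (real^'n) set. norm k \<le> ?N + R + ?N}) * (\<integral>\<^sup>+x. f x \<partial>torus))"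
      by (simp add: mult_left_mono)
    then show "emeasure torus (lattice_hull S) \<le> ennreal (maximal_const TYPE('n) R / L) * (\<integral>\<^sup>+x. f x \<partial>torus)"
      using L by (simp add: maximal_const_def ennreal_of_nat_eq_real_of_nat mult.assoc[symmetric] flip: ennreal_mult)
  qed
qed

lemma torus_outer_regular:
  assumes A: "A \<in> sets borel" "lattice_invariant A" and e: "0 < e"
  obtains H where "open H" "lattice_invariant H" "A \<subseteq> H" "emeasure torus H \<le> emeasure torus A + ennreal e"
proof -
  let ?E = "A \<inter> unit_cell"
  have E [measurable]: "?E \<in> sets borel" using A by simp
  obtain U where U: "open U" "?E \<subseteq> U" "emeasure lborel (U - ?E) < ennreal e"
    using outer_regular_lborel[OF E e] .
  have [measurable]: "U \<in> sets borel" using U(1) by simp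
  show thesis
  proof
    show "open (lattice_hull U)" by (rule open_lattice_hull[OF U(1)])
    show "lattice_invariant (lattice_hull U)" by (rule lattice_invariant_hull)
    show "A \<subseteq> lattice_hull U"
    proof
      fix x assume "x \<in> A"
      then have "wrap x \<in> ?E"
        using lattice_invariantD[OF A(2) wrap_diff_int_lattice[of x], of x] by (simp add: wrap_in_unit_cell)
      then show "x \<in> lattice_hull U"
        using U(2) wrap_diff_int_lattice[of x] unfolding lattice_hull_def
        by (intro CollectI bexI[of _ "wrap x - x"]) auto
    qed
    have "emeasure torus (lattice_hull U) \<le> emeasure lborel U"
      by (rule emeasure_torus_lattice_hull_le) simp
    also have "\<dots> \<le> emeasure lborel ?E + emeasure lborel (U - ?E)"
      using emeasure_subadditive[of ?E lborel "U - ?E"] U(2) by (simp add: Un_absorb1)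
    also have "\<dots> \<le> emeasure torus A + ennreal e"
    proof (intro add_mono)
      show "emeasure lborel ?E \<le> emeasure torus A"
        using A(1) by (simp add: torus_def emeasure_density indicator_inter_arith[symmetric] Int_commute)
    qed (use U(3) in simp)
    finally show "emeasure torus (lattice_hull U) \<le> emeasure torus A + ennreal e" .
  qed
qed

definition excess :: "real \<Rightarrow> ('a \<Rightarrow> real) \<Rightarrow> 'a \<Rightarrow> real" where
  "excess L g x = (if L < g x then g x else 0)"

lemma excess_measurable [measurable]:
  assumes [measurable]: "g \<in> borel_measurable M" shows "excess L g \<in> borel_measurable M"
  unfolding excess_def[abs_def] by measurable

lemma excess_nonneg: "(\<And>x. 0 \<le> g x) \<Longrightarrow> 0 \<le> excess L g x"
  by (simp add: excess_def)

lemma le_add_excess: "0 \<le> L \<Longrightarrow> g x \<le> L + excess L g x"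
  by (simp add: excess_def)

lemma excess_integrable:
  assumes g: "integrable M g"
  shows "integrable M (excess L g)"
proof (rule Bochner_Integration.integrable_bound[OF g])
  show "excess L g \<in> borel_measurable M"
    using borel_measurable_integrable[OF g] by measurable
qed (auto simp: excess_def)

lemma lattice_periodic_excess: "lattice_periodic g \<Longrightarrow> lattice_periodic (excess L g)"
  by (simp add: lattice_periodic_def excess_def)

lemma emeasure_superlevel_le_excess:
  assumes g: "integrable M g" "\<And>x. 0 \<le> g x" and L: "0 < L"
  shows "emeasure M {x \<in> space M. L < g x} \<le> ennreal (1 / L * (\<integral>x. excess L g x \<partial>M))"
proof -
  have "{x \<in> space M. L < g x} = {x \<in> space M. L \<le> excess L g x}"
    using L by (auto simp: excess_def)
  then show ?thesis
    using integral_Markov_inequality[OF excess_integrable[OF g(1)], of L L] g L by (simp add: excess_nonneg ennreal_mult')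
qed

section \<open>Truncation on the torus\<close>

subsection \<open>The Euclidean norm of a form\<close>

lemma form_norm_eq_L2_set: "form_norm r a = L2_set a {K. card K = r}"
  by (simp add: form_norm_def L2_set_def)

lemma form_norm_nonneg [simp]: "0 \<le> form_norm r a"
  by (simp add: form_norm_def sum_nonneg)

lemma form_norm_zero [simp]: "form_norm r (\<lambda>K. 0) = 0"
  by (simp add: form_norm_def)

lemma form_norm_cong: "(\<And>K. card K = r \<Longrightarrow> a K = b K) \<Longrightarrow> form_norm r a = form_norm r b"
  by (simp add: form_norm_def)

lemma form_norm_diff_le: "form_norm r (\<lambda>K. a K - b K) \<le> form_norm r a + form_norm r b"
proof -
  have "L2_set (\<lambda>K. - b K) {K. card K = r} = L2_set b {K. card K = r}"
    by (simp add: L2_set_def)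
  then show ?thesis
    using L2_set_triangle_ineq[of a "\<lambda>K. - b K" "{K. card K = r}"] by (simp add: form_norm_eq_L2_set)
qed

lemma form_norm_le_form_l1: "form_norm r a \<le> form_l1 r a"
  unfolding form_norm_eq_L2_set form_l1_def by (rule L2_set_le_sum_abs)

lemma form_l1_le_card:
  fixes a :: "'n::finite set \<Rightarrow> real" and c :: real
  assumes "\<And>K. card K = r \<Longrightarrow> \<bar>a K\<bar> \<le> c"
  shows "form_l1 r a \<le> card {K :: 'n set. card K = r} * c"
  unfolding form_l1_def using assms by (intro sum_bounded_above) auto

lemma form_l1_le_form_norm:
  fixes a :: "'n::finite set \<Rightarrow> real"
  shows "form_l1 r a \<le> card {K :: 'n set. card K = r} * form_norm r a"
proof (rule form_l1_le_card)
  fix K :: "'n set" assume "card K = r"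
  then have "\<bar>a K\<bar> \<le> L2_set (\<lambda>K. \<bar>a K\<bar>) {K. card K = r}" by (intro member_le_L2_set) auto
  then show "\<bar>a K\<bar> \<le> form_norm r a" by (simp add: form_norm_eq_L2_set L2_set_def)
qed

lemma form_norm_borel_measurable:
  fixes w :: "'a \<Rightarrow> 'n::finite set \<Rightarrow> real"
  assumes "\<And>K. card K = r \<Longrightarrow> (\<lambda>x. w x K) \<in> borel_measurable M"
  shows "(\<lambda>x. form_norm r (w x)) \<in> borel_measurable M"
  unfolding form_norm_def using assms
  by (intro borel_measurable_sqrt[THEN measurable_compose[rotated]] borel_measurable_sum borel_measurable_power) auto

lemma form_neq_borel:
  fixes v w :: "'a::topological_space \<Rightarrow> 'n::finite set \<Rightarrow> real"
  assumes "\<And>K. card K = r \<Longrightarrow> (\<lambda>x. v x K) \<in> borel_measurable borel"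
    and "\<And>K. card K = r \<Longrightarrow> (\<lambda>x. w x K) \<in> borel_measurable borel"
  shows "{x. form_neq r (v x) (w x)} \<in> sets borel"
proof -
  have "{x. form_neq r (v x) (w x)} = (\<Union>K\<in>{K. card K = r}. {x \<in> space borel. v x K \<noteq> w x K})"
    by (auto simp: form_neq_def)
  also have "\<dots> \<in> sets borel"
    using assms by (intro sets.finite_UN) (auto intro!: borel_measurable_neq)
  finally show ?thesis .
qed

lemma
  assumes w: "periodic_L1_form r w"
  shows periodic_L1_form_norm_measurable: "(\<lambda>x. form_norm r (w x)) \<in> borel_measurable borel"
    and periodic_L1_form_norm_periodic: "lattice_periodic (\<lambda>x. form_norm r (w x))"
    and periodic_L1_form_norm_integrable: "integrable torus (\<lambda>x. form_norm r (w x))"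
proof -
  show meas: "(\<lambda>x. form_norm r (w x)) \<in> borel_measurable borel"
    by (rule form_norm_borel_measurable[OF periodic_L1_form_measurable[OF w]])
  show "lattice_periodic (\<lambda>x. form_norm r (w x))"
    by (intro lattice_periodicI form_norm_cong lattice_periodicD[OF periodic_L1_form_periodic[OF w]])
  show "integrable torus (\<lambda>x. form_norm r (w x))"
    by (rule Bochner_Integration.integrable_bound[OF form_l1_integrable[OF w]])
      (use meas in \<open>auto simp: form_norm_le_form_l1\<close>)
qed

subsection \<open>Distance to an invariant set\<close>

definition lattice_distance :: "(real^'n) set \<Rightarrow> real^'n \<Rightarrow> real" where
  "lattice_distance X x = infdist x X / CARD('n)"

lemma infdist_eq_lattice_distance: "infdist x X = CARD('n) * lattice_distance X (x :: real^'n)"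
  by (simp add: lattice_distance_def)

lemma lattice_distance_nonneg: "0 \<le> lattice_distance X x"
  by (simp add: lattice_distance_def infdist_nonneg)

lemma lattice_distance_le_1: "lattice_invariant X \<Longrightarrow> X \<noteq> {} \<Longrightarrow> lattice_distance X (x :: real^'n) \<le> 1"
  using infdist_lattice_invariant_le[of X x] by (simp add: lattice_distance_def)

lemma lattice_distance_eq_0_iff: "closed X \<Longrightarrow> X \<noteq> {} \<Longrightarrow> lattice_distance X x = 0 \<longleftrightarrow> x \<in> X"
  by (simp add: lattice_distance_def in_closed_iff_infdist_zero)

lemma lattice_periodic_lattice_distance: "lattice_invariant X \<Longrightarrow> lattice_periodic (lattice_distance X)"
  using lattice_periodicD[OF lattice_periodic_infdist] by (intro lattice_periodicI) (simp add: lattice_distance_def)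

lemma lattice_distance_lipschitz:
  fixes x y :: "real^'n"
  shows "\<bar>lattice_distance X x - lattice_distance X y\<bar> \<le> norm (x - y)"
proof -
  have "CARD('n) * \<bar>lattice_distance X x - lattice_distance X y\<bar> = \<bar>infdist x X - infdist y X\<bar>"
    by (simp add: infdist_eq_lattice_distance abs_mult flip: right_diff_distrib)
  also have "\<dots> \<le> dist x y" by (rule infdist_triangle_abs)
  also have "\<dots> \<le> CARD('n) * norm (x - y)"
    using mult_right_mono[of 1 "real CARD('n)" "norm (x - y)"] by (simp add: dist_norm Suc_leI)
  finally show ?thesis by simp
qed

lemma ball_average_le_lattice_distance:
  fixes h :: "real^'n \<Rightarrow> ennreal"
  assumes h: "h \<in> borel_measurable borel" and T: "0 \<le> T"
    and X: "closed X" "lattice_invariant X" "X \<noteq> {}" and means: "\<And>p. p \<in> X \<Longrightarrow> ball_means_le (CARD('n) + 1) T h p"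
    and s: "0 < lattice_distance X x" "lattice_distance X x / 64 \<le> s" "s \<le> lattice_distance X x"
  shows "(\<integral>\<^sup>+y. h (x + s *\<^sub>R y) \<partial>unit_ball_measure) \<le> ennreal (T * (64 * (CARD('n) + 1)) ^ CARD('n))"
proof -
  let ?\<delta> = "lattice_distance X x" and ?n = "real CARD('n)"
  obtain p where p: "p \<in> X" "infdist x X = dist x p"
    using infdist_attains_inf[OF X(1,3)] .
  have "(\<integral>\<^sup>+y. h (x + s *\<^sub>R y) \<partial>unit_ball_measure) \<le> ennreal (T * (64 * (?n + 1)) ^ DIM(real^'n))"
  proof (rule ball_average_le[OF h _ T])
    show "ball_means_le (?n + 1) T h p" using means[OF p(1)] by (simp add: add.commute)
    have "dist p x + s \<le> (?n + 1) * ?\<delta>"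
      using p(2) s(3) by (simp add: infdist_eq_lattice_distance dist_commute distrib_right)
    then show "cball x s \<subseteq> cball p ((?n + 1) * ?\<delta>)"
      by (simp add: cball_subset_cball_iff dist_commute)
    show "(?n + 1) * ?\<delta> \<le> ?n + 1"
      using mult_left_mono[OF lattice_distance_le_1[OF X(2,3), of x], of "?n + 1"] by simp
    show "(?n + 1) * ?\<delta> \<le> 64 * (?n + 1) * s"
      using mult_left_mono[OF s(2), of "64 * (?n + 1)"] by (simp add: algebra_simps)
  qed (use s in \<open>simp_all add: add_nonneg_pos\<close>)
  then show ?thesis by (simp add: add.commute)
qed

subsection \<open>Truncation off a closed set\<close>

definition truncation_const :: "'n::finite itself \<Rightarrow> real" where
  "truncation_const _ = (1 + CARD('n)\<^sup>2) * (64 * (CARD('n) + 1)) ^ CARD('n)"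

lemma truncation_const_nonneg: "0 \<le> truncation_const TYPE('n::finite)"
  by (simp add: truncation_const_def)

lemma truncate_off_closed_set:
  fixes w :: "'n::{finite,linorder} form"
  assumes w: "periodic_L1_form r w" "torus_closed r w" and T: "0 \<le> T"
    and X: "closed X" "lattice_invariant X"
    and means: "\<And>p. p \<in> X \<Longrightarrow> ball_means_le (CARD('n) + 1) T (\<lambda>z. ennreal (form_l1 r (w z))) p"
  obtains v where "\<And>K. card K = r \<Longrightarrow> (\<lambda>x. v x K) \<in> borel_measurable borel" "torus_closed r v"
    "\<And>x K. x \<in> X \<Longrightarrow> v x K = w x K"
    "\<And>x K. card K = r \<Longrightarrow> x \<notin> X \<Longrightarrow> \<bar>v x K\<bar> \<le> truncation_const TYPE('n) * T"
proof (cases "X = {}")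
  case True
  show thesis
    by (rule that[of "\<lambda>x K. 0"])
      (use True T truncation_const_nonneg[where 'n='n] in \<open>simp_all add: torus_closed_def differential_pairing_def\<close>)
next
  case False
  let ?\<delta> = "lattice_distance X"
  obtain \<epsilon> \<epsilon>' where reg: "regularised_distance ?\<delta> \<epsilon> \<epsilon>'"
    by (rule regularised_distance_exists[of ?\<delta>])
      (use X False in \<open>simp_all add: lattice_distance_lipschitz lattice_periodic_lattice_distance
        lattice_distance_nonneg lattice_distance_le_1\<close>)
  note [measurable] = form_l1_measurable[OF w(1)]
  interpret smoothing_limit r w ?\<delta> \<epsilon> \<epsilon>' "T * (64 * (CARD('n) + 1)) ^ CARD('n)"
  proof
    show "(\<integral>\<^sup>+y. ennreal (form_l1 r (w (x + s *\<^sub>R y))) \<partial>unit_ball_measure) \<le> ennreal (T * (64 * (CARD('n) + 1)) ^ CARD('n))"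
      if "0 < ?\<delta> x" "?\<delta> x / 64 \<le> s" "s \<le> ?\<delta> x" for x s
      by (rule ball_average_le_lattice_distance[of "\<lambda>z. ennreal (form_l1 r (w z))", OF _ T X False means that]) simp_all
  qed (use w X T reg in \<open>simp_all add: lattice_distance_lipschitz lattice_periodic_lattice_distance lattice_distance_nonneg\<close>)
  show thesis
  proof (rule that[of limit_form])
    show "limit_form x K = w x K" if "x \<in> X" for x K
      using that lattice_distance_eq_0_iff[OF X(1) False] by (intro limit_form_eq) simp
    show "\<bar>limit_form x K\<bar> \<le> truncation_const TYPE('n) * T" if "card K = r" "x \<notin> X" for x K
    proof -
      have "0 < ?\<delta> x"
        using lattice_distance_nonneg[of X x] lattice_distance_eq_0_iff[OF X(1) False, of x] that(2) by linarith
      from abs_limit_form_le[OF that(1) this] show ?thesis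
        by (simp only: pull_const_def truncation_const_def of_nat_mult mult_ac)
    qed
  qed (rule limit_form_measurable limit_form_closed; assumption)+
qed

subsection \<open>Choice of the bad set\<close>

lemma excess_bad_set:
  fixes g :: "real^'n \<Rightarrow> real"
  assumes g: "integrable torus g" "lattice_periodic g" "\<And>x. 0 \<le> g x" and L: "0 < L"
    and I: "0 < (\<integral>x. excess L g x \<partial>torus)"
  obtains B where "open B" "lattice_invariant B" "\<And>x. x \<notin> B \<Longrightarrow> g x \<le> L"
    "\<And>x. x \<notin> B \<Longrightarrow> ball_means_le R L (\<lambda>z. ennreal (excess L g z)) x"
    "measure torus B \<le> (maximal_const TYPE('n) R + 2) / L * (\<integral>x. excess L g x \<partial>torus)"
proof -
  let ?I = "\<integral>x. excess L g x \<partial>torus" and ?A = "maximal_const TYPE('n) R"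
  have [measurable]: "g \<in> borel_measurable borel" using borel_measurable_integrable[OF g(1)] by simp
  have excess_I: "(\<integral>\<^sup>+x. ennreal (excess L g x) \<partial>torus) = ennreal ?I"
    using excess_integrable[OF g(1)] g(3) by (intro nn_integral_eq_integral) (simp_all add: excess_nonneg)
  have "(\<lambda>x. ennreal (excess L g x)) \<in> borel_measurable borel" by measurable
  from maximal_function_bad_set[OF this lattice_periodic_compose[OF lattice_periodic_excess[OF g(2)]] L]
  obtain G where G: "open G" "lattice_invariant G"
    "\<And>p. p \<notin> G \<Longrightarrow> ball_means_le R L (\<lambda>x. ennreal (excess L g x)) p"
    "emeasure torus G \<le> ennreal (?A / L) * ennreal ?I"
    unfolding excess_I by blast
  obtain H where H: "open H" "lattice_invariant H" "{x \<in> space torus. L < g x} \<subseteq> H"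
    "emeasure torus H \<le> emeasure torus {x \<in> space torus. L < g x} + ennreal (1 / L * ?I)"
    using torus_outer_regular[of "{x \<in> space torus. L < g x}" "1 / L * ?I"] I L
      lattice_periodicD[OF g(2)] by (auto simp: lattice_invariant_def)
  show thesis
  proof
    show "open (G \<union> H)" "lattice_invariant (G \<union> H)"
      using G H by (auto intro: lattice_invariant_Un)
    show "g x \<le> L" if "x \<notin> G \<union> H" for x
      using subsetD[OF H(3), of x] that by (auto simp: not_less[symmetric])
    show "ball_means_le R L (\<lambda>z. ennreal (excess L g z)) x" if "x \<notin> G \<union> H" for x
      using G(3) that by simp
    have "emeasure torus (G \<union> H) \<le> emeasure torus G + emeasure torus H"
      using G(1) H(1) by (intro emeasure_subadditive) auto
    also have "\<dots> \<le> ennreal (?A / L) * ennreal ?I + (ennreal (1 / L * ?I) + ennreal (1 / L * ?I))"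
      using G(4) H(4) emeasure_superlevel_le_excess[OF g(1,3) L]
      by (intro add_mono) (auto intro: order_trans add_right_mono)
    also have "\<dots> = ennreal ((?A + 2) / L * ?I)"
      using I L maximal_const_nonneg[where 'n='n, of R]
      by (simp add: add_divide_distrib distrib_right flip: ennreal_plus ennreal_mult)
    finally show "measure torus (G \<union> H) \<le> (?A + 2) / L * ?I"
      using I L maximal_const_nonneg[where 'n='n, of R] by (simp add: torus.emeasure_eq_measure)
  qed
qed

lemma ball_means_le_dominated:
  fixes f h :: "'a::euclidean_space \<Rightarrow> real"
  assumes [measurable]: "f \<in> borel_measurable borel"
    and means: "ball_means_le R T (\<lambda>z. ennreal (f z)) p"
    and le: "\<And>z. h z \<le> c * (a + f z)" and nonneg: "0 \<le> c" "0 \<le> a" "0 \<le> T" "\<And>z. 0 \<le> f z"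
  shows "ball_means_le R (c * (a + T)) (\<lambda>z. ennreal (h z)) p"
  unfolding ball_means_le_def
proof (intro allI impI, elim conjE)
  fix \<rho> assume \<rho>: "0 < \<rho>" "\<rho> \<le> R"
  have [measurable]: "cball p \<rho> \<in> sets borel" by (simp add: borel_closed)
  have "(\<integral>\<^sup>+z\<in>cball p \<rho>. ennreal (h z) \<partial>lborel)
      \<le> (\<integral>\<^sup>+z. ennreal c * (ennreal a * indicator (cball p \<rho>) z + ennreal (f z) * indicator (cball p \<rho>) z) \<partial>lborel)"
  proof (rule nn_integral_mono)
    fix z
    have "ennreal (h z) \<le> ennreal c * (ennreal a + ennreal (f z))"
      using le[of z] nonneg by (simp add: ennreal_leI flip: ennreal_plus ennreal_mult)
    then show "ennreal (h z) * indicator (cball p \<rho>) z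
        \<le> ennreal c * (ennreal a * indicator (cball p \<rho>) z + ennreal (f z) * indicator (cball p \<rho>) z)"
      by (auto split: split_indicator)
  qed
  also have "\<dots> = ennreal c * (ennreal a * emeasure lborel (cball p \<rho>) + (\<integral>\<^sup>+z\<in>cball p \<rho>. ennreal (f z) \<partial>lborel))"
    by (simp add: nn_integral_cmult nn_integral_add nn_integral_cmult_indicator)
  also have "\<dots> \<le> ennreal c * (ennreal a * emeasure lborel (cball p \<rho>) + ennreal T * emeasure lborel (cball p \<rho>))"
    by (intro mult_left_mono add_left_mono ball_means_leD[OF means \<rho>]) simp
  also have "\<dots> = ennreal (c * (a + T)) * emeasure lborel (cball p \<rho>)"
    using nonneg by (simp add: ennreal_mult distrib_right mult.assoc)
  finally show "(\<integral>\<^sup>+z\<in>cball p \<rho>. ennreal (h z) \<partial>lborel) \<le> ennreal (c * (a + T)) * emeasure lborel (cball p \<rho>)" .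
qed

subsection \<open>Existence of truncations\<close>

definition is_truncation :: "nat \<Rightarrow> real \<Rightarrow> real \<Rightarrow> real \<Rightarrow> 'n::{finite,linorder} form \<Rightarrow> 'n form \<Rightarrow> bool" where
  "is_truncation r C1 C2 L w v \<longleftrightarrow>
     (\<forall>K. card K = r \<longrightarrow> (\<lambda>x. v x K) \<in> borel_measurable borel) \<and>
     torus_closed r v \<and>
     (AE x in torus. form_norm r (v x) \<le> C1 * L) \<and>
     measure torus {x. form_neq r (v x) (w x)} \<le> C2 / L * (\<integral>x. excess L (\<lambda>x. form_norm r (w x)) x \<partial>torus) \<and>
     (\<integral>x. form_norm r (\<lambda>K. v x K - w x K) \<partial>torus) \<le> C2 * (\<integral>x. excess L (\<lambda>x. form_norm r (w x)) x \<partial>torus)"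

lemma is_truncation_self:
  assumes w: "periodic_L1_form r w" "torus_closed r w"
    and I: "(\<integral>x. excess L (\<lambda>x. form_norm r (w x)) x \<partial>torus) = 0" and C: "1 \<le> C1" "0 \<le> L"
  shows "is_truncation r C1 C2 L w w"
proof -
  have "AE x in torus. excess L (\<lambda>x. form_norm r (w x)) x = 0"
    using I integral_nonneg_eq_0_iff_AE[OF excess_integrable[OF periodic_L1_form_norm_integrable[OF w(1)]]]
    by (simp add: excess_nonneg)
  then have "AE x in torus. form_norm r (w x) \<le> C1 * L"
  proof eventually_elim
    case (elim x)
    have "form_norm r (w x) \<le> 1 * L"
      using le_add_excess[OF C(2), of "\<lambda>x. form_norm r (w x)" x] elim by simp
    also have "\<dots> \<le> C1 * L" using C by (intro mult_right_mono)
    finally show ?case .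
  qed
  then show ?thesis
    using w I by (simp add: is_truncation_def form_neq_def periodic_L1_form_measurable)
qed

lemma is_truncation_modification:
  assumes w: "periodic_L1_form r w" and L: "0 < L" and C: "1 \<le> C" and A: "0 \<le> A"
    and v: "\<And>K. card K = r \<Longrightarrow> (\<lambda>x. v x K) \<in> borel_measurable borel" "torus_closed r v"
    and B [measurable]: "B \<in> sets borel"
    and off: "\<And>x K. x \<notin> B \<Longrightarrow> v x K = w x K" "\<And>x. x \<notin> B \<Longrightarrow> form_norm r (w x) \<le> L"
    and on: "\<And>x. x \<in> B \<Longrightarrow> form_norm r (v x) \<le> C * L"
    and measure_B: "measure torus B \<le> A / L * (\<integral>x. excess L (\<lambda>x. form_norm r (w x)) x \<partial>torus)"
  shows "is_truncation r C ((C + 1) * A + 1) L w v"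
proof -
  let ?f = "excess L (\<lambda>x. form_norm r (w x))"
  let ?I = "\<integral>x. ?f x \<partial>torus"
  have f: "integrable torus ?f" by (rule excess_integrable[OF periodic_L1_form_norm_integrable[OF w]])
  have f_nonneg: "0 \<le> ?f x" for x by (simp add: excess_nonneg)
  have bounded: "form_norm r (v x) \<le> C * L" for x
  proof (cases "x \<in> B")
    case False
    then have "form_norm r (v x) \<le> 1 * L" using off by (simp cong: form_norm_cong)
    also have "\<dots> \<le> C * L" using C L by (intro mult_right_mono) auto
    finally show ?thesis .
  qed (rule on)
  have diff_le: "form_norm r (\<lambda>K. v x K - w x K) \<le> (C + 1) * L * indicator B x + ?f x" for x
  proof (cases "x \<in> B")
    case True
    then show ?thesis
      using form_norm_diff_le[of r "v x" "w x"] bounded[of x] le_add_excess[of L "\<lambda>x. form_norm r (w x)" x] L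
      by (simp add: algebra_simps)
  qed (simp add: off(1) f_nonneg)
  have measure_neq: "measure torus {x. form_neq r (v x) (w x)} \<le> ((C + 1) * A + 1) / L * ?I"
  proof -
    have "measure torus {x. form_neq r (v x) (w x)} \<le> measure torus B"
      using off(1) by (intro torus.finite_measure_mono) (auto simp: form_neq_def)
    also note measure_B
    also have "A / L * ?I \<le> ((C + 1) * A + 1) / L * ?I"
      using mult_nonneg_nonneg[of C A] A C L f_nonneg
      by (intro mult_right_mono divide_right_mono) (simp_all add: algebra_simps)
    finally show ?thesis .
  qed
  have "(\<integral>x. form_norm r (\<lambda>K. v x K - w x K) \<partial>torus) \<le> (\<integral>x. (C + 1) * L * indicator B x + ?f x \<partial>torus)"
    using diff_le f C L f_nonneg by (intro integral_mono') (auto simp: torus.emeasure_finite less_top[symmetric])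
  also have "\<dots> = (C + 1) * L * measure torus B + ?I"
    using f by (subst Bochner_Integration.integral_add) (auto simp: torus.emeasure_finite less_top[symmetric])
  also have "\<dots> \<le> (C + 1) * L * (A / L * ?I) + ?I"
    using measure_B C L by (intro add_mono mult_left_mono) auto
  also have "\<dots> = ((C + 1) * A + 1) * ?I" using L by (simp add: field_simps)
  finally show ?thesis
    using v bounded measure_neq by (simp add: is_truncation_def)
qed

definition sup_const :: "'n::finite itself \<Rightarrow> nat \<Rightarrow> real" where
  "sup_const _ r = 1 + 2 * (card {K :: 'n set. card K = r})\<^sup>2 * truncation_const TYPE('n)"

definition bad_set_const :: "'n::finite itself \<Rightarrow> real" where
  "bad_set_const _ = maximal_const TYPE('n) (CARD('n) + 1) + 2"

lemma sup_const_ge_1: "1 \<le> sup_const TYPE('n::finite) r"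
  by (simp add: sup_const_def truncation_const_nonneg)

lemma bad_set_const_nonneg: "0 \<le> bad_set_const TYPE('n::finite)"
  using maximal_const_nonneg[where 'n='n, of "CARD('n) + 1"] by (simp add: bad_set_const_def)

lemma truncation_exists_excess_pos:
  fixes w :: "'n::{finite,linorder} form"
  assumes w: "periodic_L1_form r w" "torus_closed r w" and L: "0 < L"
    and I: "0 < (\<integral>x. excess L (\<lambda>x. form_norm r (w x)) x \<partial>torus)"
  shows "\<exists>v. is_truncation r (sup_const TYPE('n) r) ((sup_const TYPE('n) r + 1) * bad_set_const TYPE('n) + 1) L w v"
proof -
  let ?g = "\<lambda>x. form_norm r (w x)" and ?m = "real (card {K :: 'n set. card K = r})"
  have [measurable]: "?g \<in> borel_measurable borel" by (rule periodic_L1_form_norm_measurable[OF w(1)])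
  obtain B where B: "open B" "lattice_invariant B" "\<And>x. x \<notin> B \<Longrightarrow> ?g x \<le> L"
    "\<And>x. x \<notin> B \<Longrightarrow> ball_means_le (CARD('n) + 1) L (\<lambda>z. ennreal (excess L ?g z)) x"
    "measure torus B \<le> bad_set_const TYPE('n) / L * (\<integral>x. excess L ?g x \<partial>torus)"
    using excess_bad_set[OF periodic_L1_form_norm_integrable[OF w(1)] periodic_L1_form_norm_periodic[OF w(1)] _ L I]
    unfolding bad_set_const_def by (metis form_norm_nonneg)
  have means: "ball_means_le (CARD('n) + 1) (?m * (L + L)) (\<lambda>z. ennreal (form_l1 r (w z))) p" if "p \<in> - B" for p
  proof (rule ball_means_le_dominated[OF _ B(4)])
    show "form_l1 r (w z) \<le> ?m * (L + excess L ?g z)" for z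
      using form_l1_le_form_norm[of r "w z"] mult_left_mono[OF le_add_excess[of L ?g z], of ?m] L by simp
  qed (use that L in \<open>simp_all add: excess_nonneg\<close>)
  have X: "closed (- B)" "lattice_invariant (- B)" "0 \<le> ?m * (L + L)"
    using B(1,2) L by (simp_all add: lattice_invariant_Compl closed_Compl)
  obtain v where v: "\<And>K. card K = r \<Longrightarrow> (\<lambda>x. v x K) \<in> borel_measurable borel" "torus_closed r v"
    "\<And>x K. x \<in> - B \<Longrightarrow> v x K = w x K"
    "\<And>x K. card K = r \<Longrightarrow> x \<notin> - B \<Longrightarrow> \<bar>v x K\<bar> \<le> truncation_const TYPE('n) * (?m * (L + L))"
    using truncate_off_closed_set[OF w X(3,1,2) means] by blast
  have "form_norm r (v x) \<le> sup_const TYPE('n) r * L" if "x \<in> B" for x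
  proof -
    have "form_norm r (v x) \<le> ?m * (truncation_const TYPE('n) * (?m * (L + L)))"
      using v(4) that by (intro order_trans[OF form_norm_le_form_l1] form_l1_le_card) simp
    then show ?thesis
      using L by (simp add: sup_const_def algebra_simps power2_eq_square)
  qed
  then have "is_truncation r (sup_const TYPE('n) r) ((sup_const TYPE('n) r + 1) * bad_set_const TYPE('n) + 1) L w v"
    using B v by (intro is_truncation_modification[OF w(1) L sup_const_ge_1 bad_set_const_nonneg, where B=B]) auto
  then show ?thesis by blast
qed

theorem torus_truncation:
  fixes r :: nat
  shows "\<exists>C1>0. \<exists>C2>0. \<forall>(w :: 'n::{finite,linorder} form) L.
    periodic_L1_form r w \<and> torus_closed r w \<and> 0 < L \<longrightarrow> (\<exists>v. is_truncation r C1 C2 L w v)"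
proof -
  let ?C = "sup_const TYPE('n) r" and ?A = "bad_set_const TYPE('n)"
  have "\<exists>v. is_truncation r ?C ((?C + 1) * ?A + 1) L w v"
    if w: "periodic_L1_form r w" "torus_closed r w" and L: "0 < L" for w :: "'n form" and L
  proof (cases "(\<integral>x. excess L (\<lambda>x. form_norm r (w x)) x \<partial>torus) = 0")
    case True
    then show ?thesis using is_truncation_self[OF w True sup_const_ge_1] L by auto
  next
    case False
    then have "0 < (\<integral>x. excess L (\<lambda>x. form_norm r (w x)) x \<partial>torus)"
      by (simp add: less_le excess_nonneg)
    then show ?thesis by (rule truncation_exists_excess_pos[OF w L])
  qed
  moreover have "0 < ?C" "0 < (?C + 1) * ?A + 1"
    using sup_const_ge_1[where 'n='n, of r] bad_set_const_nonneg[where 'n='n] by (simp_all add: add_nonneg_pos)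
  ultimately show ?thesis by blast
qed

section \<open>Transfer to Lebesgue measure on the cube\<close>

lemma AE_torus_cube_iff_unit_cell: "AE x in lborel. (x :: real^'n) \<in> torus_cube \<longleftrightarrow> x \<in> unit_cell"
proof -
  have "AE x in lebesgue. (x :: real^'n) \<notin> cbox 0 1 - box 0 1"
    using negligible_frontier_interval[of "0 :: real^'n" 1] unfolding negligible_iff_null_sets by (rule AE_not_in)
  then have "AE x in lborel. (x :: real^'n) \<notin> cbox 0 1 - box 0 1"
    by (simp only: AE_completion_iff)
  then show ?thesis
  proof eventually_elim
    case (elim x)
    then show ?case using unit_cell_bounds[where 'n='n] unfolding torus_cube_def by blast
  qed
qed

lemma AE_torus_cubeI:
  assumes "AE x in torus. P x"
  shows "AE x in lebesgue. x \<in> torus_cube \<longrightarrow> P x"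
proof (rule AE_completion)
  show "AE x in lborel. x \<in> torus_cube \<longrightarrow> P x"
    using assms[unfolded AE_torus_iff] AE_torus_cube_iff_unit_cell by eventually_elim blast
qed

lemma
  fixes F G :: "real^'n \<Rightarrow> real"
  assumes [measurable]: "G \<in> borel_measurable borel"
    and eq: "AE x in torus. F x = G x"
  shows set_integral_torus_cube: "(LINT x:torus_cube|lebesgue. F x) = (\<integral>x. G x \<partial>torus)"
    and set_integrable_torus_cube_iff: "set_integrable lebesgue torus_cube F \<longleftrightarrow> integrable torus G"
proof -
  let ?F = "\<lambda>x. indicator torus_cube x *\<^sub>R F x" and ?G = "\<lambda>x. indicator unit_cell x * G x"
  have torus_density: "torus = density lborel (\<lambda>x. ennreal (indicator unit_cell x))"
    by (simp add: torus_def ennreal_indicator)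
  have G: "?G \<in> borel_measurable lborel" by measurable
  have G_lebesgue: "?G \<in> borel_measurable lebesgue" by (rule measurable_completion[OF G])
  have AE_eq: "AE x in lebesgue. ?F x = ?G x"
  proof (rule AE_completion)
    show "AE x in lborel. ?F x = ?G x"
      using eq[unfolded AE_torus_iff] AE_torus_cube_iff_unit_cell by eventually_elim (simp add: indicator_def)
  qed
  have F: "?F \<in> borel_measurable lebesgue"
    by (rule borel_measurable_AE[OF G_lebesgue]) (use AE_eq in \<open>auto simp: eq_commute\<close>)
  show "(LINT x:torus_cube|lebesgue. F x) = (\<integral>x. G x \<partial>torus)"
    unfolding set_lebesgue_integral_def integral_cong_AE[OF F G_lebesgue AE_eq] integral_completion[OF G] torus_density
    by (rule integral_real_density[symmetric]) auto
  show "set_integrable lebesgue torus_cube F \<longleftrightarrow> integrable torus G"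
    unfolding set_integrable_def integrable_cong_AE[OF F G_lebesgue AE_eq] integrable_completion[OF G] torus_density
    by (subst integrable_real_density) auto
qed

lemma measure_torus_cube:
  fixes P Q :: "real^'n \<Rightarrow> bool"
  assumes [measurable]: "{x. Q x} \<in> sets borel" and eq: "AE x in torus. P x \<longleftrightarrow> Q x"
  shows "measure lebesgue {x \<in> torus_cube. P x} = measure torus {x. Q x}"
proof -
  have "measure lebesgue {x \<in> torus_cube. P x} = (LINT x:torus_cube|lebesgue. indicator {x. P x} x)"
    by (simp add: set_lebesgue_integral_def Collect_conj_eq flip: indicator_inter_arith)
  also have "\<dots> = (\<integral>x. indicator {x. Q x} x \<partial>torus)"
  proof (rule set_integral_torus_cube)
    show "AE x in torus. indicat_real {x. P x} x = indicator {x. Q x} x"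
      using eq by eventually_elim (simp add: indicator_def)
  qed measurable
  finally show ?thesis by simp
qed

lemma set_integral_superlevel_eq_excess:
  fixes f g :: "real^'n \<Rightarrow> real"
  assumes [measurable]: "g \<in> borel_measurable borel" and eq: "AE x in torus. f x = g x"
  shows "(LINT y:{y \<in> torus_cube. L < f y}|lebesgue. f y) = (\<integral>x. excess L g x \<partial>torus)"
proof -
  have "(LINT y:{y \<in> torus_cube. L < f y}|lebesgue. f y) = (LINT y:torus_cube|lebesgue. excess L f y)"
    unfolding set_lebesgue_integral_def
    by (intro Bochner_Integration.integral_cong) (auto simp: excess_def indicator_def)
  also have "\<dots> = (\<integral>x. excess L g x \<partial>torus)"
    by (rule set_integral_torus_cube) (use eq in \<open>auto elim!: eventually_mono simp: excess_def\<close>)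
  finally show ?thesis .
qed

lemma closed_form_iff_torus_closed:
  fixes u w :: "'n::{finite,linorder} form"
  assumes w: "\<And>K. card K = r \<Longrightarrow> (\<lambda>x. w x K) \<in> borel_measurable borel"
    and eq: "AE x in torus. \<forall>K. card K = r \<longrightarrow> w x K = u x K"
  shows "closed_form r u \<longleftrightarrow> torus_closed r w"
proof -
  have "(LINT x:torus_cube|lebesgue. u x (J - {j}) * pderiv j \<phi> x) = (\<integral>x. w x (J - {j}) * pderiv j \<phi> x \<partial>torus)"
    if "card J = Suc r" "smooth_fun \<phi>" "j \<in> J" for J j \<phi>
  proof (rule set_integral_torus_cube)
    have card: "card (J - {j}) = r" using that by simp
    show "(\<lambda>x. w x (J - {j}) * pderiv j \<phi> x) \<in> borel_measurable borel"
      by (intro borel_measurable_times w card smooth_fun_pderiv_measurable that)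
    show "AE x in torus. u x (J - {j}) * pderiv j \<phi> x = w x (J - {j}) * pderiv j \<phi> x"
      using eq by eventually_elim (simp add: card)
  qed
  then have "(\<Sum>j\<in>J. (-1::real) ^ card {k\<in>J. k < j} * (LINT x:torus_cube|lebesgue. u x (J - {j}) * pderiv j \<phi> x))
     = differential_pairing w (gradient \<phi>) J" if "card J = Suc r" "smooth_fun \<phi>" for J \<phi>
    unfolding fsign_def differential_pairing_def using that by (intro sum.cong) (auto simp: gradient_def)
  then show ?thesis unfolding closed_form_def torus_closed_def by (metis (no_types, lifting))
qed

lemma AE_torus_borel_representative:
  fixes f :: "real^'n \<Rightarrow> real"
  assumes "set_integrable lebesgue torus_cube f"
  obtains g where "g \<in> borel_measurable borel" "AE x in torus. g x = f x"
proof -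
  have "(\<lambda>x. indicator torus_cube x *\<^sub>R f x) \<in> borel_measurable lebesgue"
    using assms unfolding set_integrable_def by (rule borel_measurable_integrable)
  then obtain g where g: "g \<in> borel_measurable lborel" "AE x in lborel. indicator torus_cube x *\<^sub>R f x = g x"
    using completion_ex_borel_measurable_real by blast
  from g(2) AE_torus_cube_iff_unit_cell have "AE x in torus. g x = f x"
    unfolding AE_torus_iff by eventually_elim auto
  then show thesis using g(1) by (intro that) simp_all
qed

lemma periodic_L1_form_representative:
  fixes u :: "'n::{finite,linorder} form"
  assumes u: "\<And>K. card K = r \<Longrightarrow> set_integrable lebesgue torus_cube (\<lambda>y. u y K)"
  obtains w where "periodic_L1_form r w" "AE x in torus. \<forall>K. card K = r \<longrightarrow> w x K = u x K"
proof -
  have "\<exists>g. g \<in> borel_measurable borel \<and> (AE x in torus. g x = u x K)" if "card K = r" for K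
    using AE_torus_borel_representative[OF u[OF that]] by blast
  then obtain g where g: "\<And>K. card K = r \<Longrightarrow> g K \<in> borel_measurable borel"
    "\<And>K. card K = r \<Longrightarrow> AE x in torus. g K x = u x K"
    by metis
  define w where "w x K = g K (wrap x)" for x K
  have w_eq: "AE x in torus. w x K = u x K" if "card K = r" for K
    using g(2)[OF that] unfolding AE_torus_iff by eventually_elim (simp add: w_def wrap_id)
  have w_borel: "(\<lambda>x. w x K) \<in> borel_measurable borel" if "card K = r" for K
    unfolding w_def using g(1)[OF that] by measurable
  have "AE x in torus. u x K = w x K" if "card K = r" for K
    using w_eq[OF that] by eventually_elim simp
  then have "periodic_L1_form r w"
    unfolding periodic_L1_form_def using set_integrable_torus_cube_iff[OF w_borel] u
    by (auto simp: w_def intro: lattice_periodic_comp_wrap)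
  moreover have "AE x in torus. \<forall>K\<in>{K. card K = r}. w x K = u x K"
    using w_eq by (subst AE_finite_all) auto
  ultimately show thesis by (intro that[of w]) simp_all
qed

lemma truncation_transfer:
  fixes u v w :: "'n::{finite,linorder} form"
  assumes w: "periodic_L1_form r w" and eq: "AE x in torus. \<forall>K. card K = r \<longrightarrow> w x K = u x K"
    and trunc: "is_truncation r C1 C2 L w v"
  shows "\<forall>K. card K = r \<longrightarrow> set_borel_measurable lebesgue torus_cube (\<lambda>y. v y K)"
    and "closed_form r v"
    and "AE y in lebesgue. y \<in> torus_cube \<longrightarrow> form_norm r (v y) \<le> C1 * L"
    and "measure lebesgue {y \<in> torus_cube. form_neq r (v y) (u y)}
      \<le> C2 / L * (LINT y:{y \<in> torus_cube. form_norm r (u y) > L}|lebesgue. form_norm r (u y))"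
    and "(LINT y:torus_cube|lebesgue. form_norm r (\<lambda>K. v y K - u y K))
      \<le> C2 * (LINT y:{y \<in> torus_cube. form_norm r (u y) > L}|lebesgue. form_norm r (u y))"
proof -
  have v: "\<And>K. card K = r \<Longrightarrow> (\<lambda>x. v x K) \<in> borel_measurable borel" "torus_closed r v"
    "AE x in torus. form_norm r (v x) \<le> C1 * L"
    using trunc by (simp_all add: is_truncation_def)
  note w_borel = periodic_L1_form_measurable[OF w]
  have eq_norm: "AE x in torus. form_norm r (u x) = form_norm r (w x)"
    and eq_neq: "AE x in torus. form_neq r (v x) (u x) \<longleftrightarrow> form_neq r (v x) (w x)"
    and eq_diff: "AE x in torus. form_norm r (\<lambda>K. v x K - u x K) = form_norm r (\<lambda>K. v x K - w x K)"
    using eq by (auto elim!: eventually_mono simp: form_neq_def intro!: form_norm_cong)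
  have excess_eq: "(LINT y:{y \<in> torus_cube. form_norm r (u y) > L}|lebesgue. form_norm r (u y))
      = (\<integral>x. excess L (\<lambda>x. form_norm r (w x)) x \<partial>torus)"
    by (rule set_integral_superlevel_eq_excess[OF periodic_L1_form_norm_measurable[OF w] eq_norm])
  have diff_eq: "(LINT y:torus_cube|lebesgue. form_norm r (\<lambda>K. v y K - u y K))
      = (\<integral>x. form_norm r (\<lambda>K. v x K - w x K) \<partial>torus)"
    using v(1) w_borel by (intro set_integral_torus_cube[OF form_norm_borel_measurable eq_diff] borel_measurable_diff)
  show "\<forall>K. card K = r \<longrightarrow> set_borel_measurable lebesgue torus_cube (\<lambda>y. v y K)"
  proof (intro allI impI)
    fix K :: "'n set" assume "card K = r"
    then have "(\<lambda>x. indicat_real torus_cube x *\<^sub>R v x K) \<in> borel_measurable lborel"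
      unfolding torus_cube_def using v(1) by (intro borel_measurable_scaleR borel_measurable_indicator) auto
    then show "set_borel_measurable lebesgue torus_cube (\<lambda>y. v y K)"
      unfolding set_borel_measurable_def by (rule measurable_completion)
  qed
  show "closed_form r v" using closed_form_iff_torus_closed[where u=v, OF v(1)] v(2) by simp
  show "AE y in lebesgue. y \<in> torus_cube \<longrightarrow> form_norm r (v y) \<le> C1 * L"
    by (rule AE_torus_cubeI[OF v(3)])
  show "measure lebesgue {y \<in> torus_cube. form_neq r (v y) (u y)}
      \<le> C2 / L * (LINT y:{y \<in> torus_cube. form_norm r (u y) > L}|lebesgue. form_norm r (u y))"
    using trunc measure_torus_cube[OF form_neq_borel[OF v(1) w_borel] eq_neq]
    by (simp only: is_truncation_def excess_eq)
  show "(LINT y:torus_cube|lebesgue. form_norm r (\<lambda>K. v y K - u y K))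
      \<le> C2 * (LINT y:{y \<in> torus_cube. form_norm r (u y) > L}|lebesgue. form_norm r (u y))"
    using trunc by (simp only: is_truncation_def excess_eq diff_eq)
qed

theorem theorem4p1:
  fixes r :: nat
  assumes "r \<le> CARD('n::{finite,linorder})"
  shows "\<exists>C1 C2 :: real. C1 > 0 \<and> C2 > 0 \<and>
    (\<forall>(u :: (real,'n) vec \<Rightarrow> ('n set \<Rightarrow> real)) (L :: real).
       (\<forall>K. card K = r \<longrightarrow> set_integrable lebesgue torus_cube (\<lambda>y. u y K)) \<and>
       closed_form r u \<and> L > 0 \<longrightarrow>
       (\<exists>v :: (real,'n) vec \<Rightarrow> ('n set \<Rightarrow> real).
          (\<forall>K. card K = r \<longrightarrow> set_borel_measurable lebesgue torus_cube (\<lambda>y. v y K)) \<and>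
          closed_form r v \<and>
          (AE y in lebesgue. y \<in> torus_cube \<longrightarrow> form_norm r (v y) \<le> C1 * L) \<and>
          measure lebesgue {y \<in> torus_cube. form_neq r (v y) (u y)}
            \<le> C2 / L * (LINT y:{y \<in> torus_cube. form_norm r (u y) > L}|lebesgue. form_norm r (u y)) \<and>
          (LINT y:torus_cube|lebesgue. form_norm r (\<lambda>K. v y K - u y K))
            \<le> C2 * (LINT y:{y \<in> torus_cube. form_norm r (u y) > L}|lebesgue. form_norm r (u y))))"
proof -
  obtain C1 C2 :: real where C: "0 < C1" "0 < C2"
    and truncation: "\<forall>(w :: 'n form) L. periodic_L1_form r w \<and> torus_closed r w \<and> 0 < L \<longrightarrow>
      (\<exists>v. is_truncation r C1 C2 L w v)"
    using torus_truncation[where r=r] by blast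
  show ?thesis
  proof (rule exI[of _ C1], rule exI[of _ C2], intro conjI allI impI C; elim conjE; goal_cases)
    case (1 u L)
    then obtain w where w: "periodic_L1_form r w" and eq: "AE x in torus. \<forall>K. card K = r \<longrightarrow> w x K = u x K"
      by (blast intro: periodic_L1_form_representative)
    have "torus_closed r w"
      using closed_form_iff_torus_closed[OF periodic_L1_form_measurable[OF w] eq] 1(2) by simp
    then obtain v where "is_truncation r C1 C2 L w v"
      using truncation w 1(3) by blast
    from truncation_transfer[OF w eq this] show ?case by blast
  qed
qed

end
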